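(* Let $\mathcal R=A_l$, $1\le\bar k\le l$, and let $D$ be the discriminant stratum determined by a partition of $\{1,\dots,l+1\}$ into $d+1$ blocks of sizes $m_1,\dots,m_{d+1}\ge1$, $\sum_a m_a=l+1$, on which the functions $a_i$ ($1\le i\le l+1$) with index in the $a$-th block all coincide, with common value $\hat\xi_a$. Then, in the frame of linear coordinates on $D$ (including $x_{l+1}$, so $\dim D=d+1$), the determinant of the pull-back $\eta_D$ of the Saito metric satisfies $$\det\eta_D\;\propto\;a_0^{\,d+1}\prod_{a=1}^{d+1}\hat\xi_a^{\,-\bar k}\prod_{1\le a<b\le d+1}(\hat\xi_a-\hat\xi_b)^{m_a+m_b},$$ with a non-zero constant of proportionality depending on the stratum.
   Context: Root data: $\mathcal R=A_l$ with Cartan subalgebra $\mathfrak h$, form $(\cdot,\cdot)$ with $(\alpha,\alpha)=2$ for roots $\alpha$, simple roots $\alpha_i$, fundamental weights $\omega_i$ ($(\omega_i,\alpha_j)=\delta_{ij}$), Weyl group $\mathcal W$; $d_i=(\omega_i,\omega_{\bar k})$. For $x\in\mathfrak h$ put $\tilde x_i=(\omega_i,x)$, $\tilde x_0=\tilde x_{l+1}=0$ here, and let $x_{l+1}$ be the coordinate on the second summand of $\mathfrak h\oplus\mathbb C$. Set $$a_0=\mathrm e^{d_{\bar k}x_{l+1}},\qquad a_i=\mathrm e^{\tilde x_{i-1}-\tilde x_i}\quad(1\le i\le l+1),$$ so $\prod_{i=1}^{l+1}a_i=1$ and the logarithms of the $a_i/a_j$, $i\neq j$, are the roots. On $D$ one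 has $\prod_a\hat\xi_a^{m_a}=1$, and each $\hat\xi_a$ is the exponential of a linear form on $D$. Saito metric (Dubrovin–Zhang): with $Y_i=\sum_{w\in\mathcal W}\mathrm e^{(w\omega_i,x)}$, $y_i=\mathrm e^{d_ix_{l+1}}Y_i$ ($i\le l$), $y_{l+1}=x_{l+1}$, and $\gamma$ the constant form equal to $(\cdot,\cdot)$ on $\mathfrak h$ plus $\gamma(\partial_{x_{l+1}},\partial_{x_{l+1}})=-d_{\bar k}$, the metric $\eta$ has contravariant form $\mathcal L_e\gamma^{-1}$, $e$ being a non-zero constant multiple of $\partial/\partial y_{\bar k}$ (overall constant normalisation immaterial). Its pull-back $\eta_D$ to $D$ is equivalently given by the Landau–Ginzburg residue formula $$\eta_D(\zeta_1,\zeta_2)=(-1)^{\bar k+1}\sum_{q_s}\operatorname*{Res}_{\hat\mu=q_s}\frac{\zeta_1(\lambda_D)\,\zeta_2(\lambda_D)}{\hat\mu^2\,\lambda_D'}\,\mathrm d\hat\mu,\qquad \lambda_D(\hat\mu)=\frac{(-1)^{l+\bar k}a_0}{\hat\mu^{\bar k}}\prod_{a=1}^{d+1}(\hat\mu-\hat\xi_a)^{m_a},$$ where the sum is over the $d+1$ critical points $q_s$ of $\lambda_D$ other than the $\hat\xi_a$, the prime is $\mathrm d/\mathrm d\hat\mu$, and vector fields $\zeta_i$ on $D$ act on $\lambda_D$ at fixed $\hat\mu$. $p\propto q$ means $p=c\,q$ with $c$ a non-zero constant. *)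

theory Defs
  imports
    "HOL-Analysis.Analysis"
    "HOL-Combinatorics.Permutations"
    "Jordan_Normal_Form.Gauss_Jordan_Elimination"
    "Jordan_Normal_Form.Determinant"
begin

section \<open>Root data of type A\<close>

text \<open>
  The Cartan subalgebra is the complex hyperplane of vectors with coordinates \<open>1, \<dots>, l + 1\<close> and
  coordinate sum zero, the roots are \<open>\<epsilon>\<^sub>i - \<epsilon>\<^sub>j\<close>, and the Weyl group is the group of permutations of
  the coordinates. Indices are 1-based throughout, except for matrix entries, which the library
  numbers from 0.
\<close>

definition root_form :: "nat \<Rightarrow> (nat \<Rightarrow> complex) \<Rightarrow> (nat \<Rightarrow> complex) \<Rightarrow> complex" where
  "root_form l u v = (\<Sum>j = 1..l+1. u j * v j)"

definition simple_root :: "nat \<Rightarrow> nat \<Rightarrow> complex" where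
  "simple_root i = (\<lambda>j. if j = i then 1 else if j = i + 1 then - 1 else 0)"

definition fund_weight :: "nat \<Rightarrow> nat \<Rightarrow> nat \<Rightarrow> complex" where
  "fund_weight l i = (\<lambda>j. if j \<in> {1..l+1}
     then (if j \<le> i then 1 else 0) - of_nat i / of_nat (l + 1) else 0)"

definition weyl_group :: "nat \<Rightarrow> (nat \<Rightarrow> nat) set" where
  "weyl_group l = {w. w permutes {1..l+1}}"

definition weyl_act :: "(nat \<Rightarrow> nat) \<Rightarrow> (nat \<Rightarrow> complex) \<Rightarrow> nat \<Rightarrow> complex" where
  "weyl_act w v = (\<lambda>j. v (inv_into UNIV w j))"

lemma sum_simple_root_mult:
  assumes "i \<in> {1..l}"
  shows "(\<Sum>j = 1..l+1. f j * simple_root i j) = f i - f (i + 1)"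
proof -
  have "(\<Sum>j = 1..l+1. f j * simple_root i j)
      = (\<Sum>j = 1..l+1. (if j = i then f j else 0) - (if j = i + 1 then f j else 0))"
    by (rule sum.cong) (auto simp: simple_root_def)
  also have "\<dots> = f i - f (i + 1)"
    using assms by (simp add: sum_subtractf)
  finally show ?thesis .
qed

lemma simple_root_norm: "i \<in> {1..l} \<Longrightarrow> root_form l (simple_root i) (simple_root i) = 2"
  unfolding root_form_def by (subst sum_simple_root_mult) (auto simp: simple_root_def)

lemma fund_weight_dual:
  assumes "i \<in> {1..l}" "j \<in> {1..l}"
  shows "root_form l (fund_weight l i) (simple_root j) = (if i = j then 1 else 0)"
  using assms unfolding root_form_def
  by (subst sum_simple_root_mult) (auto simp: fund_weight_def)

lemma sum_fund_weight:
  assumes "i \<in> {1..l}"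
  shows "(\<Sum>j = 1..l+1. fund_weight l i j) = 0"
proof -
  have "(\<Sum>j = 1..l+1. fund_weight l i j)
      = (\<Sum>j = 1..l+1. (if j \<le> i then 1 else 0)) - of_nat i"
    by (simp add: fund_weight_def sum_subtractf del: sum.cl_ivl_Suc of_nat_Suc)
  also have "(\<Sum>j = 1..l+1. (if j \<le> i then 1 else 0 :: complex)) = (\<Sum>j \<in> {1..i}. 1)"
    using assms by (intro sum.mono_neutral_cong_right) auto
  finally show ?thesis by simp
qed

lemma simple_reflection_eq_transposition:
  assumes "i \<in> {1..l}"
  shows "(\<lambda>j. v j - root_form l v (simple_root i) * simple_root i j)
       = weyl_act (Transposition.transpose i (i + 1)) v"
  unfolding root_form_def sum_simple_root_mult[OF assms]
  by (auto simp: fun_eq_iff simple_root_def weyl_act_def Transposition.transpose_def)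


section \<open>Linear coordinates on the direct sum of the Cartan subalgebra and the complex line\<close>

text \<open>
  A point of the \<open>(l+1)\<close>-dimensional space is given by its coordinates \<open>x\<close> in the basis consisting
  of the simple roots and the generator of the second summand; \<open>x (l + 1)\<close> is the coordinate on
  that summand.
\<close>

definition coord_space :: "nat \<Rightarrow> (nat \<Rightarrow> complex) set" where
  "coord_space n = {x. \<forall>i. i \<notin> {1..n} \<longrightarrow> x i = 0}"

definition cartan_part :: "nat \<Rightarrow> (nat \<Rightarrow> complex) \<Rightarrow> nat \<Rightarrow> complex" where
  "cartan_part l x = (\<lambda>j. \<Sum>i = 1..l. x i * simple_root i j)"

definition x_tilde :: "nat \<Rightarrow> (nat \<Rightarrow> complex) \<Rightarrow> nat \<Rightarrow> complex" where
  "x_tilde l x i =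
     (if i \<in> {1..l} then root_form l (fund_weight l i) (cartan_part l x) else 0)"

lemma x_tilde_eq:
  assumes "i \<in> {1..l}"
  shows "x_tilde l x i = x i"
proof -
  have "x_tilde l x i = (\<Sum>j = 1..l+1. \<Sum>r = 1..l. x r * (fund_weight l i j * simple_root r j))"
    using assms by (simp add: x_tilde_def root_form_def cartan_part_def sum_distrib_left
        mult.left_commute del: sum.cl_ivl_Suc)
  also have "\<dots> = (\<Sum>r = 1..l. x r * root_form l (fund_weight l i) (simple_root r))"
    by (subst sum.swap) (simp add: root_form_def sum_distrib_left del: sum.cl_ivl_Suc)
  also have "\<dots> = (\<Sum>r = 1..l. if r = i then x r else 0)"
    using assms by (intro sum.cong refl) (auto simp: fund_weight_dual)
  also have "\<dots> = x i"
    using assms by simp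
  finally show ?thesis .
qed

definition d_coeff :: "nat \<Rightarrow> nat \<Rightarrow> nat \<Rightarrow> complex" where
  "d_coeff l k i = root_form l (fund_weight l i) (fund_weight l k)"

definition a0 :: "nat \<Rightarrow> nat \<Rightarrow> (nat \<Rightarrow> complex) \<Rightarrow> complex" where
  "a0 l k x = exp (d_coeff l k k * x (l + 1))"

definition a_fun :: "nat \<Rightarrow> (nat \<Rightarrow> complex) \<Rightarrow> nat \<Rightarrow> complex" where
  "a_fun l x i = exp (x_tilde l x (i - 1) - x_tilde l x i)"


section \<open>The Saito metric\<close>

definition partial_deriv :: "nat \<Rightarrow> ((nat \<Rightarrow> complex) \<Rightarrow> complex) \<Rightarrow> (nat \<Rightarrow> complex) \<Rightarrow> complex" where
  "partial_deriv j f x = deriv (\<lambda>t. f (x(j := t))) (x j)"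

definition inverse_matrix :: "complex mat \<Rightarrow> complex mat" where
  "inverse_matrix A = the (mat_inverse A)"

definition gamma_matrix :: "nat \<Rightarrow> nat \<Rightarrow> complex mat" where
  "gamma_matrix l k = Matrix.mat (l + 1) (l + 1) (\<lambda>(i, j).
     if i < l \<and> j < l then root_form l (simple_root (i + 1)) (simple_root (j + 1))
     else if i = l \<and> j = l then - d_coeff l k k else 0)"

text \<open>The function \<open>\<gamma>\<^sup>-\<^sup>1(df, dg)\<close>.\<close>

definition gamma_inv ::
  "nat \<Rightarrow> nat \<Rightarrow> ((nat \<Rightarrow> complex) \<Rightarrow> complex) \<Rightarrow> ((nat \<Rightarrow> complex) \<Rightarrow> complex)
     \<Rightarrow> (nat \<Rightarrow> complex) \<Rightarrow> complex" where
  "gamma_inv l k f g x = (\<Sum>i = 1..l+1. \<Sum>j = 1..l+1.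
     inverse_matrix (gamma_matrix l k) $$ (i - 1, j - 1) * partial_deriv i f x * partial_deriv j g x)"

definition Y_fun :: "nat \<Rightarrow> nat \<Rightarrow> (nat \<Rightarrow> complex) \<Rightarrow> complex" where
  "Y_fun l i x =
     (\<Sum>w \<in> weyl_group l. exp (root_form l (weyl_act w (fund_weight l i)) (cartan_part l x)))"

definition y_map :: "nat \<Rightarrow> nat \<Rightarrow> (nat \<Rightarrow> complex) \<Rightarrow> nat \<Rightarrow> complex" where
  "y_map l k x = (\<lambda>i.
     if i \<in> {1..l} then exp (d_coeff l k i * x (l + 1)) * Y_fun l i x
     else if i = l + 1 then x (l + 1) else 0)"

text \<open>
  The components \<open>\<gamma>\<^sup>-\<^sup>1(dy\<^sub>i, dy\<^sub>j)\<close> as functions of \<open>p = (y\<^sub>1, \<dots>, y\<^sub>l\<^sub>+\<^sub>1)\<close>: they are constant on the fibres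
  of the (surjective) map \<open>x \<mapsto> y\<close>, so the preimage of \<open>p\<close> at which they are evaluated does not
  matter.
\<close>

definition gamma_inv_y :: "nat \<Rightarrow> nat \<Rightarrow> nat \<Rightarrow> nat \<Rightarrow> (nat \<Rightarrow> complex) \<Rightarrow> complex" where
  "gamma_inv_y l k i j p = gamma_inv l k (\<lambda>x. y_map l k x i) (\<lambda>x. y_map l k x j)
     (inv_into (coord_space (l + 1)) (y_map l k) p)"

text \<open>
  Lie derivative, along a vector field with components \<open>e\<close>, of a contravariant 2-tensor with
  components \<open>T\<close>, in \<open>n\<close> coordinates.
\<close>

definition lie_deriv ::
  "nat \<Rightarrow> (nat \<Rightarrow> (nat \<Rightarrow> complex) \<Rightarrow> complex) \<Rightarrow> (nat \<Rightarrow> nat \<Rightarrow> (nat \<Rightarrow> complex) \<Rightarrow> complex)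
     \<Rightarrow> nat \<Rightarrow> nat \<Rightarrow> (nat \<Rightarrow> complex) \<Rightarrow> complex" where
  "lie_deriv n e T i j p = (\<Sum>m = 1..n.
       e m p * partial_deriv m (T i j) p
     - T m j p * partial_deriv m (e i) p
     - T i m p * partial_deriv m (e j) p)"

text \<open>The vector field \<open>\<kappa> \<partial>/\<partial>y\<^sub>k\<close>, in the coordinates \<open>y\<close>.\<close>

definition e_field :: "nat \<Rightarrow> complex \<Rightarrow> nat \<Rightarrow> (nat \<Rightarrow> complex) \<Rightarrow> complex" where
  "e_field k \<kappa> m p = (if m = k then \<kappa> else 0)"

definition saito_contravariant :: "nat \<Rightarrow> nat \<Rightarrow> complex \<Rightarrow> (nat \<Rightarrow> complex) \<Rightarrow> complex mat" where
  "saito_contravariant l k \<kappa> p = Matrix.mat (l + 1) (l + 1) (\<lambda>(i, j).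
     lie_deriv (l + 1) (e_field k \<kappa>) (gamma_inv_y l k) (i + 1) (j + 1) p)"

definition saito_covariant :: "nat \<Rightarrow> nat \<Rightarrow> complex \<Rightarrow> (nat \<Rightarrow> complex) \<Rightarrow> complex mat" where
  "saito_covariant l k \<kappa> p = inverse_matrix (saito_contravariant l k \<kappa> p)"

text \<open>
  The pull-back of the Saito metric along \<open>x \<mapsto> y\<close>, at \<open>x\<close>, on tangent vectors \<open>u\<close> and \<open>v\<close>. As
  the components of the metric in the coordinates \<open>y\<close> are regular on the whole orbit space, this
  makes sense on the discriminant too, where \<open>x \<mapsto> y\<close> is not a local diffeomorphism. The pull-back
  to a stratum is its restriction to tangent vectors of the stratum.
\<close>

definition dy_apply :: "nat \<Rightarrow> nat \<Rightarrow> (nat \<Rightarrow> complex) \<Rightarrow> (nat \<Rightarrow> complex) \<Rightarrow> nat \<Rightarrow> complex" where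
  "dy_apply l k x u i = (\<Sum>m = 1..l+1. partial_deriv m (\<lambda>z. y_map l k z i) x * u m)"

definition saito_pullback ::
  "nat \<Rightarrow> nat \<Rightarrow> complex \<Rightarrow> (nat \<Rightarrow> complex) \<Rightarrow> (nat \<Rightarrow> complex) \<Rightarrow> (nat \<Rightarrow> complex) \<Rightarrow> complex" where
  "saito_pullback l k \<kappa> x u v = (\<Sum>i = 1..l+1. \<Sum>j = 1..l+1.
     saito_covariant l k \<kappa> (y_map l k x) $$ (i - 1, j - 1) * dy_apply l k x u i * dy_apply l k x v j)"


section \<open>Discriminant strata\<close>

definition is_block_partition :: "nat \<Rightarrow> nat \<Rightarrow> (nat \<Rightarrow> nat set) \<Rightarrow> bool" where
  "is_block_partition l d B \<longleftrightarrow>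
     (\<Union>b \<in> {1..d+1}. B b) = {1..l+1} \<and> disjoint_family_on B {1..d+1} \<and> (\<forall>b \<in> {1..d+1}. B b \<noteq> {})"

text \<open>
  The stratum is the linear subspace on which the logarithms of the \<open>a\<^sub>i\<close> in each block coincide.
  (The equations \<open>a\<^sub>i = a\<^sub>j\<close> by themselves would also allow translates of it by periods of the
  exponential, on which \<open>log \<xi>\<^sub>b\<close> is no longer a linear form.)
\<close>

definition stratum :: "nat \<Rightarrow> nat \<Rightarrow> (nat \<Rightarrow> nat set) \<Rightarrow> (nat \<Rightarrow> complex) set" where
  "stratum l d B = {x \<in> coord_space (l + 1). \<forall>b \<in> {1..d+1}. \<forall>i \<in> B b. \<forall>j \<in> B b.
     x_tilde l x (i - 1) - x_tilde l x i = x_tilde l x (j - 1) - x_tilde l x j}"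

definition xi :: "nat \<Rightarrow> (nat \<Rightarrow> nat set) \<Rightarrow> (nat \<Rightarrow> complex) \<Rightarrow> nat \<Rightarrow> complex" where
  "xi l B x b = (THE c. \<forall>i \<in> B b. a_fun l x i = c)"

text \<open>
  \<open>f 1, \<dots>, f n\<close> are the coordinate vector fields of a system of linear coordinates on the
  linear subspace \<open>S\<close>.
\<close>

definition linear_frame :: "(nat \<Rightarrow> complex) set \<Rightarrow> nat \<Rightarrow> (nat \<Rightarrow> nat \<Rightarrow> complex) \<Rightarrow> bool" where
  "linear_frame S n f \<longleftrightarrow>
     bij_betw (\<lambda>t. (\<lambda>i. \<Sum>r = 1..n. t r * f r i)) (coord_space n) S"

text \<open>The matrix of the pull-back of the Saito metric in the frame \<open>f\<close>, at the point \<open>x\<close>.\<close>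

definition saito_gram ::
  "nat \<Rightarrow> nat \<Rightarrow> complex \<Rightarrow> nat \<Rightarrow> (nat \<Rightarrow> nat \<Rightarrow> complex) \<Rightarrow> (nat \<Rightarrow> complex) \<Rightarrow> complex mat" where
  "saito_gram l k \<kappa> n f x = Matrix.mat n n (\<lambda>(r, s).
     saito_pullback l k \<kappa> x (f (r + 1)) (f (s + 1)))"

end

theory Submission
  imports Defs "HOL-Computational_Algebra.Computational_Algebra"
begin

text \<open>
  Put \<open>n = l + 1\<close> and \<open>E(\<mu>) = \<Prod>\<^sub>j (\<mu> + a\<^sub>j)\<close>; taking the roots to be \<open>-a\<^sub>j\<close> avoids all signs. Since
  \<open>\<Prod>\<^sub>j a\<^sub>j = 1\<close>, the coefficient \<open>E\<^sub>i\<close> is the \<open>i\<close>-th elementary symmetric function of the \<open>1/a\<^sub>j\<close>, so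
  \<open>y\<^sub>i\<close> is a positive integer times \<open>exp (d\<^sub>i x\<^sub>n) E\<^sub>i\<close> (\<open>Y_fun_eq\<close>). Put \<open>T = \<mu> E' - k E\<close>; it is
  \<open>\<mu>\<^bsup>k+1\<^esup>\<close> times the derivative of the superpotential \<open>\<mu>\<^bsup>-k\<^esup> E\<close>.

  The functions \<open>\<gamma>\<^sup>-\<^sup>1(dy\<^sub>i, dy\<^sub>j)\<close> are quadratic in the \<open>E\<^sub>i\<close> and affine in \<open>y\<^sub>k\<close>. Their
  \<open>y\<^sub>k\<close>-derivative, the contravariant Saito metric, consists of two Hankel blocks, \<open>i, j < k\<close> and
  \<open>i, j > k\<close>, whose entries are coefficients of \<open>T\<close>, and of a pairing of \<open>y\<^sub>k\<close> with \<open>y\<^sub>n\<close>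
  (\<open>saito_contravariant_core\<close>, \<open>saito_contravariant_top\<close>). To invert such a Hankel block is to divide by
  \<open>T\<close>, in power series at \<open>0\<close> for the first block and at \<open>\<infinity>\<close> for the second one. If tangent
  vectors are encoded as polynomials \<open>F\<close>, \<open>G\<close> (variations of \<open>E\<close>), the covariant metric therefore is the coefficient
  of \<open>\<mu>\<^sup>k\<close> in \<open>F G / T\<close> expanded at \<open>0\<close>, minus the same coefficient at \<open>\<infinity>\<close>
  (\<open>saito_covariant_pairing\<close>). This is the residue formula with the residues moved from the critical
  points to \<open>0\<close> and \<open>\<infinity>\<close>. In this form it is an identity of polynomial algebra, true also
  where critical points collide, and neither genericity nor continuity has to be invoked.

  On the stratum, \<open>E = U R\<close> with \<open>R = \<Prod>\<^sub>b (\<mu> + \<xi>\<^sub>b)\<close> and \<open>U = \<Prod>\<^sub>b (\<mu> + \<xi>\<^sub>b)\<^bsup>m\<^sub>b - 1\<^esup>\<close>. Also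
  \<open>T = U Q\<close> with \<open>deg Q = d + 1\<close>, and a vector tangent to the stratum is encoded by \<open>U \<nu>\<close>. The metric turns into the
  coefficient of \<open>\<mu>\<^sup>d\<close> in \<open>w \<nu> \<nu>' mod Q\<close>, where \<open>w\<close> represents \<open>U \<mu>\<^bsup>-k-1\<^esup>\<close> modulo \<open>Q\<close>. Hence
  the Gram determinant is, up to a constant, \<open>a\<^sub>0\<^bsup>d+1\<^esup>\<close> times the norm of \<open>w\<close> in the algebra of polynomials modulo \<open>Q\<close>, times
  the square of the determinant of the \<open>\<nu>\<close>'s in the monomial basis (\<open>det_residue_form\<close>). The norm is computed
  from the values of \<open>Q\<close> at \<open>0\<close> and at the \<open>-\<xi>\<^sub>b\<close> (\<open>residue_norm_linear\<close>). Modulo \<open>Q\<close>, every \<open>\<nu>\<close> is a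
  combination \<open>\<Sum>\<^sub>b m\<^sub>b \<xi>\<^sub>b \<phi>\<^sub>b R\<^sub>b\<close> of the cofactors \<open>R\<^sub>b = R / (\<mu> + \<xi>\<^sub>b)\<close>, where the \<open>\<phi>\<^sub>b\<close> are linear
  coordinates on the stratum. The squared determinant of the cofactors follows from \<open>det_residue_form\<close> with \<open>R\<close> in
  place of \<open>Q\<close>, because the cofactors are orthogonal modulo \<open>R\<close> (\<open>det_cofactor_coord_mat_square\<close>).
  Collecting the powers, with \<open>\<Prod>\<^sub>b \<xi>\<^sub>b\<^bsup>m\<^sub>b\<^esup> = 1\<close>, gives the theorem.
\<close>

section \<open>Bilinear forms on polynomials modulo a polynomial\<close>

definition exchange_mat :: "nat \<Rightarrow> 'a::field mat" where
  "exchange_mat n = Matrix.mat n n (\<lambda>(i, j). if i + j + 1 = n then 1 else 0)"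

lemma exchange_mat_carrier [simp]: "exchange_mat n \<in> carrier_mat n n"
  by (simp add: exchange_mat_def)

lemma index_mult_exchange_mat:
  assumes "A \<in> carrier_mat n n" "i < n" "j < n"
  shows "(A * exchange_mat n) $$ (i, j) = A $$ (i, n - 1 - j)"
proof -
  have "(A * exchange_mat n) $$ (i, j) = (\<Sum>m<n. A $$ (i, m) * (if m = n - 1 - j then 1 else 0))"
    using assms unfolding exchange_mat_def
    by (auto simp: scalar_prod_def lessThan_atLeast0 intro!: sum.cong)
  also have "\<dots> = (\<Sum>m<n. if m = n - 1 - j then A $$ (i, m) else 0)"
    by (rule sum.cong) auto
  also have "\<dots> = A $$ (i, n - 1 - j)"
    using assms by (subst sum.delta) auto
  finally show ?thesis .
qed

lemma det_exchange_mat_square: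
  "Determinant.det (exchange_mat n) * Determinant.det (exchange_mat n :: 'a::field mat) = 1"
proof -
  have "exchange_mat n * exchange_mat n = (1\<^sub>m n :: 'a mat)"
  proof (rule eq_matI)
    fix i j assume "i < dim_row (1\<^sub>m n :: 'a mat)" "j < dim_col (1\<^sub>m n :: 'a mat)"
    then show "(exchange_mat n * exchange_mat n) $$ (i, j) = (1\<^sub>m n :: 'a mat) $$ (i, j)"
      by (subst index_mult_exchange_mat) (auto simp: exchange_mat_def)
  qed (auto simp: exchange_mat_def)
  then show ?thesis
    using det_mult[of "exchange_mat n" n "exchange_mat n :: 'a mat"] by simp
qed

lemma det_exchange_mat_nonzero: "Determinant.det (exchange_mat n :: 'a::field mat) \<noteq> 0"
  using det_exchange_mat_square[of n, where 'a='a] by auto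

text \<open>
  Reversing the columns makes the matrix unitriangular. The value is left as the determinant of the
  exchange matrix, since only its square, which is \<open>1\<close>, matters.
\<close>

lemma det_antitriangular:
  fixes A :: "'a::field mat"
  assumes A: "A \<in> carrier_mat n n"
    and zero: "\<And>i j. i + j + 1 < n \<Longrightarrow> A $$ (i, j) = 0"
    and one: "\<And>i j. i + j + 1 = n \<Longrightarrow> A $$ (i, j) = 1"
  shows "Determinant.det A = Determinant.det (exchange_mat n :: 'a mat)"
proof -
  let ?E = "exchange_mat n :: 'a mat"
  have c: "A * ?E \<in> carrier_mat n n"
    using A by simp
  have "Determinant.det (A * ?E) = prod_list (diag_mat (A * ?E))"
  proof (rule det_lower_triangular[OF _ c])
    fix i j assume "i < j" "j < n"
    then show "(A * ?E) $$ (i, j) = 0"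
      using A by (subst index_mult_exchange_mat) (auto intro!: zero)
  qed
  also have "diag_mat (A * ?E) = map (\<lambda>i. 1) [0..<n]"
    unfolding diag_mat_def using c
    by (auto intro!: map_cong simp: index_mult_exchange_mat[OF A] simp del: map_replicate_trivial) (rule one, simp)
  also have "prod_list (map (\<lambda>i. 1 :: 'a) [0..<n]) = 1"
    by (simp add: map_replicate_const)
  finally have "Determinant.det A * Determinant.det ?E = 1"
    using det_mult[OF A, of ?E] by simp
  then show ?thesis
    using det_exchange_mat_square[of n, where 'a='a] det_exchange_mat_nonzero[of n, where 'a='a]
    by (metis mult_cancel_right)
qed

lemma mod_sum_poly: "(\<Sum>i\<in>S. f i) mod q = (\<Sum>i\<in>S. f i mod (q :: 'a::field poly))"
  by (induction S rule: infinite_finite_induct) (auto simp: poly_mod_add_left)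

text \<open>
  Multiplication by \<open>f\<close> modulo \<open>q\<close> is linear, hence given by a matrix on coefficient vectors.
\<close>

lemma coeff_mult_mod:
  fixes f g q :: "'a::field poly"
  assumes "\<And>j. j \<ge> n \<Longrightarrow> coeff g j = 0"
  shows "coeff ((f * g) mod q) i = (\<Sum>j<n. coeff ((f * monom 1 j) mod q) i * coeff g j)"
proof -
  have "g = (\<Sum>j<n. Polynomial.smult (coeff g j) (monom 1 j))"
    by (rule poly_eqI) (use assms in \<open>auto simp: coeff_sum sum.delta not_less if_distrib cong: if_cong\<close>)
  then have "f * g = (\<Sum>j<n. Polynomial.smult (coeff g j) (f * monom 1 j))"
    by (metis (no_types, lifting) mult_smult_right sum.cong sum_distrib_left)
  then show ?thesis
    by (simp add: mod_sum_poly mod_smult_left coeff_sum mult.commute)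
qed

definition residue_mult_mat :: "'a::field poly \<Rightarrow> 'a poly \<Rightarrow> 'a mat" where
  "residue_mult_mat q f =
     Matrix.mat (degree q) (degree q) (\<lambda>(i, j). coeff ((f * monom 1 j) mod q) i)"

lemma residue_mult_mat_carrier [simp]:
  "residue_mult_mat q f \<in> carrier_mat (degree q) (degree q)"
  by (simp add: residue_mult_mat_def)

lemma coeff_mod_eq_0: "degree q > 0 \<Longrightarrow> i \<ge> degree q \<Longrightarrow> coeff (f mod (q :: 'a::field poly)) i = 0"
  by (metis coeff_eq_0 degree_0 degree_mod_less le_degree less_le_trans not_le order_less_irrefl mod_poly_less coeff_0)

lemma residue_mult_mat_mult:
  assumes "degree q > 0"
  shows "residue_mult_mat q (f * g) = residue_mult_mat q f * residue_mult_mat q g"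
proof (rule eq_matI)
  fix i j
  assume "i < dim_row (residue_mult_mat q f * residue_mult_mat q g)"
    "j < dim_col (residue_mult_mat q f * residue_mult_mat q g)"
  then have ij: "i < degree q" "j < degree q"
    by (auto simp: residue_mult_mat_def)
  have "coeff ((f * g * monom 1 j) mod q) i = coeff ((f * ((g * monom 1 j) mod q)) mod q) i"
    by (simp add: mod_mult_right_eq mult.assoc)
  also have "\<dots> = (\<Sum>m<degree q. coeff ((f * monom 1 m) mod q) i * coeff ((g * monom 1 j) mod q) m)"
    by (rule coeff_mult_mod) (use assms in \<open>simp add: coeff_mod_eq_0\<close>)
  finally show "residue_mult_mat q (f * g) $$ (i, j) =
      (residue_mult_mat q f * residue_mult_mat q g) $$ (i, j)"
    using ij by (simp add: residue_mult_mat_def scalar_prod_def lessThan_atLeast0)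
qed (auto simp: residue_mult_mat_def)

lemma residue_mult_mat_cong: "f mod q = g mod q \<Longrightarrow> residue_mult_mat q f = residue_mult_mat q g"
  unfolding residue_mult_mat_def by (metis mod_mult_left_eq)

text \<open>
  The norm of \<open>f\<close> in the algebra of polynomials modulo \<open>q\<close>; for monic \<open>q\<close> it is the resultant of \<open>q\<close>
  and \<open>f\<close>.
\<close>

definition residue_norm :: "'a::field poly \<Rightarrow> 'a poly \<Rightarrow> 'a" where
  "residue_norm q f = Determinant.det (residue_mult_mat q f)"

lemma residue_norm_mult:
  "degree q > 0 \<Longrightarrow> residue_norm q (f * g) = residue_norm q f * residue_norm q g"
  unfolding residue_norm_def by (simp add: residue_mult_mat_mult det_mult[of _ "degree q"])

lemma residue_norm_cong: "f mod q = g mod q \<Longrightarrow> residue_norm q f = residue_norm q g"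
  unfolding residue_norm_def by (simp add: residue_mult_mat_cong[of f q g])

lemma residue_norm_1: "degree q > 0 \<Longrightarrow> residue_norm q 1 = 1"
proof -
  assume "degree q > 0"
  then have "residue_mult_mat q 1 = 1\<^sub>m (degree q)"
    unfolding residue_mult_mat_def by (intro eq_matI) (auto simp: mod_poly_less degree_monom_eq)
  then show ?thesis
    by (simp add: residue_norm_def)
qed

lemma residue_norm_power: "degree q > 0 \<Longrightarrow> residue_norm q (f ^ m) = residue_norm q f ^ m"
  by (induction m) (auto simp: residue_norm_1 residue_norm_mult)

lemma residue_norm_prod:
  "degree q > 0 \<Longrightarrow> residue_norm q (\<Prod>i\<in>S. f i) = (\<Prod>i\<in>S. residue_norm q (f i))"
  by (induction S rule: infinite_finite_induct) (auto simp: residue_norm_1 residue_norm_mult)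

lemma poly_eq_sum_lessThan:
  fixes f :: "'a::comm_semiring_1 poly"
  shows "degree f < n \<Longrightarrow> poly f c = (\<Sum>i<n. c ^ i * coeff f i)"
  unfolding poly_altdef
  by (rule sum.mono_neutral_cong_left) (auto simp: mult.commute intro: le_degree)

text \<open>
  In the monomial basis, multiplication by \<open>x - c\<close> shifts \<open>x\<^sup>j\<close> to \<open>x\<^bsup>j+1\<^esup> - c x\<^sup>j\<close> as long as
  \<open>j < d\<close>. Evaluation at \<open>c\<close> kills these columns and sends the last one to \<open>-q(c)\<close> divided by the
  leading coefficient, so a row operation that puts the evaluation into the first row leaves a single entry there.
\<close>

lemma residue_norm_linear:
  fixes q :: "'a::field poly"
  assumes q: "degree q = Suc d"
  shows "residue_norm q [:- c, 1:] = (- 1) ^ Suc d * poly q c / lead_coeff q"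
proof -
  define M where "M = residue_mult_mat q [:- c, 1:]"
  have M: "M \<in> carrier_mat (Suc d) (Suc d)"
    using residue_mult_mat_carrier[of q "[:- c, 1:]"] by (simp add: M_def q)
  have col: "[:- c, 1:] * monom 1 j mod q = [:- c, 1:] * monom 1 j" if "j < d" for j
    by (rule mod_poly_less, subst degree_mult_eq) (use that q in \<open>auto simp: degree_monom_eq\<close>)
  have M_entry: "M $$ (i, j) = (if i = Suc j then 1 else if i = j then - c else 0)"
    if "i < Suc d" "j < d" for i j
  proof -
    have "M $$ (i, j) = coeff ([:- c, 1:] * monom 1 j mod q) i"
      using that q unfolding M_def residue_mult_mat_def by (simp del: mult_pCons_left)
    also have "\<dots> = (if i = Suc j then 1 else if i = j then - c else 0)"
      unfolding col[OF \<open>j < d\<close>] by (auto simp: coeff_pCons split: nat.splits)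
    finally show ?thesis .
  qed
  \<comment> \<open>The first row of \<open>P\<close> is evaluation at \<open>c\<close>.\<close>
  define P where "P = Matrix.mat (Suc d) (Suc d) (\<lambda>(i, j). if i = 0 then c ^ j else if i = j then 1 else 0)"
  have P: "P \<in> carrier_mat (Suc d) (Suc d)"
    by (simp add: P_def)
  have "Determinant.det P = prod_list (diag_mat P)"
    by (rule det_upper_triangular[OF _ P]) (auto simp: P_def upper_triangular_def)
  also have "diag_mat P = map (\<lambda>i. 1) [0..<Suc d]"
    unfolding diag_mat_def by (rule map_cong) (auto simp: P_def)
  also have "prod_list (map (\<lambda>i. 1 :: 'a) [0..<Suc d]) = 1"
    by (simp only: map_replicate_const prod_list_replicate power_one)
  finally have detP: "Determinant.det P = 1" .
  define N where "N = P * M"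
  have N: "N \<in> carrier_mat (Suc d) (Suc d)"
    using P M by (simp add: N_def)
  have eval_row: "N $$ (0, j) = poly ([:- c, 1:] * monom 1 j mod q) c" if "j < Suc d" for j
  proof -
    have "N $$ (0, j) = (\<Sum>i<Suc d. c ^ i * coeff ([:- c, 1:] * monom 1 j mod q) i)"
      using that unfolding N_def P_def M_def residue_mult_mat_def q
      by (simp add: scalar_prod_def lessThan_atLeast0 q del: sum.op_ivl_Suc)
    also have "\<dots> = poly ([:- c, 1:] * monom 1 j mod q) c"
    proof -
      have "degree ([:- c, 1:] * monom 1 j mod q) < Suc d"
        using degree_mod_less'[of q] q by (metis degree_0 degree_mod_less zero_less_Suc not_less_zero)
      then show ?thesis
        by (rule poly_eq_sum_lessThan[symmetric])
    qed
    finally show ?thesis .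
  qed
  have row0: "N $$ (0, j) = 0" if "j < d" for j
    using that eval_row[of j] unfolding col[OF that] by simp
  have row0_last: "N $$ (0, d) = - (poly q c / lead_coeff q)"
  proof -
    have lc: "lead_coeff q \<noteq> 0"
      using q by (metis degree_0 leading_coeff_0_iff nat.distinct(1))
    define r where "r = [:- c, 1:] * monom 1 d - Polynomial.smult (1 / lead_coeff q) q"
    have "degree r < degree q"
    proof -
      have "degree r \<le> Suc d"
        unfolding r_def using q by (intro degree_diff_le)
        (simp_all del: mult_pCons_left add: degree_mult_eq degree_monom_eq)
      moreover have "coeff r (Suc d) = 0"
        unfolding r_def using lc q by (simp add: coeff_pCons)
      ultimately show ?thesis
        using q by (metis le_neq_implies_less leading_coeff_0_iff degree_0 zero_less_Suc)
    qed
    moreover have "[:- c, 1:] * monom 1 d = [:1 / lead_coeff q:] * q + r"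
      unfolding r_def by simp
    ultimately have "[:- c, 1:] * monom 1 d mod q = r"
      by (simp only: mod_mult_self3 mod_poly_less)
    then show ?thesis
      by (simp add: eval_row r_def)
  qed
  have del: "mat_delete N 0 d = Matrix.mat d d (\<lambda>(i, j). if i = j then 1 else if Suc i = j then - c else 0)"
  proof (rule eq_matI)
    fix i j
    assume "i < dim_row (Matrix.mat d d (\<lambda>(i, j). if i = j then 1 else if Suc i = j then - c else 0))"
      "j < dim_col (Matrix.mat d d (\<lambda>(i, j). if i = j then 1 else if Suc i = j then - c else 0))"
    then have ij: "i < d" "j < d" by auto
    have "mat_delete N 0 d $$ (i, j) = N $$ (Suc i, j)"
      using ij N by (simp add: mat_delete_def)
    also have "\<dots> = (\<Sum>m = 0..<Suc d. (if Suc i = m then 1 else 0) * M $$ (m, j))"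
      using ij M unfolding N_def P_def by (simp add: scalar_prod_def del: sum.op_ivl_Suc)
    also have "\<dots> = (\<Sum>m = 0..<Suc d. if Suc i = m then M $$ (m, j) else 0)"
      by (rule sum.cong) auto
    also have "\<dots> = M $$ (Suc i, j)"
      using ij by (subst sum.delta') auto
    finally show "mat_delete N 0 d $$ (i, j) = Matrix.mat d d (\<lambda>(i, j). if i = j then 1 else if Suc i = j then - c else 0) $$ (i, j)"
      using ij by (simp add: M_entry)
  qed (use N in \<open>auto simp: mat_delete_def\<close>)
  have "Determinant.det (mat_delete N 0 d) = prod_list (diag_mat (mat_delete N 0 d))"
    by (rule det_upper_triangular[where n = d]) (auto simp: del upper_triangular_def)
  also have "diag_mat (mat_delete N 0 d) = map (\<lambda>i. 1) [0..<d]"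
    unfolding diag_mat_def del by (rule map_cong) auto
  also have "prod_list (map (\<lambda>i. 1 :: 'a) [0..<d]) = 1"
    by (simp only: map_replicate_const prod_list_replicate power_one)
  finally have detdel: "Determinant.det (mat_delete N 0 d) = 1" .
  have "Determinant.det N = (\<Sum>j<Suc d. N $$ (0, j) * cofactor N 0 j)"
    by (rule laplace_expansion_row[OF N]) simp
  also have "\<dots> = N $$ (0, d) * cofactor N 0 d"
    using row0 by simp
  also have "\<dots> = (- 1) ^ Suc d * poly q c / lead_coeff q"
    by (simp add: row0_last cofactor_def detdel)
  finally show ?thesis
    using det_mult[OF P M] detP by (simp add: residue_norm_def N_def M_def)
qed

definition residue_coord_mat :: "'a::field poly \<Rightarrow> (nat \<Rightarrow> 'a poly) \<Rightarrow> 'a mat" where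
  "residue_coord_mat q f = Matrix.mat (degree q) (degree q) (\<lambda>(i, r). coeff (f r mod q) i)"

text \<open>
  The functional ``coefficient of \<open>x\<^bsup>n-1\<^esup>\<close> modulo \<open>q\<close>'' has an antitriangular Gram matrix \<open>L\<close> on
  the monomials, for every \<open>q\<close> of degree \<open>n\<close>. With \<open>W\<close> the multiplication by \<open>w\<close> and \<open>V\<close> the
  coordinates of the \<open>f r\<close>, the matrix in question is \<open>V\<^sup>T L W V\<close>.
\<close>

lemma det_residue_form:
  fixes q w :: "'a::field poly"
  assumes q: "degree q > 0"
  shows "Determinant.det (Matrix.mat (degree q) (degree q)
            (\<lambda>(r, s). coeff ((w * f r * f s) mod q) (degree q - 1)))
       = Determinant.det (exchange_mat (degree q) :: 'a mat) * residue_norm q w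
           * Determinant.det (residue_coord_mat q f) ^ 2"
proof -
  let ?n = "degree q"
  define L where "L = Matrix.mat ?n ?n (\<lambda>(i, j). coeff (monom 1 (i + j) mod q) (?n - 1))"
  define V where "V = residue_coord_mat q f"
  define W where "W = residue_mult_mat q w"
  have [simp]: "L \<in> carrier_mat ?n ?n" "V \<in> carrier_mat ?n ?n" "W \<in> carrier_mat ?n ?n"
    by (auto simp: L_def V_def W_def residue_coord_mat_def)
  have "Determinant.det L = Determinant.det (exchange_mat ?n :: 'a mat)"
    by (rule det_antitriangular) (auto simp: L_def mod_poly_less degree_monom_eq)
  moreover have "Matrix.mat ?n ?n (\<lambda>(r, s). coeff ((w * f r * f s) mod q) (?n - 1))
      = transpose_mat V * (L * (W * V))"
  proof (rule eq_matI)
    fix r s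
    assume "r < dim_row (transpose_mat V * (L * (W * V)))" "s < dim_col (transpose_mat V * (L * (W * V)))"
    then have rs: "r < ?n" "s < ?n"
      by (auto simp: V_def residue_coord_mat_def)
    define g where "g = f r mod q"
    define h where "h = (w * (f s mod q)) mod q"
    have h: "coeff h i = (W * V) $$ (i, s)" if "i < ?n" for i
    proof -
      have "coeff h i = (\<Sum>j<?n. coeff ((w * monom 1 j) mod q) i * coeff (f s mod q) j)"
        unfolding h_def by (rule coeff_mult_mod) (use q in \<open>simp add: coeff_mod_eq_0\<close>)
      then show ?thesis
        using that rs by (simp add: W_def V_def residue_coord_mat_def residue_mult_mat_def
            scalar_prod_def lessThan_atLeast0)
    qed
    have "(w * f r * f s) mod q = (g * h) mod q"
      unfolding g_def h_def by (metis (no_types, lifting) mod_mult_eq mod_mult_right_eq mod_mod_trivial mult.left_commute mult.assoc)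
    also have "coeff \<dots> (?n - 1) = (\<Sum>j<?n. coeff ((g * monom 1 j) mod q) (?n - 1) * coeff h j)"
      by (rule coeff_mult_mod) (use q in \<open>simp add: h_def coeff_mod_eq_0\<close>)
    also have "\<dots> = (\<Sum>j<?n. (\<Sum>i<?n. coeff (monom 1 (i + j) mod q) (?n - 1) * coeff g i) * coeff h j)"
    proof (rule sum.cong[OF refl])
      fix j
      have "coeff ((monom 1 j * g) mod q) (?n - 1)
          = (\<Sum>i<?n. coeff ((monom 1 j * monom 1 i) mod q) (?n - 1) * coeff g i)"
        by (rule coeff_mult_mod) (use q in \<open>simp add: g_def coeff_mod_eq_0\<close>)
      then show "coeff ((g * monom 1 j) mod q) (?n - 1) * coeff h j
          = (\<Sum>i<?n. coeff (monom 1 (i + j) mod q) (?n - 1) * coeff g i) * coeff h j"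
        by (simp add: mult_monom mult.commute add.commute)
    qed
    also have "\<dots> = (\<Sum>i<?n. coeff g i * (\<Sum>j<?n. L $$ (i, j) * (W * V) $$ (j, s)))"
      unfolding sum_distrib_left sum_distrib_right
      by (subst sum.swap) (auto simp: L_def h ac_simps intro!: sum.cong)
    also have "\<dots> = (transpose_mat V * (L * (W * V))) $$ (r, s)"
      using rs by (auto simp: V_def residue_coord_mat_def g_def L_def W_def scalar_prod_def lessThan_atLeast0
          residue_mult_mat_def intro!: sum.cong)
    finally show "Matrix.mat ?n ?n (\<lambda>(r, s). coeff ((w * f r * f s) mod q) (?n - 1)) $$ (r, s)
        = (transpose_mat V * (L * (W * V))) $$ (r, s)"
      using rs by simp
  qed (auto simp: V_def residue_coord_mat_def)
  moreover have "Determinant.det (transpose_mat V * (L * (W * V)))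
      = Determinant.det V * (Determinant.det L * (Determinant.det W * Determinant.det V))"
    using det_mult[of "transpose_mat V" ?n "L * (W * V)"] det_mult[of L ?n "W * V"]
      det_mult[of W ?n V] det_transpose[of V ?n] mult_carrier_mat[of W ?n ?n V ?n]
      mult_carrier_mat[of L ?n ?n "W * V" ?n] by simp
  ultimately show ?thesis
    by (simp add: residue_norm_def V_def[symmetric] W_def[symmetric] power2_eq_square)
qed

section \<open>Expansions of a quotient at zero and at infinity\<close>

lemma degree_mod_lt: "degree q > 0 \<Longrightarrow> degree (f mod q :: 'a::field poly) < degree q"
  by (cases "q = 0") (use degree_mod_less[of q f] in auto)

lemma coeff_div_eq_0:
  fixes f q :: "'a::field poly"
  assumes "degree f < degree q + m" "m \<le> i"
  shows "coeff (f div q) i = 0"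
proof (cases "f div q = 0")
  case False
  have "degree (f div q) + degree q \<le> degree f"
  proof (rule ccontr)
    assume *: "\<not> ?thesis"
    have q: "q \<noteq> 0" using False by auto
    have "degree (f mod q) < degree q \<or> f mod q = 0"
      using q degree_mod_less by blast
    then have "coeff (f mod q) (degree (f div q) + degree q) = 0"
      by (metis add.commute coeff_0 coeff_eq_0 trans_less_add1)
    moreover have "coeff f (degree (f div q) + degree q) = 0"
      using * by (intro coeff_eq_0) simp
    moreover have "coeff (f div q * q) (degree (f div q) + degree q) = coeff (f div q * q + f mod q) (degree (f div q) + degree q)
        - coeff (f mod q) (degree (f div q) + degree q)"
      by (metis coeff_add add_diff_cancel_right')
    ultimately have "lead_coeff (f div q) * lead_coeff q = 0"
      unfolding coeff_mult_degree_sum by simp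
    then show False using False q by simp
  qed
  then show ?thesis
    using assms by (intro coeff_eq_0) simp
qed simp

text \<open>
  The polynomial quotient is the polynomial part of the expansion of \<open>f / q\<close> at infinity; this lemma
  and the next two are what is needed about that expansion.
\<close>

lemma coeff_div_top:
  fixes f q :: "'a::field poly"
  assumes "degree f < degree q + Suc j" "degree q > 0"
  shows "coeff (f div q) j = coeff f (degree q + j) / lead_coeff q"
proof -
  define s where "s = f div q"
  have q: "q \<noteq> 0" using assms(2) by auto
  have s: "coeff s i = 0" if "i > j" for i
    unfolding s_def using assms that by (intro coeff_div_eq_0[where m = "Suc j"]) auto
  have "coeff (f mod q) (degree q + j) = 0"
    by (rule coeff_mod_eq_0) (use assms in auto)
  moreover have "f = q * s + f mod q"
    unfolding s_def by simp
  ultimately have "coeff f (degree q + j) = coeff (q * s) (degree q + j)"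
    by (metis add.right_neutral coeff_add)
  also have "\<dots> = (\<Sum>i\<le>degree q + j. if i = degree q then lead_coeff q * coeff s j else 0)"
    unfolding coeff_mult
  proof (rule sum.cong[OF refl])
    fix i assume "i \<in> {..degree q + j}"
    then show "coeff q i * coeff s (degree q + j - i) = (if i = degree q then lead_coeff q * coeff s j else 0)"
      by (cases i "degree q" rule: linorder_cases) (auto intro: s coeff_eq_0)
  qed
  also have "\<dots> = lead_coeff q * coeff s j"
    by simp
  finally show ?thesis
    using q by (simp add: s_def)
qed

lemma coeff_monom_mult_div:
  fixes g q :: "'a::field poly"
  assumes "degree q > 0"
  shows "coeff ((monom 1 j * g) div q) (j + i) = coeff (g div q) i"
proof -
  have "monom 1 j * g = monom 1 j * (g div q) * q + monom 1 j * (g mod q)"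
    by (metis distrib_left div_mult_mod_eq mult.assoc)
  then have "(monom 1 j * g) div q = monom 1 j * (g div q) + (monom 1 j * (g mod q)) div q"
    using assms by (metis add.commute degree_0 div_mult_self1 less_numeral_extra(3))
  moreover have "coeff ((monom 1 j * (g mod q)) div q) (j + i) = 0"
  proof (rule coeff_div_eq_0)
    have "degree (g mod q) < degree q"
      using assms by (rule degree_mod_lt)
    then show "degree (monom 1 j * (g mod q)) < degree q + j"
      using degree_mult_le[of "monom 1 j" "g mod q"] degree_monom_le[of "1 :: 'a" j] by linarith
  qed simp
  ultimately show ?thesis
    by (simp add: coeff_monom_mult)
qed

lemma coeff_monom_Suc_mult_div:
  fixes g q :: "'a::field poly"
  assumes "degree q > 0"
  shows "coeff ((monom 1 (Suc j) * g) div q) j = coeff (g mod q) (degree q - 1) / lead_coeff q"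
proof -
  have "monom 1 (Suc j) * g = monom 1 (Suc j) * (g div q) * q + monom 1 (Suc j) * (g mod q)"
    by (metis distrib_left div_mult_mod_eq mult.assoc)
  then have "(monom 1 (Suc j) * g) div q
      = monom 1 (Suc j) * (g div q) + (monom 1 (Suc j) * (g mod q)) div q"
    using assms by (metis add.commute degree_0 div_mult_self1 less_numeral_extra(3))
  moreover have "coeff ((monom 1 (Suc j) * (g mod q)) div q) j
      = coeff (monom 1 (Suc j) * (g mod q)) (degree q + j) / lead_coeff q"
  proof (rule coeff_div_top)
    have "degree (g mod q) < degree q"
      using assms by (rule degree_mod_lt)
    then show "degree (monom 1 (Suc j) * (g mod q)) < degree q + Suc j"
      using degree_mult_le[of "monom 1 (Suc j)" "g mod q"] degree_monom_le[of "1 :: 'a" "Suc j"] by linarith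
  qed fact
  ultimately show ?thesis
    using assms by (simp add: coeff_monom_mult)
qed

text \<open>
  The expansion of \<open>f / t\<close> at \<open>0\<close>, truncated at degree \<open>m\<close>.
\<close>

lemma expansion_at_0_exists:
  fixes f t :: "'a::field poly"
  assumes "coeff t 0 \<noteq> 0"
  shows "\<exists>a h. f = t * a + monom 1 m * h \<and> (\<forall>i\<ge>m. coeff a i = 0)"
proof (induction m)
  case 0
  show ?case by (intro exI[of _ 0] exI[of _ f]) (simp add: monom_0)
next
  case (Suc m)
  then obtain a h where ah: "f = t * a + monom 1 m * h" "\<forall>i\<ge>m. coeff a i = 0"
    by blast
  define c where "c = coeff h 0 / coeff t 0"
  obtain g where g: "h - Polynomial.smult c t = pCons 0 g"
  proof -
    have "coeff (h - Polynomial.smult c t) 0 = 0"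
      using assms by (simp add: c_def)
    then show ?thesis
      using that by (metis pCons_cases coeff_pCons_0)
  qed
  have "monom 1 (Suc m) * g = monom 1 m * pCons 0 g"
    by (simp add: monom_Suc)
  then have "f = t * (a + monom c m) + monom 1 (Suc m) * g"
  proof -
    assume *: "monom 1 (Suc m) * g = monom 1 m * pCons 0 g"
    have "monom c m = Polynomial.smult c (monom 1 m)"
      by (simp add: smult_monom)
    then show ?thesis
      unfolding * ah(1) g[symmetric] by (simp add: algebra_simps)
  qed
  then show ?case
    using ah(2) by (intro exI[of _ "a + monom c m"] exI[of _ g]) auto
qed

lemma expansion_at_0_unique:
  fixes f t :: "'a::field poly"
  assumes t: "coeff t 0 \<noteq> 0"
    and eq: "t * a + monom 1 m * h = t * a' + monom 1 m * h'"
    and "i < m"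
  shows "coeff a i = coeff a' i"
  using \<open>i < m\<close>
proof (induction i rule: less_induct)
  case (less i)
  have "t * (a - a') = monom 1 m * (h' - h)"
    using eq by (simp add: algebra_simps)
  then have "coeff (t * (a - a')) i = 0"
    using less.prems by (simp add: coeff_monom_mult)
  moreover have "coeff (t * (a - a')) i = coeff t 0 * (coeff a i - coeff a' i)"
    unfolding coeff_mult
  proof (subst sum.remove[of _ 0])
    show "coeff t 0 * coeff (a - a') (i - 0) + (\<Sum>j\<in>{..i} - {0}. coeff t j * coeff (a - a') (i - j))
        = coeff t 0 * (coeff a i - coeff a' i)"
      using less by (auto intro!: sum.neutral)
  qed auto
  ultimately show ?case
    using t by simp
qed

text \<open>
  The sum of the residues of \<open>f / (x\<^bsup>k+1\<^esup> t) dx\<close> at \<open>0\<close> and at infinity: the coefficient of \<open>x\<^sup>k\<close> in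
  \<open>f / t\<close> at \<open>0\<close>, minus the one at infinity. By the residue theorem it is minus the sum of the residues at the zeros of
  \<open>t\<close> if \<open>t(0) \<noteq> 0\<close>. The choice is irrelevant by \<open>expansion_at_0_unique\<close>.
\<close>

definition residue_0_inf :: "'a::field poly \<Rightarrow> nat \<Rightarrow> 'a poly \<Rightarrow> 'a" where
  "residue_0_inf t k f = coeff (SOME a. \<exists>h. f = t * a + monom 1 (Suc k) * h) k - coeff (f div t) k"

lemma residue_0_inf_eq:
  fixes t :: "'a::field poly"
  assumes "coeff t 0 \<noteq> 0" "f = t * a + monom 1 (Suc k) * h"
  shows "residue_0_inf t k f = coeff a k - coeff (f div t) k"
proof -
  define a' where "a' = (SOME a. \<exists>h. f = t * a + monom 1 (Suc k) * h)"
  have "\<exists>h. f = t * a' + monom 1 (Suc k) * h"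
    unfolding a'_def by (rule someI_ex) (use assms in blast)
  then obtain h' where "f = t * a' + monom 1 (Suc k) * h'"
    by blast
  then have "coeff a' k = coeff a k"
    using assms expansion_at_0_unique[of t a' "Suc k" h' a h k] by simp
  then show ?thesis
    by (simp add: residue_0_inf_def a'_def)
qed

text \<open>
  Only the zeros of \<open>q\<close> contribute, because the poles at the zeros of \<open>u\<close> cancel. Modulo \<open>q\<close>, the factor
  \<open>w\<close> is \<open>u x\<^bsup>-k-1\<^esup>\<close>, and the residue sum over the zeros of \<open>q\<close> is read off from the
  remainder modulo \<open>q\<close>.
\<close>

lemma residue_0_inf_factor:
  fixes u q :: "'a::field poly"
  assumes t0: "coeff (u * q) 0 \<noteq> 0" and q: "degree q > 0"
    and w: "u = q * s + monom 1 (Suc k) * w"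
  shows "residue_0_inf (u * q) k (u * f * (u * g)) = - coeff ((w * f * g) mod q) (degree q - 1) / lead_coeff q"
proof -
  have "u * f * (u * g) = u * ((q * s + monom 1 (Suc k) * w) * f * g)"
    by (subst w[symmetric]) (simp add: ac_simps)
  also have "\<dots> = (u * q) * (s * f * g) + monom 1 (Suc k) * (u * w * f * g)"
    by (simp add: algebra_simps)
  finally have "residue_0_inf (u * q) k (u * f * (u * g))
      = coeff (s * f * g) k - coeff ((u * f * (u * g)) div (u * q)) k"
    by (rule residue_0_inf_eq[OF t0])
  also have "(u * f * (u * g)) div (u * q) = (f * (u * g)) div q"
    using t0 by (auto simp: mult.assoc)
  also have "f * (u * g) = (s * f * g) * q + monom 1 (Suc k) * (w * f * g)"
    by (subst w) (simp add: algebra_simps)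
  also have "\<dots> div q = s * f * g + (monom 1 (Suc k) * (w * f * g)) div q"
    using q by (metis add.commute degree_0 div_mult_self1 less_numeral_extra(3))
  finally show ?thesis
    using coeff_monom_Suc_mult_div[OF q, of k "w * f * g"] by simp
qed

text \<open>
  The solution of two Hankel systems with coefficients from \<open>t\<close>: for \<open>j < k\<close> it is made of the
  coefficients of \<open>f / t\<close> at \<open>0\<close>, for \<open>j > k\<close> of those of \<open>-(f - c t) / t\<close> at infinity.
\<close>

definition dual_coeff :: "'a::field poly \<Rightarrow> nat \<Rightarrow> 'a poly \<Rightarrow> 'a \<Rightarrow> nat \<Rightarrow> 'a" where
  "dual_coeff t k f c j =
    (if j < k then coeff (SOME a. (\<exists>h. f = t * a + monom 1 k * h) \<and> (\<forall>i\<ge>k. coeff a i = 0)) (k - j)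
     else - coeff ((monom 1 (degree t - k) * (f - Polynomial.smult c t)) div t) (degree t - j))"

context
  fixes t f g :: "'a::field poly" and k n :: nat and c c' :: 'a
  assumes n: "degree t = n" and k: "1 \<le> k" "k < n"
    and t0: "coeff t 0 \<noteq> 0" and tk: "coeff t k = 0"
    and f: "degree f \<le> n" "coeff f 0 = 0" "coeff f n = c * coeff t n"
    and g: "degree g \<le> n" "coeff g 0 = 0" "coeff g n = c' * coeff t n"
begin

lemma dual_coeff_low_obtain:
  obtains a h where "f = t * a + monom 1 k * h" "\<And>i. i \<ge> k \<Longrightarrow> coeff a i = 0" "coeff a 0 = 0"
    "\<And>j. j < k \<Longrightarrow> dual_coeff t k f c j = coeff a (k - j)"
proof -
  define a where "a = (SOME a. (\<exists>h. f = t * a + monom 1 k * h) \<and> (\<forall>i\<ge>k. coeff a i = 0))"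
  have "(\<exists>h. f = t * a + monom 1 k * h) \<and> (\<forall>i\<ge>k. coeff a i = 0)"
    unfolding a_def by (rule someI_ex) (use expansion_at_0_exists[OF t0] in blast)
  then obtain h where h: "f = t * a + monom 1 k * h" and a: "\<forall>i\<ge>k. coeff a i = 0"
    by blast
  have "coeff f 0 = coeff t 0 * coeff a 0"
    using k(1) by (subst h) (simp add: coeff_monom_mult coeff_mult)
  then have "coeff a 0 = 0"
    using f t0 by simp
  with h a show ?thesis
    by (intro that[of a h]) (auto simp: dual_coeff_def a_def)
qed

text \<open>
  The Hankel system of the first block is the identity \<open>t a = f\<close> modulo \<open>x\<^sup>k\<close>.
\<close>

lemma dual_coeff_low:
  assumes i: "1 \<le> i" "i < k"
  shows "(\<Sum>j\<in>{1..<k}. (if k \<le> i + j then coeff t (i + j - k) else 0) * dual_coeff t k f c j) = coeff f i"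
proof -
  obtain a h where a: "f = t * a + monom 1 k * h" "\<And>i. i \<ge> k \<Longrightarrow> coeff a i = 0" "coeff a 0 = 0"
    "\<And>j. j < k \<Longrightarrow> dual_coeff t k f c j = coeff a (k - j)"
    using dual_coeff_low_obtain by blast
  have "coeff f i = coeff (a * t) i"
    using i by (subst a) (simp add: coeff_monom_mult mult.commute[of t])
  also have "\<dots> = (\<Sum>m\<in>{1..i}. coeff a m * coeff t (i - m))"
    unfolding coeff_mult using a(3)
    by (intro sum.mono_neutral_right) (auto simp: Suc_le_eq)
  also have "\<dots> = (\<Sum>j\<in>{k-i..<k}. coeff t (i + j - k) * dual_coeff t k f c j)"
    using i by (intro sum.reindex_bij_witness[of _ "\<lambda>j. k - j" "\<lambda>m. k - m"])
      (auto simp: a(4) intro!: arg_cong[of _ _ "coeff t"])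
  also have "\<dots> = (\<Sum>j\<in>{1..<k}. (if k \<le> i + j then coeff t (i + j - k) else 0) * dual_coeff t k f c j)"
    using i by (intro sum.mono_neutral_cong_left) auto
  finally show ?thesis by simp
qed

text \<open>
  The multiplication by \<open>x\<^bsup>n-k\<^esup>\<close> makes the coefficients of \<open>(f - c t) / t\<close> at \<open>x\<^bsup>-1\<^esup>, \<dots>, x\<^bsup>k-n\<^esup>\<close>
  visible to the polynomial quotient.
\<close>

definition "high_quotient = (monom 1 (n - k) * (f - Polynomial.smult c t)) div t"

lemma reduced_degree:
  shows "degree (f - Polynomial.smult c t) < n" 
    and "degree (g - Polynomial.smult c' t) < n"
proof -
  have "degree (p - Polynomial.smult b t) < n" if "degree p \<le> n" "coeff p n = b * coeff t n" for p b
  proof -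
    have "degree (p - Polynomial.smult b t) \<le> n"
      using that n by (intro degree_diff_le) auto
    moreover have "coeff (p - Polynomial.smult b t) n = 0"
      using that by simp
    ultimately show ?thesis
      using k by (metis degree_0 le_neq_implies_less leading_coeff_0_iff less_one less_trans not_less_zero
          gr_implies_not0 nat_less_le)
  qed
  then show "degree (f - Polynomial.smult c t) < n" "degree (g - Polynomial.smult c' t) < n"
    using f g by auto
qed

lemma high_quotient_zero: "m \<ge> n - k \<Longrightarrow> coeff high_quotient m = 0"
proof -
  have "degree (monom 1 (n - k) * (f - Polynomial.smult c t)) < degree t + (n - k)"
    using degree_mult_le[of "monom 1 (n - k)" "f - Polynomial.smult c t"]
      degree_monom_le[of "1 :: 'a" "n - k"] reduced_degree n by linarith
  then show "m \<ge> n - k \<Longrightarrow> coeff high_quotient m = 0"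
    unfolding high_quotient_def by (rule coeff_div_eq_0)
qed

lemma dual_coeff_high_eq: "j \<ge> k \<Longrightarrow> dual_coeff t k f c j = - coeff high_quotient (n - j)"
  by (simp add: dual_coeff_def high_quotient_def n)

lemma dual_coeff_high:
  assumes i: "k < i" "i < n"
  shows "(\<Sum>j\<in>{k<..<n}. coeff t (i + j - k) * dual_coeff t k f c j) = - (coeff f i - c * coeff t i)"
proof -
  let ?r = "(monom 1 (n - k) * (f - Polynomial.smult c t)) mod t"
  have eq: "high_quotient * t + ?r = monom 1 (n - k) * (f - Polynomial.smult c t)"
    unfolding high_quotient_def by simp
  have "coeff ?r (n - k + i) = 0"
    by (rule coeff_mod_eq_0) (use n i k in auto)
  then have "coeff (high_quotient * t) (n - k + i) = coeff (monom 1 (n - k) * (f - Polynomial.smult c t)) (n - k + i)"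
    by (metis eq coeff_add add.right_neutral)
  then have "coeff f i - c * coeff t i = coeff (high_quotient * t) (n - k + i)"
    by (simp add: coeff_monom_mult)
  also have "\<dots> = (\<Sum>m\<in>{1..<n-k}. coeff high_quotient m * coeff t (n - k + i - m))"
    unfolding coeff_mult using i
    by (intro sum.mono_neutral_right ballI) (auto simp: Suc_le_eq not_less high_quotient_zero n intro: coeff_eq_0)
  also have "\<dots> = (\<Sum>j\<in>{k<..<n}. coeff high_quotient (n - j) * coeff t (i + j - k))"
    using i k by (intro sum.reindex_bij_witness[of _ "\<lambda>j. n - j" "\<lambda>m. n - m"])
      (auto intro!: arg_cong[of _ _ "coeff t"])
  also have "\<dots> = (\<Sum>j\<in>{k<..<n}. - (coeff t (i + j - k) * dual_coeff t k f c j))"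
    by (intro sum.cong) (auto simp: dual_coeff_high_eq)
  finally show ?thesis
    by (simp add: sum_negf)
qed

text \<open>
  The block sums are the coefficients of \<open>x\<^sup>k\<close> in \<open>f g / t\<close> at \<open>0\<close> and in
  \<open>(f - c t) (g - c' t) / t\<close> at infinity. The latter is \<open>f g / t - c g - c' f + c c' t\<close>. As \<open>t\<close> has no term of degree
  \<open>k\<close>, the two boundary terms \<open>c g\<^sub>k\<close> and \<open>c' f\<^sub>k\<close> are exactly the discrepancy.
\<close>

lemma dual_coeff_pairing:
  "(\<Sum>j\<in>{1..<k}. dual_coeff t k f c j * coeff g j)
    + (\<Sum>j\<in>{k<..<n}. dual_coeff t k f c j * (coeff g j - c' * coeff t j))
    - c * coeff g k - c' * coeff f k = residue_0_inf t k (f * g)"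
proof -
  obtain a h where a: "f = t * a + monom 1 k * h" "\<And>i. i \<ge> k \<Longrightarrow> coeff a i = 0" "coeff a 0 = 0"
    "\<And>j. j < k \<Longrightarrow> dual_coeff t k f c j = coeff a (k - j)"
    using dual_coeff_low_obtain by blast
  have tpos: "degree t > 0" using n k by simp
  obtain g' where g': "g = pCons 0 g'"
    using g(2) by (metis pCons_cases coeff_pCons_0)
  have fg: "f * g = t * (a * g) + monom 1 (Suc k) * (h * g')"
    by (subst a(1)) (simp add: g' algebra_simps monom_Suc)
  have low: "coeff (a * g) k = (\<Sum>j\<in>{1..<k}. dual_coeff t k f c j * coeff g j)"
  proof -
    have "coeff (a * g) k = (\<Sum>j\<le>k. coeff g j * coeff a (k - j))"
      by (simp add: mult.commute[of a] coeff_mult)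
    also have "\<dots> = (\<Sum>j\<in>{1..<k}. coeff g j * coeff a (k - j))"
      using g(2) a(3) by (intro sum.mono_neutral_right) (auto simp: Suc_le_eq not_less)
    also have "\<dots> = (\<Sum>j\<in>{1..<k}. dual_coeff t k f c j * coeff g j)"
      using a(4) by (intro sum.cong) auto
    finally show ?thesis .
  qed
  define F where "F = f - Polynomial.smult c t"
  define G where "G = g - Polynomial.smult c' t"
  have Gj: "coeff G j = coeff g j - c' * coeff t j" for j
    by (simp add: G_def)
  have Gn: "coeff G n = 0"
    using g(3) by (simp add: Gj)
  have high: "coeff ((F * G) div t) k = coeff (high_quotient * G) n"
  proof -
    let ?r = "(monom 1 (n - k) * F) mod t"
    have "coeff ((F * G) div t) k = coeff ((monom 1 (n - k) * (F * G)) div t) (n - k + k)"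
      by (rule coeff_monom_mult_div[OF tpos, symmetric])
    also have "monom 1 (n - k) * (F * G) = (high_quotient * t + ?r) * G"
      unfolding high_quotient_def F_def by simp
    also have "\<dots> = (high_quotient * G) * t + ?r * G"
      by (simp add: algebra_simps)
    also have "\<dots> div t = high_quotient * G + (?r * G) div t"
      using tpos by (metis add.commute degree_0 div_mult_self1 less_numeral_extra(3))
    also have "coeff (high_quotient * G + (?r * G) div t) (n - k + k) = coeff (high_quotient * G) n + coeff ((?r * G) div t) n"
      using k by simp
    also have "coeff ((?r * G) div t) n = 0"
    proof (rule coeff_div_eq_0[where m = n])
      have "degree ?r < degree t"
        using tpos by (rule degree_mod_lt)
      then show "degree (?r * G) < degree t + n"
        using degree_mult_le[of ?r G] reduced_degree(2) unfolding G_def n by linarith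
    qed simp
    finally show ?thesis by simp
  qed
  have "coeff (high_quotient * G) n = (\<Sum>j\<le>n. coeff G j * coeff high_quotient (n - j))"
    by (simp add: mult.commute[of high_quotient] coeff_mult)
  also have "\<dots> = (\<Sum>j\<in>{k<..<n}. coeff G j * coeff high_quotient (n - j))"
  proof (intro sum.mono_neutral_right ballI)
    fix j assume "j \<in> {..n} - {k<..<n}"
    then consider "j = n" | "j \<le> k" by fastforce
    then show "coeff G j * coeff high_quotient (n - j) = 0"
      using Gn by cases (simp_all add: high_quotient_zero)
  qed auto
  also have "\<dots> = - (\<Sum>j\<in>{k<..<n}. dual_coeff t k f c j * coeff G j)"
    unfolding sum_negf[symmetric] by (intro sum.cong) (auto simp: dual_coeff_high_eq)
  finally have high': "coeff ((F * G) div t) k = - (\<Sum>j\<in>{k<..<n}. dual_coeff t k f c j * coeff G j)"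
    using high by simp
  have "F * G = f * g + (Polynomial.smult (c * c') t - Polynomial.smult c g - Polynomial.smult c' f) * t"
    unfolding F_def G_def by (simp add: algebra_simps smult_diff_right smult_diff_left)
  then have "(F * G) div t = (f * g) div t + (Polynomial.smult (c * c') t - Polynomial.smult c g - Polynomial.smult c' f)"
    using tpos by (metis add.commute degree_0 div_mult_self1 less_numeral_extra(3))
  then have "coeff ((f * g) div t) k = coeff ((F * G) div t) k + c * coeff g k + c' * coeff f k"
    by (simp add: tk)
  then show ?thesis
    unfolding residue_0_inf_eq[OF t0 fg] low high' Gj by simp
qed

end

section \<open>Products of linear factors and their cofactors\<close>

definition lin_prod :: "nat \<Rightarrow> (nat \<Rightarrow> complex) \<Rightarrow> complex poly" where
  "lin_prod d \<xi> = (\<Prod>b = 1..d+1. [:\<xi> b, 1:])"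

definition lin_cofactor :: "nat \<Rightarrow> (nat \<Rightarrow> complex) \<Rightarrow> nat \<Rightarrow> complex poly" where
  "lin_cofactor d \<xi> b = (\<Prod>c\<in>{1..d+1} - {b}. [:\<xi> c, 1:])"

lemma degree_prod_linear: "finite S \<Longrightarrow> degree (\<Prod>b\<in>S. [:f b, 1 :: complex:]) = card S"
  by (subst degree_prod_eq_sum_degree) auto

lemma monic_prod_linear: "lead_coeff (\<Prod>b\<in>S. [:f b, 1 :: complex:]) = 1"
  by (simp add: lead_coeff_prod)

lemma degree_lin_prod: "degree (lin_prod d \<xi>) = Suc d"
  unfolding lin_prod_def by (subst degree_prod_linear) auto

lemma lead_coeff_lin_prod: "coeff (lin_prod d \<xi>) (Suc d) = 1"
  using monic_prod_linear[of \<xi> "{1..d+1}"] degree_lin_prod[of d \<xi>] by (simp add: lin_prod_def)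

lemma degree_lin_cofactor:
  assumes "b \<in> {1..d+1}"
  shows "degree (lin_cofactor d \<xi> b) = d"
  unfolding lin_cofactor_def using assms by (subst degree_prod_linear) auto

lemma lead_coeff_lin_cofactor:
  assumes "b \<in> {1..d+1}"
  shows "coeff (lin_cofactor d \<xi> b) d = 1"
  using monic_prod_linear[of \<xi> "{1..d+1} - {b}"] degree_lin_cofactor[OF assms, of \<xi>]
  by (simp add: lin_cofactor_def)

lemma lin_prod_eq_cofactor:
  assumes "b \<in> {1..d+1}"
  shows "lin_prod d \<xi> = [:\<xi> b, 1:] * lin_cofactor d \<xi> b"
  unfolding lin_prod_def lin_cofactor_def using assms by (subst prod.remove[of _ b]) auto

lemma poly_lin_cofactor: "poly (lin_cofactor d \<xi> b) c = (\<Prod>a\<in>{1..d+1} - {b}. \<xi> a + c)"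
  by (simp add: lin_cofactor_def poly_prod)

lemma poly_lin_cofactor_other:
  assumes "b \<in> {1..d+1}" "a \<in> {1..d+1}" "a \<noteq> b"
  shows "poly (lin_cofactor d \<xi> b) (- \<xi> a) = 0"
  unfolding poly_lin_cofactor by (rule prod_zero) (use assms in auto)

text \<open>
  Each cofactor vanishes at all the other nodes, so modulo the product of the linear factors the cofactors are orthogonal.
  This holds for coinciding nodes as well.
\<close>

lemma lin_cofactor_mult_mod:
  assumes "a \<in> {1..d+1}" "b \<in> {1..d+1}"
  shows "(lin_cofactor d \<xi> a * lin_cofactor d \<xi> b) mod lin_prod d \<xi>
    = (if a = b then Polynomial.smult (poly (lin_cofactor d \<xi> b) (- \<xi> b)) (lin_cofactor d \<xi> b) else 0)"
proof -
  define c where "c = (if a = b then poly (lin_cofactor d \<xi> b) (- \<xi> b) else 0)"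
  have "poly (lin_cofactor d \<xi> a - [:c:]) (- \<xi> b) = 0"
    using assms poly_lin_cofactor_other[of a d b \<xi>] by (auto simp: c_def)
  then have "[:\<xi> b, 1:] dvd lin_cofactor d \<xi> a - [:c:]"
    using poly_eq_0_iff_dvd[of "lin_cofactor d \<xi> a - [:c:]" "- \<xi> b"] by (simp only: minus_minus)
  then obtain g where g: "lin_cofactor d \<xi> a - [:c:] = [:\<xi> b, 1:] * g"
    by (rule dvdE)
  have "lin_cofactor d \<xi> a * lin_cofactor d \<xi> b
      = [:c:] * lin_cofactor d \<xi> b + (lin_cofactor d \<xi> a - [:c:]) * lin_cofactor d \<xi> b"
    by (simp add: algebra_simps)
  also have "\<dots> = [:c:] * lin_cofactor d \<xi> b + g * lin_prod d \<xi>"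
    unfolding g by (simp only: lin_prod_eq_cofactor[OF assms(2)] ac_simps)
  finally have "(lin_cofactor d \<xi> a * lin_cofactor d \<xi> b) mod lin_prod d \<xi>
      = ([:c:] * lin_cofactor d \<xi> b) mod lin_prod d \<xi>"
    by simp
  also have "\<dots> = [:c:] * lin_cofactor d \<xi> b"
    using assms by (intro mod_poly_less) (simp add: degree_lin_cofactor degree_lin_prod degree_smult_le le_less_trans)
  finally show ?thesis
    by (simp add: c_def)
qed

definition cofactor_coord_mat :: "nat \<Rightarrow> (nat \<Rightarrow> complex) \<Rightarrow> complex mat" where
  "cofactor_coord_mat d \<xi> = Matrix.mat (d + 1) (d + 1) (\<lambda>(i, b). coeff (lin_cofactor d \<xi> (b + 1)) i)"

lemma det_diagonal:
  "Determinant.det (Matrix.mat n n (\<lambda>(i, j). if i = j then f i else 0)) = (\<Prod>i<n. f i)"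
proof -
  let ?D = "Matrix.mat n n (\<lambda>(i, j). if i = j then f i else 0)"
  have "Determinant.det ?D = prod_list (diag_mat ?D)"
    by (rule det_upper_triangular[where n = n]) (auto simp: upper_triangular_def)
  also have "diag_mat ?D = map f [0..<n]"
    unfolding diag_mat_def by (rule map_cong) auto
  also have "prod_list (map f [0..<n]) = (\<Prod>i<n. f i)"
    using prod.distinct_set_conv_list[of "[0..<n]" f] by (simp add: lessThan_atLeast0)
  finally show ?thesis .
qed

lemma prod_shift_Suc: "(\<Prod>b<d+1. (f :: nat \<Rightarrow> complex) (b + 1)) = (\<Prod>b = 1..d+1. f b)"
  using prod.atLeast1_atMost_eq[of f "d + 1"] by (simp del: prod.cl_ivl_Suc prod.lessThan_Suc)

text \<open>
  The form of \<open>det_residue_form\<close> for the product of the linear factors is diagonal on the cofactors. This yields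
  the square of the Vandermonde-like determinant without a case distinction for coinciding nodes.
\<close>

lemma det_cofactor_coord_mat_square:
  "Determinant.det (exchange_mat (d + 1) :: complex mat) * Determinant.det (cofactor_coord_mat d \<xi>) ^ 2
     = (\<Prod>b = 1..d+1. poly (lin_cofactor d \<xi> b) (- \<xi> b))"
proof -
  let ?R = "lin_prod d \<xi>"
  have deg: "degree ?R = d + 1" by (simp add: degree_lin_prod)
  have "residue_coord_mat ?R (\<lambda>r. lin_cofactor d \<xi> (r + 1)) = cofactor_coord_mat d \<xi>"
    unfolding residue_coord_mat_def cofactor_coord_mat_def deg
    by (rule eq_matI) (auto simp: mod_poly_less degree_lin_cofactor degree_lin_prod)
  moreover have "Matrix.mat (d + 1) (d + 1) (\<lambda>(r, s). coeff ((1 * lin_cofactor d \<xi> (r + 1) * lin_cofactor d \<xi> (s + 1)) mod ?R) (d + 1 - 1))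
    = Matrix.mat (d + 1) (d + 1) (\<lambda>(r, s). if r = s then poly (lin_cofactor d \<xi> (r + 1)) (- \<xi> (r + 1)) else 0)"
    by (rule eq_matI) (auto simp: lin_cofactor_mult_mod lead_coeff_lin_cofactor[simplified] simp del: mult_pCons_left)
  ultimately show ?thesis
    using det_residue_form[of ?R 1 "\<lambda>r. lin_cofactor d \<xi> (r + 1)"]
      prod_shift_Suc[of "\<lambda>b. poly (lin_cofactor d \<xi> b) (- \<xi> b)" d]
    unfolding deg
    by (simp add: det_diagonal residue_norm_1 deg del: prod.cl_ivl_Suc prod.lessThan_Suc)
qed

lemma det_cofactor_combination:
  fixes q :: "complex poly"
  assumes q: "degree q = d + 1"
    and \<nu>: "\<And>r. r < d + 1 \<Longrightarrow> \<nu> r mod q = (\<Sum>b = 1..d+1. Polynomial.smult (c b * \<phi> r b) (lin_cofactor d \<xi> b)) mod q"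
  shows "Determinant.det (residue_coord_mat q \<nu>) = Determinant.det (cofactor_coord_mat d \<xi>) * (\<Prod>b = 1..d+1. c b)
     * Determinant.det (Matrix.mat (d + 1) (d + 1) (\<lambda>(b, r). \<phi> r (b + 1)))"
proof -
  let ?C = "cofactor_coord_mat d \<xi>"
  let ?D = "Matrix.mat (d + 1) (d + 1) (\<lambda>(i, j). if i = j then c (i + 1) else 0)"
  let ?F = "Matrix.mat (d + 1) (d + 1) (\<lambda>(b, r). \<phi> r (b + 1))"
  have C: "?C \<in> carrier_mat (d + 1) (d + 1)"
    by (simp add: cofactor_coord_mat_def)
  have DF: "?D * ?F = Matrix.mat (d + 1) (d + 1) (\<lambda>(b, r). c (b + 1) * \<phi> r (b + 1))"
  proof (rule eq_matI)
    fix b r assume "b < dim_row (Matrix.mat (d + 1) (d + 1) (\<lambda>(b, r). c (b + 1) * \<phi> r (b + 1)))"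
      "r < dim_col (Matrix.mat (d + 1) (d + 1) (\<lambda>(b, r). c (b + 1) * \<phi> r (b + 1)))"
    then have br: "b < d + 1" "r < d + 1" by auto
    then have "(?D * ?F) $$ (b, r) = (\<Sum>i = 0..<d+1. (if b = i then c (b + 1) else 0) * \<phi> r (i + 1))"
      by (simp add: scalar_prod_def del: sum.op_ivl_Suc)
    also have "\<dots> = (\<Sum>i = 0..<d+1. if b = i then c (b + 1) * \<phi> r (i + 1) else 0)"
      by (rule sum.cong) auto
    also have "\<dots> = c (b + 1) * \<phi> r (b + 1)"
      using br by (subst sum.delta') auto
    finally show "(?D * ?F) $$ (b, r) = Matrix.mat (d + 1) (d + 1) (\<lambda>(b, r). c (b + 1) * \<phi> r (b + 1)) $$ (b, r)"
      using br by simp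
  qed auto
  have "residue_coord_mat q \<nu> = ?C * (?D * ?F)"
  proof (rule eq_matI)
    fix i r assume "i < dim_row (?C * (?D * ?F))" "r < dim_col (?C * (?D * ?F))"
    then have ir: "i < d + 1" "r < d + 1" by (auto simp: cofactor_coord_mat_def)
    have "degree (\<Sum>b = 1..d+1. Polynomial.smult (c b * \<phi> r b) (lin_cofactor d \<xi> b)) < degree q"
    proof -
      have "degree (\<Sum>b = 1..d+1. Polynomial.smult (c b * \<phi> r b) (lin_cofactor d \<xi> b)) \<le> d"
        by (rule degree_sum_le) (auto simp: degree_lin_cofactor)
      then show ?thesis using q by simp
    qed
    then have "residue_coord_mat q \<nu> $$ (i, r) = (\<Sum>b = 1..d+1. c b * \<phi> r b * coeff (lin_cofactor d \<xi> b) i)"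
      using ir q by (simp add: residue_coord_mat_def \<nu> mod_poly_less coeff_sum del: sum.cl_ivl_Suc)
    also have "\<dots> = (\<Sum>b<d+1. c (b + 1) * \<phi> r (b + 1) * coeff (lin_cofactor d \<xi> (b + 1)) i)"
      using sum.atLeast1_atMost_eq[of "\<lambda>b. c b * \<phi> r b * coeff (lin_cofactor d \<xi> b) i" "d + 1"] by simp
    also have "\<dots> = (?C * (?D * ?F)) $$ (i, r)"
      unfolding DF using ir
      by (simp add: cofactor_coord_mat_def scalar_prod_def lessThan_atLeast0 ac_simps)
    finally show "residue_coord_mat q \<nu> $$ (i, r) = (?C * (?D * ?F)) $$ (i, r)" .
  qed (auto simp: residue_coord_mat_def cofactor_coord_mat_def q)
  then show ?thesis
    using det_mult[OF C, of "?D * ?F"] det_mult[of ?D "d + 1" ?F]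
      mult_carrier_mat[of ?D "d + 1" "d + 1" ?F "d + 1"] det_diagonal[of "d + 1" "\<lambda>i. c (i + 1)"] prod_shift_Suc[of c d]
    by (simp del: prod.cl_ivl_Suc prod.lessThan_Suc)
qed

text \<open>
  With \<open>R\<close> the product of the linear factors, this is \<open>R (x \<Sum>\<^sub>b m\<^sub>b / (x + \<xi>\<^sub>b) - k)\<close>: the logarithmic derivative
  of \<open>x\<^bsup>-k\<^esup> \<Prod>\<^sub>b (x + \<xi>\<^sub>b)\<^bsup>m\<^sub>b\<^esup>\<close>, times \<open>x R\<close>. If the \<open>\<xi>\<^sub>b\<close> are
  distinct and non-zero, its zeros are the critical points other than the \<open>-\<xi>\<^sub>b\<close>.
\<close>

definition crit_poly :: "nat \<Rightarrow> (nat \<Rightarrow> complex) \<Rightarrow> (nat \<Rightarrow> nat) \<Rightarrow> nat \<Rightarrow> complex poly" where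
  "crit_poly d \<xi> m k = Polynomial.smult (of_nat (\<Sum>b = 1..d+1. m b) - of_nat k) (lin_prod d \<xi>)
     - (\<Sum>b = 1..d+1. Polynomial.smult (of_nat (m b) * \<xi> b) (lin_cofactor d \<xi> b))"

lemma degree_crit_poly_aux:
  "degree (\<Sum>b = 1..d+1. Polynomial.smult (of_nat (m b) * \<xi> b) (lin_cofactor d \<xi> b)) < Suc d"
  using degree_sum_le[of "{1..d+1}" "\<lambda>b. Polynomial.smult (of_nat (m b) * \<xi> b) (lin_cofactor d \<xi> b)" d]
  by (auto simp: degree_lin_cofactor less_Suc_eq_le simp del: sum.cl_ivl_Suc)

lemma coeff_crit_poly_top:
  "coeff (crit_poly d \<xi> m k) (Suc d) = of_nat (\<Sum>b = 1..d+1. m b) - of_nat k"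
  using coeff_eq_0[OF degree_crit_poly_aux[of m \<xi> d]]
  by (simp add: crit_poly_def lead_coeff_lin_prod del: sum.cl_ivl_Suc)

lemma degree_crit_poly:
  assumes "k \<noteq> (\<Sum>b = 1..d+1. m b)"
  shows "degree (crit_poly d \<xi> m k) = Suc d"
proof (rule antisym)
  show "degree (crit_poly d \<xi> m k) \<le> Suc d"
    unfolding crit_poly_def using degree_crit_poly_aux[of m \<xi> d] degree_lin_prod[of d \<xi>]
    by (intro degree_diff_le) (auto simp del: sum.cl_ivl_Suc)
  show "Suc d \<le> degree (crit_poly d \<xi> m k)"
    using assms
    by (intro le_degree) (metis coeff_crit_poly_top eq_iff_diff_eq_0 of_nat_eq_iff)
qed

lemma poly_crit_poly_node:
  assumes "b \<in> {1..d+1}"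
  shows "poly (crit_poly d \<xi> m k) (- \<xi> b) = - (of_nat (m b) * \<xi> b * poly (lin_cofactor d \<xi> b) (- \<xi> b))"
proof -
  have "poly (lin_prod d \<xi>) (- \<xi> b) = 0"
    by (simp add: lin_prod_eq_cofactor[OF assms])
  moreover have "(\<Sum>a = 1..d+1. of_nat (m a) * \<xi> a * poly (lin_cofactor d \<xi> a) (- \<xi> b))
     = (\<Sum>a\<in>{b}. of_nat (m a) * \<xi> a * poly (lin_cofactor d \<xi> a) (- \<xi> b))"
    using assms by (intro sum.mono_neutral_right) (auto simp: poly_lin_cofactor_other)
  ultimately show ?thesis
    by (simp add: crit_poly_def poly_sum del: sum.cl_ivl_Suc)
qed

lemma poly_crit_poly_0: "poly (crit_poly d \<xi> m k) 0 = - (of_nat k * (\<Prod>b = 1..d+1. \<xi> b))"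
proof -
  have "\<xi> b * poly (lin_cofactor d \<xi> b) 0 = (\<Prod>b = 1..d+1. \<xi> b)" if "b \<in> {1..d+1}" for b
    unfolding poly_lin_cofactor using that by (subst prod.remove[of _ b]) auto
  then have "(\<Sum>b = 1..d+1. of_nat (m b) * \<xi> b * poly (lin_cofactor d \<xi> b) 0)
      = (\<Sum>b = 1..d+1. of_nat (m b) * (\<Prod>b = 1..d+1. \<xi> b))"
    by (intro sum.cong) (auto simp: mult.assoc)
  moreover have "poly (lin_prod d \<xi>) 0 = (\<Prod>b = 1..d+1. \<xi> b)"
    by (simp add: lin_prod_def poly_prod)
  ultimately show ?thesis
    by (simp add: crit_poly_def poly_sum sum_distrib_right[symmetric] left_diff_distrib
        del: sum.cl_ivl_Suc prod.cl_ivl_Suc)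
qed

definition stratum_const :: "nat \<Rightarrow> (nat \<Rightarrow> nat) \<Rightarrow> nat \<Rightarrow> complex" where
  "stratum_const d m k = (\<Prod>b = 1..d+1. of_nat (m b) ^ 2 * ((- 1) ^ d * of_nat (m b) / (of_nat (\<Sum>b = 1..d+1. m b) - of_nat k)) ^ (m b - 1))
     / ((- 1) ^ d * of_nat k / (of_nat (\<Sum>b = 1..d+1. m b) - of_nat k)) ^ Suc k"

text \<open>
  The norm of \<open>w\<close> is determined by multiplicativity, since \<open>x\<^bsup>k+1\<^esup> w\<close> is congruent to a product of powers of
  the \<open>x + \<xi>\<^sub>b\<close> and the norms of linear polynomials are known.
\<close>

lemma det_stratum_form:
  fixes \<xi> :: "nat \<Rightarrow> complex" and m :: "nat \<Rightarrow> nat"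
  assumes \<xi>: "\<And>b. b \<in> {1..d+1} \<Longrightarrow> \<xi> b \<noteq> 0" and m: "\<And>b. b \<in> {1..d+1} \<Longrightarrow> m b \<ge> 1"
    and k: "1 \<le> k" "k < (\<Sum>b = 1..d+1. m b)"
    and w: "(\<Prod>b = 1..d+1. [:\<xi> b, 1:] ^ (m b - 1)) = crit_poly d \<xi> m k * s + monom 1 (Suc k) * w"
    and \<nu>: "\<And>r. r < d + 1 \<Longrightarrow> \<nu> r mod crit_poly d \<xi> m k
       = (\<Sum>b = 1..d+1. Polynomial.smult (of_nat (m b) * \<xi> b * \<phi> r b) (lin_cofactor d \<xi> b)) mod crit_poly d \<xi> m k"
  shows "Determinant.det (Matrix.mat (d + 1) (d + 1) (\<lambda>(r, s). coeff ((w * \<nu> r * \<nu> s) mod crit_poly d \<xi> m k) d))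
     = stratum_const d m k * Determinant.det (Matrix.mat (d + 1) (d + 1) (\<lambda>(b, r). \<phi> r (b + 1))) ^ 2
       * (\<Prod>b = 1..d+1. \<xi> b ^ m b) * (\<Prod>b = 1..d+1. \<xi> b powi (- int k))
       * (\<Prod>b = 1..d+1. poly (lin_cofactor d \<xi> b) (- \<xi> b) ^ m b)"
proof -
  define Q where "Q = crit_poly d \<xi> m k"
  define N where "N = (of_nat (\<Sum>b = 1..d+1. m b) - of_nat k :: complex)"
  define R where "R = (\<lambda>b. poly (lin_cofactor d \<xi> b) (- \<xi> b))"
  define \<Phi> where "\<Phi> = Determinant.det (Matrix.mat (d + 1) (d + 1) (\<lambda>(b, r). \<phi> r (b + 1)))"
  let ?J = "Determinant.det (exchange_mat (d + 1) :: complex mat)"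
  have N: "N \<noteq> 0"
    unfolding N_def using k by (metis eq_iff_diff_eq_0 of_nat_eq_iff less_irrefl)
  have deg: "degree Q = d + 1"
    using k by (simp add: Q_def degree_crit_poly del: sum.cl_ivl_Suc)
  have lc: "lead_coeff Q = N"
    using coeff_crit_poly_top[of d \<xi> m k] by (simp add: deg Q_def[symmetric] N_def del: sum.cl_ivl_Suc)
  have norm_linear: "residue_norm Q [:\<xi> b, 1:] = (- 1) ^ d * of_nat (m b) / N * (\<xi> b * R b)"
    if "b \<in> {1..d+1}" for b
    using residue_norm_linear[of Q d "- \<xi> b"] deg poly_crit_poly_node[OF that, of \<xi> m k] lc
    by (simp add: Q_def[symmetric] R_def)
  have norm_x: "residue_norm Q (monom 1 1) = (- 1) ^ d * of_nat k / N * (\<Prod>b = 1..d+1. \<xi> b)"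
    using residue_norm_linear[of Q d 0] deg poly_crit_poly_0[of d \<xi> m k] lc
    by (simp add: Q_def[symmetric] monom_Suc monom_0 del: prod.cl_ivl_Suc)
  have "residue_norm Q (\<Prod>b = 1..d+1. [:\<xi> b, 1:] ^ (m b - 1)) = residue_norm Q (monom 1 (Suc k) * w)"
    unfolding w Q_def[symmetric] by (intro residue_norm_cong) simp
  also have "\<dots> = residue_norm Q (monom 1 1) ^ Suc k * residue_norm Q w"
    using deg by (simp add: residue_norm_mult residue_norm_power[symmetric] monom_power del: power_Suc)
  also have "residue_norm Q (\<Prod>b = 1..d+1. [:\<xi> b, 1:] ^ (m b - 1))
     = (\<Prod>b = 1..d+1. ((- 1) ^ d * of_nat (m b) / N * (\<xi> b * R b)) ^ (m b - 1))"
    using deg unfolding norm_linear[symmetric]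
    by (subst residue_norm_prod) (auto simp: residue_norm_power norm_linear simp del: prod.cl_ivl_Suc intro!: prod.cong)
  finally have norm_w: "residue_norm Q w * ((- 1) ^ d * of_nat k / N) ^ Suc k * (\<Prod>b = 1..d+1. \<xi> b) ^ Suc k
      = (\<Prod>b = 1..d+1. ((- 1) ^ d * of_nat (m b) / N * (\<xi> b * R b)) ^ (m b - 1))"
    unfolding norm_x by (simp only: power_mult_distrib mult.commute mult.left_commute mult.assoc)
  have "Determinant.det (Matrix.mat (d + 1) (d + 1) (\<lambda>(r, s). coeff ((w * \<nu> r * \<nu> s) mod Q) d))
      = ?J * residue_norm Q w * Determinant.det (residue_coord_mat Q \<nu>) ^ 2"
    using det_residue_form[of Q w \<nu>] deg by simp
  also have "Determinant.det (residue_coord_mat Q \<nu>)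
      = Determinant.det (cofactor_coord_mat d \<xi>) * (\<Prod>b = 1..d+1. of_nat (m b) * \<xi> b) * \<Phi>"
    unfolding \<Phi>_def by (rule det_cofactor_combination) (use \<nu> deg in \<open>simp_all add: Q_def\<close>)
  also have "?J * residue_norm Q w * (Determinant.det (cofactor_coord_mat d \<xi>) * (\<Prod>b = 1..d+1. of_nat (m b) * \<xi> b) * \<Phi>) ^ 2
      = (?J * Determinant.det (cofactor_coord_mat d \<xi>) ^ 2) * residue_norm Q w * (\<Prod>b = 1..d+1. of_nat (m b) * \<xi> b) ^ 2 * \<Phi> ^ 2"
    by (simp add: power_mult_distrib)
  also have "?J * Determinant.det (cofactor_coord_mat d \<xi>) ^ 2 = (\<Prod>b = 1..d+1. R b)"
    unfolding R_def by (rule det_cofactor_coord_mat_square)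
  finally have det: "Determinant.det (Matrix.mat (d + 1) (d + 1) (\<lambda>(r, s). coeff ((w * \<nu> r * \<nu> s) mod Q) d))
      = (\<Prod>b = 1..d+1. R b) * residue_norm Q w * (\<Prod>b = 1..d+1. of_nat (m b) * \<xi> b) ^ 2 * \<Phi> ^ 2" .
  define K where "K = (- 1) ^ d * of_nat k / N"
  have K: "K \<noteq> 0"
    using k N by (auto simp: K_def)
  define X where "X = (\<Prod>b = 1..d+1. \<xi> b)"
  have X: "X \<noteq> 0"
    using \<xi> by (auto simp: X_def)
  have norm_w': "residue_norm Q w = (\<Prod>b = 1..d+1. ((- 1) ^ d * of_nat (m b) / N * (\<xi> b * R b)) ^ (m b - 1)) / (K ^ Suc k * X ^ Suc k)"
    using norm_w K X unfolding K_def[symmetric] X_def[symmetric]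
    by (subst nonzero_eq_divide_eq) (simp_all only: mult.assoc power_eq_0_iff mult_eq_0_iff simp_thms)
  have "(\<Prod>b = 1..d+1. R b) * (\<Prod>b = 1..d+1. of_nat (m b) * \<xi> b) ^ 2
       * (\<Prod>b = 1..d+1. ((- 1) ^ d * of_nat (m b) / N * (\<xi> b * R b)) ^ (m b - 1))
     = (\<Prod>b = 1..d+1. of_nat (m b) ^ 2 * ((- 1) ^ d * of_nat (m b) / N) ^ (m b - 1))
       * (\<Prod>b = 1..d+1. \<xi> b ^ m b) * X * (\<Prod>b = 1..d+1. R b ^ m b)"
    unfolding X_def prod_power_distrib prod.distrib[symmetric]
  proof (rule prod.cong[OF refl])
    fix b assume "b \<in> {1..d+1}"
    then have mb: "Suc (m b - 1) = m b" using m[of b] by simp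
    have "r * (c * x)\<^sup>2 * (e * (x * r)) ^ j = c\<^sup>2 * e ^ j * x ^ Suc j * x * r ^ Suc j"
      for r c x e :: complex and j
      by (simp add: power_mult_distrib power2_eq_square)
    from this[of "R b" "of_nat (m b)" "\<xi> b" _ "m b - 1"]
    show "R b * (of_nat (m b) * \<xi> b)\<^sup>2 * ((- 1) ^ d * of_nat (m b) / N * (\<xi> b * R b)) ^ (m b - 1) =
         of_nat (m b) ^ 2 * ((- 1) ^ d * of_nat (m b) / N) ^ (m b - 1) * \<xi> b ^ m b * \<xi> b * R b ^ m b"
      unfolding mb .
  qed
  moreover have "(\<Prod>b = 1..d+1. \<xi> b powi (- int k)) = 1 / X ^ k"
    unfolding X_def prod_power_distrib
    by (simp only: power_int_minus power_int_of_nat inverse_eq_divide prod_dividef prod.neutral_const)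
  moreover have "p * (y / (c * X ^ Suc k)) * z * f = e / c * f * g * (1 / X ^ k) * h"
    if "p * z * y = e * g * X * h" for p y c z e f g h :: complex
  proof -
    have "p * (y / (c * X ^ Suc k)) * z * f = (p * z * y) / (c * X ^ Suc k) * f"
      by simp
    also have "\<dots> = e / c * f * g * (1 / X ^ k) * h"
      unfolding that using X by simp
    finally show ?thesis .
  qed
  ultimately show ?thesis
    unfolding Q_def[symmetric] \<Phi>_def[symmetric] det norm_w' stratum_const_def N_def[symmetric] K_def[symmetric]
    by (simp only: R_def)
qed

text \<open>
  The pair \<open>a < b\<close> contributes \<open>(\<xi>\<^sub>a - \<xi>\<^sub>b)\<^bsup>m\<^sub>b\<^esup>\<close> through the node \<open>b\<close> and
  \<open>(\<xi>\<^sub>b - \<xi>\<^sub>a)\<^bsup>m\<^sub>a\<^esup>\<close> through the node \<open>a\<close>; the sign depends on the multiplicities only.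
\<close>

lemma prod_cofactor_values:
  fixes \<xi> :: "nat \<Rightarrow> complex"
  shows "(\<Prod>b = 1..d+1. poly (lin_cofactor d \<xi> b) (- \<xi> b) ^ m b)
     = (\<Prod>b = 1..d+1. \<Prod>a\<in>{1..<b}. (- 1) ^ m a) * (\<Prod>b = 1..d+1. \<Prod>a\<in>{1..<b}. (\<xi> a - \<xi> b) ^ (m a + m b))"
proof -
  let ?I = "{1..d+1}"
  have split: "poly (lin_cofactor d \<xi> b) (- \<xi> b) ^ m b
     = (\<Prod>a\<in>{1..<b}. (\<xi> a - \<xi> b) ^ m b) * (\<Prod>a\<in>{b<..d+1}. (\<xi> a - \<xi> b) ^ m b)" if "b \<in> ?I" for b
  proof -
    have "?I - {b} = {1..<b} \<union> {b<..d+1}"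
      using that by auto
    then have "poly (lin_cofactor d \<xi> b) (- \<xi> b) ^ m b
        = (\<Prod>a\<in>{1..<b} \<union> {b<..d+1}. (\<xi> a - \<xi> b) ^ m b)"
      by (simp only: poly_lin_cofactor prod_power_distrib add_uminus_conv_diff)
    also have "\<dots> = (\<Prod>a\<in>{1..<b}. (\<xi> a - \<xi> b) ^ m b) * (\<Prod>a\<in>{b<..d+1}. (\<xi> a - \<xi> b) ^ m b)"
      by (rule prod.union_disjoint) auto
    finally show ?thesis .
  qed
  have "(\<Prod>b = 1..d+1. poly (lin_cofactor d \<xi> b) (- \<xi> b) ^ m b)
     = (\<Prod>b = 1..d+1. \<Prod>a\<in>{1..<b}. (\<xi> a - \<xi> b) ^ m b) * (\<Prod>b = 1..d+1. \<Prod>a\<in>{b<..d+1}. (\<xi> a - \<xi> b) ^ m b)"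
    unfolding prod.distrib[symmetric] by (intro prod.cong refl split)
  also have "(\<Prod>b = 1..d+1. \<Prod>a\<in>{b<..d+1}. (\<xi> a - \<xi> b) ^ m b)
     = (\<Prod>b = 1..d+1. \<Prod>a\<in>{1..<b}. (\<xi> b - \<xi> a) ^ m a)"
    unfolding prod.Sigma[OF finite_atLeastAtMost ballI[OF finite_greaterThanAtMost]]
      prod.Sigma[OF finite_atLeastAtMost ballI[OF finite_atLeastLessThan]]
    by (rule prod.reindex_bij_witness[of _ prod.swap prod.swap]) auto
  also have "(\<Prod>b = 1..d+1. \<Prod>a\<in>{1..<b}. (\<xi> a - \<xi> b) ^ m b) * (\<Prod>b = 1..d+1. \<Prod>a\<in>{1..<b}. (\<xi> b - \<xi> a) ^ m a)
     = (\<Prod>b = 1..d+1. \<Prod>a\<in>{1..<b}. (- 1) ^ m a) * (\<Prod>b = 1..d+1. \<Prod>a\<in>{1..<b}. (\<xi> a - \<xi> b) ^ (m a + m b))"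
    unfolding prod.distrib[symmetric]
  proof (intro prod.cong refl)
    fix b a
    have "(\<xi> b - \<xi> a) ^ m a = (- 1) ^ m a * (\<xi> a - \<xi> b) ^ m a"
      by (simp flip: power_mult_distrib)
    then show "(\<xi> a - \<xi> b) ^ m b * (\<xi> b - \<xi> a) ^ m a = (- 1) ^ m a * (\<xi> a - \<xi> b) ^ (m a + m b)"
      by (simp add: power_add)
  qed
  finally show ?thesis .
qed

section \<open>The orbit polynomial\<close>

definition orbit_poly :: "nat \<Rightarrow> (nat \<Rightarrow> complex) \<Rightarrow> complex poly" where
  "orbit_poly l x = lin_prod l (a_fun l x)"

lemma x_tilde_0 [simp]: "x_tilde l x 0 = 0" and x_tilde_top [simp]: "x_tilde l x (Suc l) = 0"
  by (auto simp: x_tilde_def)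

lemma a_fun_nonzero [simp]: "a_fun l x j \<noteq> 0"
  by (simp add: a_fun_def)

lemma sum_telescope_1:
  fixes f :: "nat \<Rightarrow> complex"
  shows "(\<Sum>j = 1..n. f (j - 1) - f j) = f 0 - f n"
  by (induction n) auto

lemma prod_a_fun: "(\<Prod>j = 1..l+1. a_fun l x j) = 1"
proof -
  have "(\<Prod>j = 1..l+1. a_fun l x j) = exp (\<Sum>j = 1..l+1. x_tilde l x (j - 1) - x_tilde l x j)"
    by (simp add: a_fun_def exp_sum del: prod.cl_ivl_Suc sum.cl_ivl_Suc)
  also have "(\<Sum>j = 1..l+1. x_tilde l x (j - 1) - x_tilde l x j) = 0"
    by (simp only: sum_telescope_1) simp
  finally show ?thesis by simp
qed

lemma coeff_lin_prod_0: "coeff (lin_prod d \<xi>) 0 = (\<Prod>b = 1..d+1. \<xi> b)"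
  unfolding poly_0_coeff_0[symmetric] by (simp add: lin_prod_def poly_prod del: prod.cl_ivl_Suc)

lemma degree_orbit_poly: "degree (orbit_poly l x) = l + 1"
  by (simp add: orbit_poly_def degree_lin_prod)

lemma coeff_orbit_poly_0: "coeff (orbit_poly l x) 0 = 1"
  by (simp only: orbit_poly_def coeff_lin_prod_0 prod_a_fun)

lemma coeff_orbit_poly_top: "coeff (orbit_poly l x) (l + 1) = 1"
  by (simp add: orbit_poly_def lead_coeff_lin_prod)

text \<open>
  Expansion of the product: \<open>S\<close> is the set of factors from which the variable is taken.
\<close>

lemma coeff_prod_linear:
  fixes a :: "nat \<Rightarrow> complex"
  assumes "finite I"
  shows "coeff (\<Prod>j\<in>I. [:a j, 1:]) i = (\<Sum>S | S \<subseteq> I \<and> card S = i. \<Prod>j\<in>I - S. a j)"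
proof -
  have "(\<Prod>j\<in>I. [:a j, 1:]) = (\<Prod>j\<in>I. monom 1 1 + [:a j:])"
    by (simp add: monom_Suc monom_0)
  also have "\<dots> = (\<Sum>S\<in>Pow I. (\<Prod>j\<in>S. monom 1 1) * (\<Prod>j\<in>I - S. [:a j:]))"
    by (rule prod_add[OF assms])
  also have "\<dots> = (\<Sum>S\<in>Pow I. Polynomial.smult (\<Prod>j\<in>I - S. a j) (monom 1 (card S)))"
  proof (rule sum.cong[OF refl])
    fix S
    have "(\<Prod>j\<in>T. [:a j:]) = [:\<Prod>j\<in>T. a j:]" for T
      by (induction T rule: infinite_finite_induct) auto
    then show "(\<Prod>j\<in>S. monom 1 1) * (\<Prod>j\<in>I - S. [:a j:]) = Polynomial.smult (\<Prod>j\<in>I - S. a j) (monom 1 (card S))"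
      by (simp add: monom_power)
  qed
  also have "coeff \<dots> i = (\<Sum>S\<in>Pow I. if card S = i then \<Prod>j\<in>I - S. a j else 0)"
    by (auto simp: coeff_sum intro!: sum.cong)
  also have "\<dots> = (\<Sum>S\<in>{S \<in> Pow I. card S = i}. \<Prod>j\<in>I - S. a j)"
    using assms by (intro sum.inter_filter[symmetric]) simp
  also have "{S \<in> Pow I. card S = i} = {S. S \<subseteq> I \<and> card S = i}"
    by auto
  finally show ?thesis .
qed

lemma coeff_orbit_poly:
  "coeff (orbit_poly l x) i = (\<Sum>S | S \<subseteq> {1..l+1} \<and> card S = i. \<Prod>j\<in>{1..l+1} - S. a_fun l x j)"
  unfolding orbit_poly_def lin_prod_def by (rule coeff_prod_linear) simp

lemma cartan_part_eq:
  assumes "j \<in> {1..l+1}"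
  shows "cartan_part l x j = x_tilde l x j - x_tilde l x (j - 1)"
proof -
  have "cartan_part l x j = (\<Sum>i = 1..l. (if i = j then x i else 0) - (if i = j - 1 then x i else 0))"
    unfolding cartan_part_def using assms by (intro sum.cong) (auto simp: simple_root_def)
  also have "\<dots> = (if j \<in> {1..l} then x j else 0) - (if j - 1 \<in> {1..l} then x (j - 1) else 0)"
    by (simp add: sum_subtractf)
  also have "\<dots> = x_tilde l x j - x_tilde l x (j - 1)"
    using x_tilde_eq[of j l x] x_tilde_eq[of "j - 1" l x] by (simp add: x_tilde_def)
  finally show ?thesis .
qed

lemma exp_cartan_part:
  assumes "j \<in> {1..l+1}"
  shows "exp (cartan_part l x j) = inverse (a_fun l x j)"
  by (simp add: cartan_part_eq[OF assms] a_fun_def exp_minus[symmetric])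

lemma sum_cartan_part: "(\<Sum>j = 1..l+1. cartan_part l x j) = 0"
proof -
  have "(\<Sum>j = 1..l+1. cartan_part l x j) = (\<Sum>j = 1..l+1. - (x_tilde l x (j - 1) - x_tilde l x j))"
    by (intro sum.cong) (auto simp: cartan_part_eq)
  also have "\<dots> = 0"
    by (simp only: sum_negf sum_telescope_1) simp
  finally show ?thesis .
qed

text \<open>
  The shift of the fundamental weight by a multiple of \<open>(1, \<dots>, 1)\<close> pairs to zero with the Cartan subalgebra, so
  only the coordinates in \<open>w ` {1..i}\<close> count. By \<open>\<Prod>\<^sub>j a\<^sub>j = 1\<close>, the product of the inverse \<open>a\<^sub>j\<close> over this set
  is the product of the \<open>a\<^sub>j\<close> over its complement.
\<close>

lemma exp_weyl_weight:
  assumes w: "w permutes {1..l+1}" and i: "i \<le> l + 1"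
  shows "exp (root_form l (weyl_act w (fund_weight l i)) (cartan_part l x))
    = (\<Prod>j\<in>{1..l+1} - w ` {1..i}. a_fun l x j)"
proof -
  let ?I = "{1..l+1}" and ?\<epsilon> = "cartan_part l x"
  let ?S = "w ` {1..i}"
  have S: "?S \<subseteq> ?I"
  proof
    fix j assume "j \<in> ?S"
    then obtain m where "j = w m" "m \<in> {1..i}" by blast
    then show "j \<in> ?I"
      using i permutes_in_image[OF w, of m] by simp
  qed
  have mem: "inv_into UNIV w j \<le> i \<longleftrightarrow> j \<in> ?S" if "j \<in> ?I" for j
  proof -
    have inI: "inv_into UNIV w j \<in> ?I"
      using permutes_inv[OF w] that by (metis permutes_in_image)
    have "w (inv_into UNIV w j) = j"
      using w by (simp add: permutes_inverses)
    with inI have "inv_into UNIV w j \<le> i \<Longrightarrow> j \<in> ?S"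
      by (metis atLeastAtMost_iff imageI)
    moreover have "j \<in> ?S \<Longrightarrow> inv_into UNIV w j \<le> i"
      using w by (auto simp: permutes_inverses)
    ultimately show ?thesis by blast
  qed
  have "root_form l (weyl_act w (fund_weight l i)) ?\<epsilon>
      = (\<Sum>j\<in>?I. (if j \<in> ?S then ?\<epsilon> j else 0) - of_nat i / of_nat (l + 1) * ?\<epsilon> j)"
    unfolding root_form_def
  proof (rule sum.cong[OF refl])
    fix j assume j: "j \<in> ?I"
    have "inv_into UNIV w j \<in> ?I"
      using permutes_inv[OF w] j by (metis permutes_in_image)
    then show "weyl_act w (fund_weight l i) j * ?\<epsilon> j = (if j \<in> ?S then ?\<epsilon> j else 0) - of_nat i / of_nat (l + 1) * ?\<epsilon> j"
      using mem[OF j] by (simp add: weyl_act_def fund_weight_def algebra_simps)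
  qed
  also have "\<dots> = (\<Sum>j\<in>?I. if j \<in> ?S then ?\<epsilon> j else 0)"
    unfolding sum_subtractf sum_distrib_left[symmetric] sum_cartan_part by simp
  also have "\<dots> = (\<Sum>j\<in>?I \<inter> ?S. ?\<epsilon> j)"
    by (rule sum.inter_restrict[symmetric]) simp
  also have "?I \<inter> ?S = ?S"
    using S by blast
  finally have "root_form l (weyl_act w (fund_weight l i)) ?\<epsilon> = sum ?\<epsilon> ?S" .
  moreover have "sum ?\<epsilon> ?S = - sum ?\<epsilon> (?I - ?S)"
    using sum.subset_diff[OF S, of ?\<epsilon>] sum_cartan_part[of l x] by (simp add: add_eq_0_iff del: sum.cl_ivl_Suc)
  ultimately have "exp (root_form l (weyl_act w (fund_weight l i)) ?\<epsilon>) = inverse (\<Prod>j\<in>?I - ?S. exp (?\<epsilon> j))"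
    by (simp add: exp_minus exp_sum del: sum.cl_ivl_Suc)
  also have "\<dots> = (\<Prod>j\<in>?I - ?S. a_fun l x j)"
    unfolding prod_inversef[symmetric] by (intro prod.cong) (auto simp: exp_cartan_part)
  finally show ?thesis .
qed

text \<open>
  The order of the stabiliser of the \<open>i\<close>-th fundamental weight, that is \<open>i! (l + 1 - i)!\<close>.
\<close>

definition orbit_mult :: "nat \<Rightarrow> nat \<Rightarrow> nat" where
  "orbit_mult l i = card {w. w permutes {1..l+1} \<and> w ` {1..i} = {1..i}}"

lemma orbit_mult_pos: "orbit_mult l i > 0"
proof -
  have "finite {w. w permutes {1..l+1} \<and> w ` {1..i} = {1..i}}"
    using finite_permutations[of "{1..l+1}"] by (rule rev_finite_subset) auto
  moreover have "id \<in> {w. w permutes {1..l+1} \<and> w ` {1..i} = {1..i}}"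
    by (auto simp: permutes_id)
  ultimately show ?thesis
    unfolding orbit_mult_def by (metis card_gt_0_iff empty_iff)
qed

lemma ex_permutation_image:
  assumes "finite I" "A \<subseteq> I" "S \<subseteq> I" "card A = card S"
  shows "\<exists>\<sigma>. \<sigma> permutes I \<and> \<sigma> ` A = S"
proof -
  have fin: "finite A" "finite S" using assms finite_subset by auto
  obtain f where f: "bij_betw f A S"
    using finite_same_card_bij[OF fin assms(4)] by blast
  have "card (I - A) = card (I - S)"
    using assms fin by (simp add: card_Diff_subset)
  then obtain g where g: "bij_betw g (I - A) (I - S)"
    using finite_same_card_bij[of "I - A" "I - S"] assms(1) by blast
  define \<sigma> where "\<sigma> j = (if j \<in> A then f j else if j \<in> I then g j else j)" for j
  have 1: "bij_betw \<sigma> A S"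
    using f by (rule bij_betw_cong[THEN iffD1, rotated]) (simp add: \<sigma>_def)
  have 2: "bij_betw \<sigma> (I - A) (I - S)"
    using g by (rule bij_betw_cong[THEN iffD1, rotated]) (simp add: \<sigma>_def)
  have "bij_betw \<sigma> (A \<union> (I - A)) (S \<union> (I - S))"
    using 1 2 by (rule bij_betw_combine) blast
  moreover have "A \<union> (I - A) = I" "S \<union> (I - S) = I"
    using assms by auto
  ultimately have "\<sigma> permutes I"
    by (intro bij_imp_permutes) (auto simp: \<sigma>_def assms(2)[THEN subsetD])
  with 1 show ?thesis
    by (auto simp: bij_betw_def)
qed

lemma card_permutations_image:
  assumes "S \<subseteq> {1..l+1}" "card S = i" "i \<le> l + 1"
  shows "card {w. w permutes {1..l+1} \<and> w ` {1..i} = S} = orbit_mult l i"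
proof -
  let ?I = "{1..l+1}"
  obtain \<sigma> where \<sigma>: "\<sigma> permutes ?I" "\<sigma> ` {1..i} = S"
    using ex_permutation_image[of ?I "{1..i}" S] assms by auto
  let ?\<tau> = "inv_into UNIV \<sigma>"
  have \<tau>: "?\<tau> permutes ?I" "\<And>x. \<sigma> (?\<tau> x) = x" "\<And>x. ?\<tau> (\<sigma> x) = x"
    using \<sigma>(1) by (auto simp: permutes_inverses permutes_inv)
  have "bij_betw (\<lambda>w. \<sigma> \<circ> w) {w. w permutes ?I \<and> w ` {1..i} = {1..i}} {w. w permutes ?I \<and> w ` {1..i} = S}"
  proof (rule bij_betw_byWitness[where f' = "\<lambda>w. ?\<tau> \<circ> w"])
    show "(\<lambda>w. \<sigma> \<circ> w) ` {w. w permutes ?I \<and> w ` {1..i} = {1..i}} \<subseteq> {w. w permutes ?I \<and> w ` {1..i} = S}"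
    proof safe
      fix w assume w: "w permutes ?I" "w ` {1..i} = {1..i}"
      show "\<sigma> \<circ> w permutes ?I" using w(1) \<sigma>(1) by (rule permutes_compose)
      have "(\<sigma> \<circ> w) ` {1..i} = S"
        unfolding image_comp[symmetric] w(2) \<sigma>(2) ..
      then show "\<And>j. j \<in> {1..i} \<Longrightarrow> (\<sigma> \<circ> w) j \<in> S" "\<And>j. j \<in> S \<Longrightarrow> j \<in> (\<sigma> \<circ> w) ` {1..i}"
        by blast+
    qed
    show "(\<lambda>w. ?\<tau> \<circ> w) ` {w. w permutes ?I \<and> w ` {1..i} = S} \<subseteq> {w. w permutes ?I \<and> w ` {1..i} = {1..i}}"
    proof safe
      fix w assume w: "w permutes ?I" "S = w ` {1..i}"
      show "?\<tau> \<circ> w permutes ?I" using w(1) \<tau>(1) by (rule permutes_compose)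
      have "(?\<tau> \<circ> w) ` {1..i} = ?\<tau> ` \<sigma> ` {1..i}"
        unfolding \<sigma>(2) w(2) by (simp add: image_comp)
      also have "\<dots> = {1..i}" by (simp add: image_comp comp_def \<tau>(3))
      finally have "(?\<tau> \<circ> w) ` {1..i} = {1..i}" .
      then show "\<And>j. j \<in> {1..i} \<Longrightarrow> (?\<tau> \<circ> w) j \<in> {1..i}" "\<And>j. j \<in> {1..i} \<Longrightarrow> j \<in> (?\<tau> \<circ> w) ` {1..i}"
        by blast+
    qed
  qed (auto simp: \<tau> fun_eq_iff)
  then show ?thesis
    unfolding orbit_mult_def by (simp add: bij_betw_same_card)
qed

text \<open>
  The summand for \<open>w\<close> depends on \<open>w ` {1..i}\<close> only, and each subset of size \<open>i\<close> arises equally often.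
\<close>

lemma Y_fun_eq:
  assumes "i \<in> {1..l}"
  shows "Y_fun l i x = of_nat (orbit_mult l i) * coeff (orbit_poly l x) i"
proof -
  let ?I = "{1..l+1}" and ?h = "\<lambda>S. \<Prod>j\<in>{1..l+1} - S. a_fun l x j"
  let ?T = "{S. S \<subseteq> ?I \<and> card S = i}"
  have il: "i \<le> l + 1" using assms by simp
  have fin: "finite {w. w permutes ?I}" by (rule finite_permutations) simp
  have "Y_fun l i x = (\<Sum>w | w permutes ?I. ?h (w ` {1..i}))"
    unfolding Y_fun_def weyl_group_def using exp_weyl_weight[OF _ il] by (intro sum.cong) auto
  also have "\<dots> = (\<Sum>S\<in>?T. \<Sum>w\<in>{w \<in> {w. w permutes ?I}. w ` {1..i} = S}. ?h (w ` {1..i}))"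
  proof (rule sum.group[symmetric, OF fin])
    show "finite ?T" by (rule finite_subset[of _ "Pow ?I"]) auto
    show "(\<lambda>w. w ` {1..i}) ` {w. w permutes ?I} \<subseteq> ?T"
    proof safe
      fix w j assume w: "w permutes ?I" "j \<in> {1..i}"
      then have "j \<in> ?I" using il by simp
      then show "w j \<in> ?I" using w(1) by (metis permutes_in_image)
    next
      fix w assume "w permutes ?I"
      then show "card (w ` {1..i}) = i"
        by (subst card_image) (auto intro: inj_on_subset[OF permutes_inj])
    qed
  qed
  also have "\<dots> = (\<Sum>S\<in>?T. of_nat (orbit_mult l i) * ?h S)"
  proof (rule sum.cong[OF refl])
    fix S assume S: "S \<in> ?T"
    have "(\<Sum>w\<in>{w \<in> {w. w permutes ?I}. w ` {1..i} = S}. ?h (w ` {1..i}))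
        = (\<Sum>w\<in>{w. w permutes ?I \<and> w ` {1..i} = S}. ?h S)"
      by (intro sum.cong) auto
    also have "\<dots> = of_nat (orbit_mult l i) * ?h S"
      using card_permutations_image[of S l i] S il by simp
    finally show "(\<Sum>w\<in>{w \<in> {w. w permutes ?I}. w ` {1..i} = S}. ?h (w ` {1..i}))
        = of_nat (orbit_mult l i) * ?h S" .
  qed
  finally show ?thesis
    unfolding coeff_orbit_poly sum_distrib_left .
qed

text \<open>
  The derivative of \<open>E\<close> along the logarithm of \<open>1/a\<^sub>p\<close> is \<open>x\<close> times the \<open>p\<close>-th cofactor, up to a
  multiple of \<open>E\<close> that does not depend on \<open>p\<close>. So this is the Euclidean pairing of the gradients of two coefficients of
  \<open>E\<close>, before the projection to the Cartan subalgebra.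
\<close>

definition cofactor_gram :: "nat \<Rightarrow> (nat \<Rightarrow> complex) \<Rightarrow> nat \<Rightarrow> nat \<Rightarrow> complex" where
  "cofactor_gram d a i j =
     (\<Sum>p = 1..d+1. coeff (pCons 0 (lin_cofactor d a p)) i * coeff (pCons 0 (lin_cofactor d a p)) j)"

lemma pderiv_lin_prod: "pderiv (lin_prod d a) = (\<Sum>p = 1..d+1. lin_cofactor d a p)"
  unfolding lin_prod_def lin_cofactor_def
  by (simp add: pderiv_prod pderiv_pCons del: sum.cl_ivl_Suc prod.cl_ivl_Suc)

lemma sum_coeff_cofactor:
  "(\<Sum>p = 1..d+1. coeff (pCons 0 (lin_cofactor d a p)) i) = of_nat i * coeff (lin_prod d a) i"
proof (cases i)
  case (Suc j)
  have "(\<Sum>p = 1..d+1. coeff (lin_cofactor d a p) j) = coeff (pderiv (lin_prod d a)) j"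
    unfolding pderiv_lin_prod coeff_sum ..
  then show ?thesis
    using Suc by (simp add: coeff_pderiv del: sum.cl_ivl_Suc)
qed simp

lemma coeff_cofactor_step:
  assumes "p \<in> {1..d+1}"
  shows "coeff (pCons 0 (lin_cofactor d a p)) i
    = coeff (lin_prod d a) i - a p * coeff (pCons 0 (lin_cofactor d a p)) (Suc i)"
  unfolding lin_prod_eq_cofactor[OF assms] by simp

lemma cofactor_gram_step:
  fixes d :: nat and a :: "nat \<Rightarrow> complex"
  defines "e \<equiv> coeff (lin_prod d a)"
  shows "cofactor_gram d a (Suc i) j = cofactor_gram d a i (Suc j)
      + of_nat (Suc i) * e (Suc i) * e j - of_nat (Suc j) * e i * e (Suc j)"
proof -
  let ?c = "\<lambda>p. coeff (pCons 0 (lin_cofactor d a p))"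
  have "cofactor_gram d a (Suc i) j - cofactor_gram d a i (Suc j)
      = (\<Sum>p = 1..d+1. ?c p (Suc i) * ?c p j - ?c p i * ?c p (Suc j))"
    by (simp only: cofactor_gram_def sum_subtractf)
  also have "\<dots> = (\<Sum>p = 1..d+1. e j * ?c p (Suc i) - e i * ?c p (Suc j))"
  proof (rule sum.cong[OF refl])
    fix p assume p: "p \<in> {1..d+1}"
    show "?c p (Suc i) * ?c p j - ?c p i * ?c p (Suc j) = e j * ?c p (Suc i) - e i * ?c p (Suc j)"
      unfolding coeff_cofactor_step[OF p, of a i] coeff_cofactor_step[OF p, of a j] e_def
      by (simp add: algebra_simps del: coeff_pCons_Suc)
  qed
  also have "\<dots> = e j * (of_nat (Suc i) * e (Suc i)) - e i * (of_nat (Suc j) * e (Suc j))"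
    unfolding sum_subtractf sum_distrib_left[symmetric] sum_coeff_cofactor e_def ..
  finally show ?thesis
    by (simp add: algebra_simps)
qed

text \<open>
  Quadratic expression of the pairing in the coefficients. It follows by iterating \<open>cofactor_gram_step\<close>, which in terms
  of generating functions is \<open>(v - u) \<Sum>\<^sub>p C\<^sub>p(u) C\<^sub>p(v) = E'(u) E(v) - E(u) E'(v)\<close>
  for the cofactors \<open>C\<^sub>p\<close>.
\<close>

lemma cofactor_gram_eq:
  fixes d :: nat and a :: "nat \<Rightarrow> complex"
  defines "e \<equiv> coeff (lin_prod d a)"
  shows "cofactor_gram d a i j = of_nat i * e i * e j
     - (\<Sum>r = 1..i. (of_nat j - of_nat i + 2 * of_nat r) * e (i - r) * e (j + r))"
proof (induction i arbitrary: j)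
  case 0
  show ?case by (simp add: cofactor_gram_def)
next
  case (Suc i)
  define t where "t = (\<Sum>r = 1..i. (of_nat (Suc j) - of_nat i + 2 * of_nat r) * e (i - r) * e (Suc j + r))"
  have "(\<Sum>r = 1..Suc i. (of_nat j - of_nat (Suc i) + 2 * of_nat r) * e (Suc i - r) * e (j + r))
      = (\<Sum>r = 0..i. (of_nat j - of_nat (Suc i) + 2 * of_nat (Suc r)) * e (Suc i - Suc r) * e (j + Suc r))"
    unfolding One_nat_def by (subst sum.shift_bounds_cl_Suc_ivl) (rule refl)
  also have "\<dots> = (of_nat j - of_nat i + 1) * e i * e (Suc j)
     + t"
    unfolding t_def by (subst sum.atLeast_Suc_atMost) (auto intro!: sum.cong simp: algebra_simps)
  finally have sum: "(\<Sum>r = 1..Suc i. (of_nat j - of_nat (Suc i) + 2 * of_nat r) * e (Suc i - r) * e (j + r))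
      = (of_nat j - of_nat i + 1) * e i * e (Suc j) + t" .
  show ?case
    unfolding sum cofactor_gram_step[of d a i j] Suc.IH[of "Suc j"] t_def[symmetric] e_def[symmetric]
    by (simp add: algebra_simps)
qed

section \<open>The map to the orbit space\<close>

lemma coeff_prod_linear_deriv:
  fixes a :: "complex \<Rightarrow> nat \<Rightarrow> complex"
  assumes "finite S" "\<And>j. j \<in> S \<Longrightarrow> ((\<lambda>t. a t j) has_field_derivative a' j) (at t0)"
  shows "((\<lambda>t. coeff (\<Prod>j\<in>S. [:a t j, 1:]) i) has_field_derivative
    (\<Sum>j\<in>S. a' j * coeff (\<Prod>c\<in>S - {j}. [:a t0 c, 1:]) i)) (at t0)"
  using assms
proof (induction S arbitrary: i rule: finite_induct)
  case empty
  show ?case by simp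
next
  case (insert s S)
  let ?P = "\<lambda>t. \<Prod>j\<in>S. [:a t j, 1:]"
  let ?D = "\<lambda>i. \<Sum>j\<in>S. a' j * coeff (\<Prod>c\<in>S - {j}. [:a t0 c, 1:]) i"
  have IH: "((\<lambda>t. coeff (?P t) i) has_field_derivative ?D i) (at t0)" for i
    by (rule insert.IH) (rule insert.prems, simp)
  have shift: "((\<lambda>t. coeff (pCons 0 (?P t)) i) has_field_derivative
      (\<Sum>j\<in>S. a' j * coeff (pCons 0 (\<Prod>c\<in>S - {j}. [:a t0 c, 1:])) i)) (at t0)"
    by (cases i) (use IH in auto)
  have "((\<lambda>t. a t s * coeff (?P t) i + coeff (pCons 0 (?P t)) i) has_field_derivative
      (a' s * coeff (?P t0) i + ?D i * a t0 s
        + (\<Sum>j\<in>S. a' j * coeff (pCons 0 (\<Prod>c\<in>S - {j}. [:a t0 c, 1:])) i))) (at t0)"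
    using insert.prems by (intro DERIV_add DERIV_mult IH shift) auto
  moreover have "?D i * a t0 s + (\<Sum>j\<in>S. a' j * coeff (pCons 0 (\<Prod>c\<in>S - {j}. [:a t0 c, 1:])) i)
      = (\<Sum>j\<in>S. a' j * coeff (\<Prod>c\<in>insert s S - {j}. [:a t0 c, 1:]) i)"
    unfolding sum_distrib_right sum.distrib[symmetric]
  proof (rule sum.cong[OF refl])
    fix j assume "j \<in> S"
    then have "insert s S - {j} = insert s (S - {j})" using insert.hyps by auto
    then have "(\<Prod>c\<in>insert s S - {j}. [:a t0 c, 1:]) = [:a t0 s, 1:] * (\<Prod>c\<in>S - {j}. [:a t0 c, 1:])"
      using insert.hyps by simp
    then show "a' j * coeff (\<Prod>c\<in>S - {j}. [:a t0 c, 1:]) i * a t0 s + a' j * coeff (pCons 0 (\<Prod>c\<in>S - {j}. [:a t0 c, 1:])) i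
        = a' j * coeff (\<Prod>c\<in>insert s S - {j}. [:a t0 c, 1:]) i"
      by (simp add: algebra_simps)
  qed
  moreover have "insert s S - {s} = S" using insert.hyps by auto
  moreover have "(\<Prod>j\<in>insert s S. [:a t j, 1:]) = [:a t s, 1:] * ?P t" for t
    using insert.hyps by simp
  ultimately show ?case
    using insert.hyps by (simp add: add.assoc)
qed

lemma x_tilde_upd:
  assumes "m \<in> {1..l}"
  shows "x_tilde l (x(m := t)) j = (if j = m then t else x_tilde l x j)"
  using x_tilde_eq[of j l x] x_tilde_eq[of j l "x(m := t)"] assms
  by (auto simp: x_tilde_def)

lemma x_tilde_upd_top: "x_tilde l (x(Suc l := t)) j = x_tilde l x j"
  using x_tilde_eq[of j l x] x_tilde_eq[of j l "x(Suc l := t)"]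
  by (auto simp: x_tilde_def)

lemma a_fun_deriv:
  assumes m: "m \<in> {1..l}" and j: "j \<ge> 1"
  shows "((\<lambda>t. a_fun l (x(m := t)) j) has_field_derivative
     ((if j = m + 1 then a_fun l x j else 0) - (if j = m then a_fun l x j else 0))) (at (x m))"
proof -
  have "a_fun l (x(m := t)) j = exp ((if j = m + 1 then t else x_tilde l x (j - 1)) - (if j = m then t else x_tilde l x j))" for t
    using m j by (auto simp: a_fun_def x_tilde_upd)
  moreover have "a_fun l x j = exp ((if j = m + 1 then x m else x_tilde l x (j - 1)) - (if j = m then x m else x_tilde l x j))"
    using m by (auto simp: a_fun_def x_tilde_eq)
  ultimately show ?thesis
    by (auto intro!: derivative_eq_intros)
qed

definition cofactor_coeff :: "nat \<Rightarrow> (nat \<Rightarrow> complex) \<Rightarrow> nat \<Rightarrow> nat \<Rightarrow> complex" where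
  "cofactor_coeff l x p i = coeff (pCons 0 (lin_cofactor l (a_fun l x) p)) i"

lemma coeff_orbit_poly_deriv:
  assumes m: "m \<in> {1..l}"
  shows "((\<lambda>t. coeff (orbit_poly l (x(m := t))) i) has_field_derivative
     (cofactor_coeff l x m i - cofactor_coeff l x (m + 1) i)) (at (x m))"
proof -
  let ?a = "a_fun l x"
  let ?C = "\<lambda>j. coeff (lin_cofactor l ?a j) i"
  have "((\<lambda>t. coeff (\<Prod>j\<in>{1..l+1}. [:a_fun l (x(m := t)) j, 1:]) i) has_field_derivative
    (\<Sum>j\<in>{1..l+1}. ((if j = m + 1 then ?a j else 0) - (if j = m then ?a j else 0))
       * coeff (\<Prod>c\<in>{1..l+1} - {j}. [:a_fun l (x(m := x m)) c, 1:]) i)) (at (x m))"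
    by (rule coeff_prod_linear_deriv) (use a_fun_deriv[OF m] in auto)
  moreover have "(\<Sum>j\<in>{1..l+1}. ((if j = m + 1 then ?a j else 0) - (if j = m then ?a j else 0))
       * coeff (\<Prod>c\<in>{1..l+1} - {j}. [:a_fun l (x(m := x m)) c, 1:]) i)
     = (\<Sum>j\<in>{1..l+1}. (if j = m + 1 then ?a j * ?C j else 0) - (if j = m then ?a j * ?C j else 0))"
    by (intro sum.cong) (auto simp: lin_cofactor_def)
  moreover have "\<dots> = ?a (m + 1) * ?C (m + 1) - ?a m * ?C m"
    using m by (simp add: sum_subtractf del: sum.cl_ivl_Suc)
  moreover have "\<dots> = cofactor_coeff l x m i - cofactor_coeff l x (m + 1) i"
    using coeff_cofactor_step[of m l ?a i] coeff_cofactor_step[of "m + 1" l ?a i] m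
    by (simp add: cofactor_coeff_def)
  ultimately show ?thesis
    by (simp add: orbit_poly_def lin_prod_def del: prod.cl_ivl_Suc sum.cl_ivl_Suc)
qed

definition y_scale :: "nat \<Rightarrow> nat \<Rightarrow> nat \<Rightarrow> (nat \<Rightarrow> complex) \<Rightarrow> complex" where
  "y_scale l k i x = of_nat (orbit_mult l i) * exp (d_coeff l k i * x (l + 1))"

lemma y_scale_nonzero [simp]: "y_scale l k i x \<noteq> 0"
  using orbit_mult_pos[of l i] by (simp add: y_scale_def)

lemma y_map_eq:
  assumes "i \<in> {1..l}"
  shows "y_map l k x i = y_scale l k i x * coeff (orbit_poly l x) i"
  using assms by (simp add: y_map_def y_scale_def Y_fun_eq)

lemma y_map_top: "y_map l k x (l + 1) = x (l + 1)"
  by (simp add: y_map_def)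

lemma partial_deriv_y_map:
  assumes "i \<in> {1..l}" "m \<in> {1..l}"
  shows "partial_deriv m (\<lambda>z. y_map l k z i) x
     = y_scale l k i x * (cofactor_coeff l x m i - cofactor_coeff l x (m + 1) i)"
proof -
  have "y_map l k (x(m := t)) i = y_scale l k i x * coeff (orbit_poly l (x(m := t))) i" for t
    using assms by (simp add: y_map_eq y_scale_def)
  then show ?thesis
    unfolding partial_deriv_def
    using DERIV_cmult[OF coeff_orbit_poly_deriv[OF assms(2), of x i], of "y_scale l k i x"]
    by (intro DERIV_imp_deriv) simp
qed

lemma partial_deriv_y_map_top:
  assumes "i \<in> {1..l}"
  shows "partial_deriv (l + 1) (\<lambda>z. y_map l k z i) x = d_coeff l k i * y_map l k x i"
proof -
  have "orbit_poly l (x(l + 1 := t)) = orbit_poly l x" for t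
    by (simp add: orbit_poly_def a_fun_def[abs_def] x_tilde_upd_top lin_prod_def del: prod.cl_ivl_Suc)
  then have "y_map l k (x(l + 1 := t)) i = of_nat (orbit_mult l i) * exp (d_coeff l k i * t) * coeff (orbit_poly l x) i" for t
    using assms by (simp add: y_map_eq y_scale_def)
  moreover have "((\<lambda>t. of_nat (orbit_mult l i) * exp (d_coeff l k i * t) * coeff (orbit_poly l x) i)
     has_field_derivative d_coeff l k i * y_map l k x i) (at (x (l + 1)))"
    using assms by (auto intro!: derivative_eq_intros simp: y_map_eq y_scale_def)
  ultimately show ?thesis
    unfolding partial_deriv_def by (intro DERIV_imp_deriv) simp
qed

lemma partial_deriv_y_map_coord:
  "partial_deriv m (\<lambda>z. y_map l k z (l + 1)) x = (if m = l + 1 then 1 else 0)"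
  unfolding partial_deriv_def y_map_top by (auto intro!: DERIV_imp_deriv derivative_eq_intros)

text \<open>
  Logarithms are chosen for the first \<open>l\<close> of the numbers; the last one is then determined by the product.
\<close>

lemma ex_a_fun:
  assumes a: "(\<Prod>j = 1..l+1. a j) = 1"
  shows "\<exists>x \<in> coord_space (l + 1). x (l + 1) = t \<and> (\<forall>j \<in> {1..l+1}. a_fun l x j = a j)"
proof -
  have a0: "a j \<noteq> 0" if "j \<in> {1..l+1}" for j
    using a that by (metis finite_atLeastAtMost prod_zero_iff zero_neq_one)
  define x where "x i = (if i \<in> {1..l} then - (\<Sum>j = 1..i. Ln (a j)) else if i = l + 1 then t else 0)" for i
  have xt: "x_tilde l x i = - (\<Sum>j = 1..i. Ln (a j))" if "i \<le> l" for i
    using that x_tilde_eq[of i l x] by (cases "i = 0") (auto simp: x_def)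
  have low: "a_fun l x j = a j" if j: "j \<in> {1..l}" for j
  proof -
    obtain i where "j = Suc i" using j by (cases j) auto
    then show ?thesis
      using j a0[of j] by (simp add: a_fun_def xt exp_Ln)
  qed
  have "(\<Prod>j = 1..l. a_fun l x j) * a_fun l x (l + 1) = (\<Prod>j = 1..l. a j) * a (l + 1)"
    using prod_a_fun[of l x] a by simp
  moreover have "(\<Prod>j = 1..l. a_fun l x j) = (\<Prod>j = 1..l. a j)"
    by (intro prod.cong) (auto simp: low)
  moreover have "(\<Prod>j = 1..l. a j) \<noteq> 0"
    using a0 by auto
  ultimately have "a_fun l x (l + 1) = a (l + 1)"
    by simp
  then have "\<forall>j \<in> {1..l+1}. a_fun l x j = a j"
    using low by (auto simp: le_Suc_eq)
  moreover have "x \<in> coord_space (l + 1)" "x (l + 1) = t"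
    by (auto simp: coord_space_def x_def)
  ultimately show ?thesis by blast
qed

lemma ex_lin_prod:
  fixes p :: "complex poly"
  assumes "degree p = d + 1" "lead_coeff p = 1"
  shows "\<exists>a. p = lin_prod d a"
proof -
  have "p \<noteq> 0" using assms by auto
  then obtain A where A: "size A = degree p" "p = Polynomial.smult (lead_coeff p) (\<Prod>x\<in>#A. [:- x, 1:])"
    using alg_closed_imp_factorization by blast
  obtain xs where xs: "A = mset xs" by (metis ex_mset)
  then have len: "length xs = d + 1" using A assms by simp
  define a where "a j = - (xs ! (j - 1))" for j
  have "p = (\<Prod>x\<leftarrow>xs. [:- x, 1:])"
    using A(2) assms by (simp add: xs flip: prod_mset_prod_list)
  also have "\<dots> = (\<Prod>i<d+1. [:- (xs ! i), 1:])"
    using len by (simp add: prod.list_conv_set_nth lessThan_atLeast0 del: prod.op_ivl_Suc)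
  also have "\<dots> = lin_prod d a"
    unfolding lin_prod_def a_def
    using prod.atLeast1_atMost_eq[of "\<lambda>j. [:- (xs ! (j - 1)), 1:]" "d + 1"] by (simp del: prod.cl_ivl_Suc prod.lessThan_Suc)
  finally show ?thesis by blast
qed

lemma lin_prod_cong: "(\<And>j. j \<in> {1..d+1} \<Longrightarrow> a j = b j) \<Longrightarrow> lin_prod d a = lin_prod d b"
  unfolding lin_prod_def by (rule prod.cong) auto

lemma y_map_in_coord_space: "y_map l k x \<in> coord_space (l + 1)"
  by (auto simp: coord_space_def y_map_def)

text \<open>
  A point of the target prescribes the coefficients of a monic polynomial with constant term \<open>1\<close>, and this
  polynomial splits by the fundamental theorem of algebra.
\<close>

lemma y_map_surj:
  assumes p: "p \<in> coord_space (l + 1)"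
  shows "\<exists>x \<in> coord_space (l + 1). y_map l k x = p"
proof -
  define e where "e i = (if i = 0 \<or> i = l + 1 then 1
      else p i / (of_nat (orbit_mult l i) * exp (d_coeff l k i * p (l + 1))))" for i
  define q where "q = (\<Sum>i = 0..l+1. monom (e i) i)"
  have q: "coeff q i = (if i \<le> l + 1 then e i else 0)" for i
    by (simp add: q_def coeff_sum del: sum.cl_ivl_Suc)
  have deg: "degree q = l + 1"
    by (intro antisym degree_le le_degree) (auto simp: q e_def)
  then have "lead_coeff q = 1"
    by (simp add: q e_def)
  then obtain a where a: "q = lin_prod l a"
    using ex_lin_prod deg by blast
  have "(\<Prod>j = 1..l+1. a j) = 1"
    unfolding coeff_lin_prod_0[symmetric] a[symmetric] by (simp add: q e_def)
  then obtain x where x: "x \<in> coord_space (l + 1)" "x (l + 1) = p (l + 1)" "\<forall>j \<in> {1..l+1}. a_fun l x j = a j"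
    using ex_a_fun by blast
  have E: "orbit_poly l x = q"
    unfolding orbit_poly_def a by (rule lin_prod_cong) (use x(3) in blast)
  have "y_map l k x i = p i" for i
  proof -
    consider "i \<in> {1..l}" | "i = l + 1" | "i \<notin> {1..l+1}" by fastforce
    then show ?thesis
    proof cases
      case 1
      then show ?thesis
        using orbit_mult_pos[of l i] by (simp add: y_map_eq E q e_def y_scale_def x(2)[simplified])
    next
      case 2
      then show ?thesis using x(2) by (simp add: y_map_def)
    next
      case 3
      then show ?thesis using p by (auto simp: y_map_def coord_space_def)
    qed
  qed
  with x(1) show ?thesis by blast
qed

lemma y_map_inv:
  assumes "p \<in> coord_space (l + 1)"
  shows "y_map l k (inv_into (coord_space (l + 1)) (y_map l k) p) = p"
  using y_map_surj[OF assms, of k] by (intro f_inv_into_f[where f = "y_map l k"]) blast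

section \<open>The contravariant metrics in invariant coordinates\<close>

lemma inverse_matrix_eq:
  assumes A: "A \<in> carrier_mat n n" and B: "B \<in> carrier_mat n n" and AB: "A * B = 1\<^sub>m n"
  shows "inverse_matrix A = B"
proof (cases "mat_inverse A")
  case None
  have "Determinant.det A * Determinant.det B = 1"
    using det_mult[OF A B] AB by simp
  then have "Determinant.det A \<noteq> 0" by auto
  then show ?thesis
    using mat_inverse(1)[OF A None, where b = "()"] det_non_zero_imp_unit[OF A, where b = "()"] by simp
next
  case (Some C)
  then have C: "C * A = 1\<^sub>m n" "C \<in> carrier_mat n n"
    using mat_inverse(2)[OF A] by auto
  have "C = C * (A * B)"
    using C AB by simp
  also have "\<dots> = (C * A) * B"
    by (rule assoc_mult_mat[symmetric]) (use A B C in auto)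
  also have "\<dots> = B"
    using C B by simp
  finally show ?thesis
    by (simp add: inverse_matrix_def Some)
qed

lemma fund_weight_eq:
  "p \<in> {1..l+1} \<Longrightarrow> fund_weight l i p = (if p \<le> i then 1 else 0) - of_nat i / of_nat (l + 1)"
  by (simp add: fund_weight_def)

text \<open>
  Summation by parts, using that \<open>\<omega>\<^sub>j - \<omega>\<^sub>j\<^sub>-\<^sub>1\<close> is a unit vector minus the mean. In other words, the
  projection of a vector \<open>g\<close> to the sum-zero hyperplane is \<open>\<Sum>\<^sub>j (g, \<alpha>\<^sub>j) \<omega>\<^sub>j\<close>.
\<close>

lemma sum_differences_fund_weight:
  fixes g :: "nat \<Rightarrow> complex"
  assumes p: "p \<in> {1..l+1}"
  shows "(\<Sum>j = 1..l. (g j - g (j + 1)) * fund_weight l j p)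
    = g p - (\<Sum>j = 1..l+1. g j) / of_nat (l + 1)"
proof -
  have 1: "(\<Sum>j = 1..m. if p \<le> j then g j - g (j + 1) else 0) = g p - g (m + 1)"
    if "1 \<le> p" "p \<le> m + 1" for m
    using that
  proof (induction m)
    case (Suc m)
    show ?case
    proof (cases "p \<le> m + 1")
      case False
      then have "p = m + 2" using Suc.prems by simp
      moreover have "(\<Sum>j = 1..Suc m. if p \<le> j then g j - g (j + 1) else 0) = 0"
        using False by (intro sum.neutral) auto
      ultimately show ?thesis by simp
    qed (use Suc in auto)
  qed auto
  have 2: "(\<Sum>j = 1..m. of_nat j * (g j - g (j + 1))) = (\<Sum>j = 1..m+1. g j) - of_nat (m + 1) * g (m + 1)" for m
    by (induction m) (auto simp: algebra_simps)
  have "(\<Sum>j = 1..l. (g j - g (j + 1)) * fund_weight l j p)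
     = (\<Sum>j = 1..l. (if p \<le> j then g j - g (j + 1) else 0) - of_nat j * (g j - g (j + 1)) / of_nat (l + 1))"
    by (intro sum.cong) (auto simp: fund_weight_eq[OF p] algebra_simps)
  also have "\<dots> = g p - g (l + 1) - ((\<Sum>j = 1..l+1. g j) - of_nat (l + 1) * g (l + 1)) / of_nat (l + 1)"
    unfolding sum_subtractf sum_divide_distrib[symmetric] 2 using 1[of l] p by simp
  also have "\<dots> = g p - (\<Sum>j = 1..l+1. g j) / of_nat (l + 1)"
    by (simp add: diff_divide_distrib del: of_nat_Suc of_nat_add sum.cl_ivl_Suc)
  finally show ?thesis .
qed

lemma d_coeff_eq:
  assumes "i \<in> {1..l}" "j \<in> {1..l}"
  shows "d_coeff l i j = of_nat (min i j) - of_nat i * of_nat j / of_nat (l + 1)"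
proof -
  have "d_coeff l i j = (\<Sum>p = 1..l+1. (if p \<le> i then fund_weight l j p else 0)
      - of_nat i / of_nat (l + 1) * fund_weight l j p)"
    unfolding d_coeff_def root_form_def
    by (intro sum.cong) (auto simp: fund_weight_eq[of _ l i] algebra_simps)
  also have "\<dots> = (\<Sum>p = 1..l+1. if p \<le> i then fund_weight l j p else 0)"
    unfolding sum_subtractf sum_distrib_left[symmetric] sum_fund_weight[OF assms(2)] by simp
  also have "\<dots> = (\<Sum>p = 1..i. (if p \<le> j then 1 else 0) - of_nat j / of_nat (l + 1))"
    using assms by (intro sum.mono_neutral_cong_right) (auto simp: fund_weight_eq)
  also have "\<dots> = (\<Sum>p = 1..i. if p \<le> j then 1 else 0) - of_nat i * (of_nat j / of_nat (l + 1))"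
    by (simp add: sum_subtractf)
  also have "(\<Sum>p = 1..i. if p \<le> j then 1 else 0 :: complex) = (\<Sum>p = 1..min i j. 1)"
    by (intro sum.mono_neutral_cong_right) auto
  finally show ?thesis by simp
qed

lemma d_coeff_commute: "d_coeff l i j = d_coeff l j i"
  by (simp add: d_coeff_def root_form_def mult.commute)

lemma d_coeff_self_nonzero:
  assumes "k \<in> {1..l}"
  shows "d_coeff l k k \<noteq> 0"
proof -
  have "d_coeff l k k = of_nat k * of_nat (l + 1 - k) / of_nat (l + 1)"
    using assms unfolding d_coeff_eq[OF assms assms] of_nat_diff[OF le_trans[OF _ le_add1], of k l 1]
    by (simp add: of_nat_diff field_simps del: of_nat_Suc of_nat_add)
  then show ?thesis
    using assms by (simp del: of_nat_Suc of_nat_add)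
qed

lemma d_coeff_altdef: "d_coeff l i j = (\<Sum>p = 1..l+1. fund_weight l i p * fund_weight l j p)"
  by (simp add: d_coeff_def root_form_def mult.commute)

lemma sum_d_coeff_differences:
  fixes F G :: "nat \<Rightarrow> complex"
  shows "(\<Sum>i = 1..l. \<Sum>j = 1..l. d_coeff l i j * (F i - F (i + 1)) * (G j - G (j + 1)))
    = (\<Sum>p = 1..l+1. F p * G p) - (\<Sum>p = 1..l+1. F p) * (\<Sum>p = 1..l+1. G p) / of_nat (l + 1)"
proof -
  let ?n = "of_nat (l + 1) :: complex"
  let ?f = "\<Sum>p = 1..l+1. F p" and ?g = "\<Sum>p = 1..l+1. G p"
  have "(\<Sum>i = 1..l. \<Sum>j = 1..l. d_coeff l i j * (F i - F (i + 1)) * (G j - G (j + 1)))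
     = (\<Sum>i = 1..l. \<Sum>j = 1..l. \<Sum>p = 1..l+1. ((F i - F (i + 1)) * fund_weight l i p) * ((G j - G (j + 1)) * fund_weight l j p))"
    unfolding d_coeff_altdef sum_distrib_right by (intro sum.cong refl) (simp only: ac_simps)
  also have "\<dots> = (\<Sum>i = 1..l. \<Sum>p = 1..l+1. \<Sum>j = 1..l. ((F i - F (i + 1)) * fund_weight l i p) * ((G j - G (j + 1)) * fund_weight l j p))"
    by (intro sum.cong refl sum.swap)
  also have "\<dots> = (\<Sum>p = 1..l+1. \<Sum>i = 1..l. \<Sum>j = 1..l. ((F i - F (i + 1)) * fund_weight l i p) * ((G j - G (j + 1)) * fund_weight l j p))"
    by (rule sum.swap)
  also have "\<dots> = (\<Sum>p = 1..l+1. (F p - ?f / ?n) * (G p - ?g / ?n))"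
    by (intro sum.cong refl) (simp only: sum_product[symmetric] sum_differences_fund_weight)
  also have "\<dots> = (\<Sum>p = 1..l+1. F p * G p - ?g / ?n * F p - ?f / ?n * G p + ?f / ?n * (?g / ?n))"
    by (intro sum.cong refl) (simp add: algebra_simps del: of_nat_Suc of_nat_add sum.cl_ivl_Suc)
  also have "\<dots> = (\<Sum>p = 1..l+1. F p * G p) - ?g / ?n * ?f - ?f / ?n * ?g + ?n * (?f / ?n * (?g / ?n))"
    unfolding sum.distrib sum_subtractf sum_distrib_left[symmetric] sum_constant by simp
  also have "\<dots> = (\<Sum>p = 1..l+1. F p * G p) - ?f * ?g / ?n"
    by (simp add: field_simps del: of_nat_Suc of_nat_add sum.cl_ivl_Suc)
  finally show ?thesis .
qed

text \<open>
  On the Cartan subalgebra, \<open>\<gamma>\<close> has the Cartan matrix as its Gram matrix in the basis of simple roots. The inverse is the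
  Gram matrix of the dual basis, which consists of the fundamental weights.
\<close>

lemma inverse_gamma_matrix:
  assumes k: "k \<in> {1..l}"
  shows "inverse_matrix (gamma_matrix l k) = Matrix.mat (l + 1) (l + 1) (\<lambda>(i, j).
     if i < l \<and> j < l then d_coeff l (i + 1) (j + 1)
     else if i = l \<and> j = l then - 1 / d_coeff l k k else 0)" (is "_ = ?B")
proof (rule inverse_matrix_eq)
  show "gamma_matrix l k * ?B = 1\<^sub>m (l + 1)"
  proof (rule eq_matI)
    fix i j assume "i < dim_row (1\<^sub>m (l + 1) :: complex mat)" "j < dim_col (1\<^sub>m (l + 1) :: complex mat)"
    then have ij: "i < l + 1" "j < l + 1" by auto
    have "(gamma_matrix l k * ?B) $$ (i, j) = (\<Sum>m<l. gamma_matrix l k $$ (i, m) * ?B $$ (m, j))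
        + gamma_matrix l k $$ (i, l) * ?B $$ (l, j)"
      using ij by (simp add: gamma_matrix_def scalar_prod_def lessThan_atLeast0)
    also have "\<dots> = (if i = j then 1 else 0)"
    proof (cases "i < l \<and> j < l")
      case True
      then have ij': "i + 1 \<in> {1..l}" "j + 1 \<in> {1..l}" by auto
      let ?g = "simple_root (i + 1)"
      have g0: "(\<Sum>p = 1..l+1. ?g p) = 0"
        using sum_simple_root_mult[OF ij'(1), of "\<lambda>_. 1"] by simp
      have "(\<Sum>m<l. gamma_matrix l k $$ (i, m) * ?B $$ (m, j))
         = (\<Sum>m<l. root_form l ?g (simple_root (m + 1)) * d_coeff l (m + 1) (j + 1))"
        using True by (intro sum.cong) (auto simp: gamma_matrix_def)
      also have "\<dots> = (\<Sum>m = 1..l. root_form l ?g (simple_root m) * d_coeff l m (j + 1))"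
        using sum.atLeast1_atMost_eq[of "\<lambda>m. root_form l ?g (simple_root m) * d_coeff l m (j + 1)" l] by simp
      also have "\<dots> = (\<Sum>m = 1..l. (?g m - ?g (m + 1)) * d_coeff l m (j + 1))"
        unfolding root_form_def by (intro sum.cong refl) (simp only: sum_simple_root_mult)
      also have "\<dots> = (\<Sum>m = 1..l. \<Sum>p = 1..l+1. (?g m - ?g (m + 1)) * fund_weight l m p * fund_weight l (j + 1) p)"
        unfolding d_coeff_altdef sum_distrib_left mult.assoc ..
      also have "\<dots> = (\<Sum>p = 1..l+1. \<Sum>m = 1..l. (?g m - ?g (m + 1)) * fund_weight l m p * fund_weight l (j + 1) p)"
        by (rule sum.swap)
      also have "\<dots> = (\<Sum>p = 1..l+1. fund_weight l (j + 1) p * ?g p)"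
        by (intro sum.cong refl)
          (simp only: sum_distrib_right[symmetric] sum_differences_fund_weight g0, simp)
      also have "\<dots> = (if i = j then 1 else 0)"
        using fund_weight_dual[OF ij'(2) ij'(1)] unfolding root_form_def by simp
      finally show ?thesis
        using True by (simp add: gamma_matrix_def)
    next
      case False
      then have "(\<Sum>m<l. gamma_matrix l k $$ (i, m) * ?B $$ (m, j)) = 0"
        using ij by (intro sum.neutral) (auto simp: gamma_matrix_def)
      with False show ?thesis
        using ij d_coeff_self_nonzero[OF k] by (auto simp: gamma_matrix_def)
    qed
    finally show "(gamma_matrix l k * ?B) $$ (i, j) = 1\<^sub>m (l + 1) $$ (i, j)"
      using ij by simp
  qed (auto simp: gamma_matrix_def)
qed (auto simp: gamma_matrix_def)

lemma gamma_inv_eq: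
  assumes k: "k \<in> {1..l}"
  shows "gamma_inv l k f g x =
    (\<Sum>i = 1..l. \<Sum>j = 1..l. d_coeff l i j * partial_deriv i f x * partial_deriv j g x)
    - partial_deriv (l + 1) f x * partial_deriv (l + 1) g x / d_coeff l k k"
proof -
  let ?B = "inverse_matrix (gamma_matrix l k)"
  have 1: "?B $$ (i - 1, j - 1) = d_coeff l i j" if "i \<in> {1..l}" "j \<in> {1..l}" for i j
    unfolding inverse_gamma_matrix[OF k] using that by auto
  have 2: "?B $$ (i - 1, l) = 0" "?B $$ (l, i - 1) = 0" if "i \<in> {1..l}" for i
    unfolding inverse_gamma_matrix[OF k] using that by auto
  have 3: "?B $$ (l, l) = - 1 / d_coeff l k k"
    unfolding inverse_gamma_matrix[OF k] by auto
  have split: "(\<Sum>i = 1..l+1. h i) = (\<Sum>i = 1..l. h i) + h (l + 1)" for h :: "nat \<Rightarrow> complex"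
    by simp
  let ?t = "\<lambda>i j. ?B $$ (i - 1, j - 1) * partial_deriv i f x * partial_deriv j g x"
  have row: "(\<Sum>j = 1..l+1. ?t i j) = (\<Sum>j = 1..l. d_coeff l i j * partial_deriv i f x * partial_deriv j g x)"
    if i: "i \<in> {1..l}" for i
  proof -
    have "(\<Sum>j = 1..l. ?t i j) = (\<Sum>j = 1..l. d_coeff l i j * partial_deriv i f x * partial_deriv j g x)"
      by (intro sum.cong refl) (simp only: 1[OF i])
    moreover have "?t i (l + 1) = 0"
      by (simp only: add_diff_cancel_right' 2[OF i] mult_zero_left)
    ultimately show ?thesis
      unfolding split by simp
  qed
  have last: "(\<Sum>j = 1..l+1. ?t (l + 1) j) = - (partial_deriv (l + 1) f x * partial_deriv (l + 1) g x / d_coeff l k k)"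
  proof -
    have "(\<Sum>j = 1..l. ?t (l + 1) j) = 0"
      by (intro sum.neutral ballI) (simp only: add_diff_cancel_right' 2 mult_zero_left)
    moreover have "?t (l + 1) (l + 1) = - (partial_deriv (l + 1) f x * partial_deriv (l + 1) g x / d_coeff l k k)"
      unfolding add_diff_cancel_right' 3 by simp
    ultimately show ?thesis
      unfolding split by simp
  qed
  have "(\<Sum>i = 1..l. \<Sum>j = 1..l+1. ?t i j)
      = (\<Sum>i = 1..l. \<Sum>j = 1..l. d_coeff l i j * partial_deriv i f x * partial_deriv j g x)"
    by (intro sum.cong refl row)
  then show ?thesis
    unfolding gamma_inv_def split[of "\<lambda>i. \<Sum>j = 1..l+1. ?t i j"] last by (simp only: diff_conv_add_uminus)
qed

lemma gamma_inv_y_map: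
  assumes k: "k \<in> {1..l}" and i: "i \<in> {1..l}" and j: "j \<in> {1..l}"
  shows "gamma_inv l k (\<lambda>x. y_map l k x i) (\<lambda>x. y_map l k x j) x
    = y_scale l k i x * y_scale l k j x * (cofactor_gram l (a_fun l x) i j
        - (of_nat i * of_nat j / of_nat (l + 1) + d_coeff l k i * d_coeff l k j / d_coeff l k k)
            * coeff (orbit_poly l x) i * coeff (orbit_poly l x) j)"
proof -
  let ?F = "\<lambda>p. cofactor_coeff l x p i" and ?G = "\<lambda>p. cofactor_coeff l x p j"
  have "(\<Sum>a = 1..l. \<Sum>b = 1..l. d_coeff l a b * partial_deriv a (\<lambda>x. y_map l k x i) x * partial_deriv b (\<lambda>x. y_map l k x j) x)
     = (\<Sum>a = 1..l. \<Sum>b = 1..l. y_scale l k i x * y_scale l k j x * (d_coeff l a b * (?F a - ?F (a + 1)) * (?G b - ?G (b + 1))))"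
    using i j by (intro sum.cong refl) (simp add: partial_deriv_y_map)
  also have "\<dots> = y_scale l k i x * y_scale l k j x * ((\<Sum>p = 1..l+1. ?F p * ?G p) - (\<Sum>p = 1..l+1. ?F p) * (\<Sum>p = 1..l+1. ?G p) / of_nat (l + 1))"
    unfolding sum_d_coeff_differences[symmetric] by (simp only: sum_distrib_left)
  also have "(\<Sum>p = 1..l+1. ?F p * ?G p) = cofactor_gram l (a_fun l x) i j"
    by (simp only: cofactor_gram_def cofactor_coeff_def)
  also have "(\<Sum>p = 1..l+1. ?F p) = of_nat i * coeff (orbit_poly l x) i"
    by (simp only: cofactor_coeff_def sum_coeff_cofactor orbit_poly_def)
  also have "(\<Sum>p = 1..l+1. ?G p) = of_nat j * coeff (orbit_poly l x) j"
    by (simp only: cofactor_coeff_def sum_coeff_cofactor orbit_poly_def)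
  finally have main: "(\<Sum>a = 1..l. \<Sum>b = 1..l. d_coeff l a b * partial_deriv a (\<lambda>x. y_map l k x i) x * partial_deriv b (\<lambda>x. y_map l k x j) x)
     = y_scale l k i x * y_scale l k j x * (cofactor_gram l (a_fun l x) i j
         - of_nat i * coeff (orbit_poly l x) i * (of_nat j * coeff (orbit_poly l x) j) / of_nat (l + 1))" .
  show ?thesis
    unfolding gamma_inv_eq[OF k] main partial_deriv_y_map_top[OF i] partial_deriv_y_map_top[OF j]
    unfolding y_map_eq[OF i] y_map_eq[OF j]
    by (simp add: ring_distribs ac_simps add_divide_distrib del: of_nat_Suc of_nat_add)
qed

lemma gamma_inv_y_map_top:
  assumes k: "k \<in> {1..l}" and i: "i \<in> {1..l}"
  shows "gamma_inv l k (\<lambda>x. y_map l k x i) (\<lambda>x. y_map l k x (l + 1)) x = - (d_coeff l k i * y_map l k x i / d_coeff l k k)"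
    and "gamma_inv l k (\<lambda>x. y_map l k x (l + 1)) (\<lambda>x. y_map l k x i) x = - (d_coeff l k i * y_map l k x i / d_coeff l k k)"
    and "gamma_inv l k (\<lambda>x. y_map l k x (l + 1)) (\<lambda>x. y_map l k x (l + 1)) x = - (1 / d_coeff l k k)"
  unfolding gamma_inv_eq[OF k] partial_deriv_y_map_coord partial_deriv_y_map_top[OF i]
  by simp_all

lemma lie_deriv_e_field:
  assumes "k \<in> {1..n}"
  shows "lie_deriv n (e_field k \<kappa>) T i j p = \<kappa> * partial_deriv k (T i j) p"
proof -
  have "partial_deriv m (e_field k \<kappa> i) p = 0" for m i
    by (simp add: partial_deriv_def e_field_def[abs_def])
  then have "lie_deriv n (e_field k \<kappa>) T i j p = (\<Sum>m = 1..n. if m = k then \<kappa> * partial_deriv k (T i j) p else 0)"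
    unfolding lie_deriv_def by (intro sum.cong refl) (simp add: e_field_def)
  then show ?thesis
    using assms by simp
qed

text \<open>
  Changing \<open>y\<^sub>k\<close> alone moves the coefficient of degree \<open>k\<close> and fixes all others.
\<close>

lemma coeff_orbit_poly_upd:
  assumes k: "k \<in> {1..l}" and eq: "y_map l k z = (y_map l k x)(k := t)"
  shows "coeff (orbit_poly l z) i
      = coeff (orbit_poly l x) i + (if i = k then (t - y_map l k x k) / y_scale l k k x else 0)"
    and "y_scale l k i z = y_scale l k i x"
proof -
  have "z (l + 1) = x (l + 1)"
    using fun_cong[OF eq, of "l + 1"] k unfolding fun_upd_def y_map_top by auto
  then have sc: "y_scale l k i z = y_scale l k i x" for i
    by (simp add: y_scale_def)
  show "y_scale l k i z = y_scale l k i x" by (rule sc)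
  consider "i = 0" | "i = l + 1" | "i > l + 1" | "i \<in> {1..l}" by fastforce
  then show "coeff (orbit_poly l z) i
      = coeff (orbit_poly l x) i + (if i = k then (t - y_map l k x k) / y_scale l k k x else 0)"
  proof cases
    case 4
    have "y_scale l k i x * coeff (orbit_poly l z) i = (if i = k then t else y_scale l k i x * coeff (orbit_poly l x) i)"
      using fun_cong[OF eq, of i] 4 by (simp add: y_map_eq sc)
    then have "coeff (orbit_poly l z) i = (if i = k then t / y_scale l k i x else coeff (orbit_poly l x) i)"
      by (auto simp: field_simps split: if_splits)
    then show ?thesis
      using 4 by (auto simp: y_map_eq diff_divide_distrib)
  qed (use k in \<open>auto simp: coeff_orbit_poly_0 coeff_orbit_poly_top coeff_orbit_poly_top[simplified] degree_orbit_poly coeff_eq_0\<close>)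
qed

text \<open>
  \<open>x\<^bsup>k+1\<^esup>\<close> times the derivative of \<open>x\<^bsup>-k\<^esup> E(x)\<close>, for \<open>E\<close> the orbit polynomial.
\<close>

definition slope_poly :: "nat \<Rightarrow> nat \<Rightarrow> (nat \<Rightarrow> complex) \<Rightarrow> complex poly" where
  "slope_poly l k x = pCons 0 (pderiv (orbit_poly l x)) - Polynomial.smult (of_nat k) (orbit_poly l x)"

lemma coeff_slope_poly: "coeff (slope_poly l k x) m = (of_nat m - of_nat k) * coeff (orbit_poly l x) m"
  by (cases m) (auto simp: slope_poly_def coeff_pderiv algebra_simps)

text \<open>
  The two Hankel blocks of the contravariant Saito metric, without the scaling factors of the coordinates.
\<close>

definition saito_core :: "nat \<Rightarrow> nat \<Rightarrow> (nat \<Rightarrow> complex) \<Rightarrow> nat \<Rightarrow> nat \<Rightarrow> complex" where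
  "saito_core l k x i j =
    (if i < k \<and> j < k then (if k \<le> i + j then coeff (slope_poly l k x) (i + j - k) else 0)
     else if k < i \<and> k < j then - coeff (slope_poly l k x) (i + j - k) else 0)"

text \<open>
  By \<open>cofactor_gram_eq\<close>, \<open>\<gamma>\<^sup>-\<^sup>1(dy\<^sub>i, dy\<^sub>j)\<close> is a combination of \<open>E\<^sub>i E\<^sub>j\<close> and of the \<open>E\<^sub>i\<^sub>-\<^sub>r E\<^sub>j\<^sub>+\<^sub>r\<close>. Since \<open>i \<le> j\<close>,
  at most one of the latter contains \<open>E\<^sub>k\<close>, and only if \<open>i\<close> and \<open>j\<close> lie on the same side of \<open>k\<close>.
  The product \<open>E\<^sub>i E\<^sub>j\<close> contains \<open>E\<^sub>k\<close> if \<open>i = k\<close> or \<open>j = k\<close>; its coefficient then is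
  \<open>d\<^sub>i\<^sub>j - d\<^sub>i d\<^sub>j / d\<^sub>k = 0\<close>, which is what the value \<open>-d\<^sub>k\<close> of \<open>\<gamma>\<close> on the second summand is for.
\<close>

lemma gamma_inv_y_deriv:
  assumes k: "k \<in> {1..l}" and i: "i \<in> {1..l}" and j: "j \<in> {1..l}" and ij: "i \<le> j"
  shows "partial_deriv k (gamma_inv_y l k i j) (y_map l k x)
     = y_scale l k i x * y_scale l k j x / y_scale l k k x * saito_core l k x i j"
proof -
  let ?s = "\<lambda>i. y_scale l k i x" and ?e = "coeff (orbit_poly l x)"
  define \<delta> where "\<delta> = (\<lambda>i. if i = k then 1 / ?s k else 0)"
  define E where "E = (\<lambda>t i. ?e i + (if i = k then (t - y_map l k x k) / ?s k else 0))"
  define c where "c = of_nat i * of_nat j / of_nat (l + 1) + d_coeff l k i * d_coeff l k j / d_coeff l k k"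
  have val: "gamma_inv_y l k i j ((y_map l k x)(k := t)) = ?s i * ?s j *
     (of_nat i * (E t i * E t j) - (\<Sum>r = 1..i. (of_nat j - of_nat i + 2 * of_nat r) * (E t (i - r) * E t (j + r))) - c * (E t i * E t j))" for t
  proof -
    let ?p = "(y_map l k x)(k := t)"
    define z where "z = inv_into (coord_space (l + 1)) (y_map l k) ?p"
    have "?p \<in> coord_space (l + 1)"
      using y_map_in_coord_space[of l k x] k by (auto simp: coord_space_def)
    then have z: "y_map l k z = ?p"
      unfolding z_def by (rule y_map_inv)
    note upd = coeff_orbit_poly_upd[OF k z]
    have "coeff (orbit_poly l z) = E t"
      by (rule ext) (simp add: E_def upd(1))
    then show ?thesis
      unfolding gamma_inv_y_def z_def[symmetric] gamma_inv_y_map[OF k i j] upd(2) cofactor_gram_eq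
        orbit_poly_def[symmetric] c_def by (simp only: mult.assoc)
  qed
  have E0: "E (y_map l k x k) = ?e"
    by (auto simp: E_def)
  have dE: "((\<lambda>t. E t a) has_field_derivative \<delta> a) (at (y_map l k x k))" for a
    unfolding E_def \<delta>_def by (auto intro!: derivative_eq_intros)
  have dEE: "((\<lambda>t. E t a * E t b) has_field_derivative \<delta> a * ?e b + \<delta> b * ?e a) (at (y_map l k x k))" for a b
    using DERIV_mult[OF dE dE, of a b] unfolding E0 .
  have "((\<lambda>t. gamma_inv_y l k i j ((y_map l k x)(k := t))) has_field_derivative
      ?s i * ?s j * (of_nat i * (\<delta> i * ?e j + \<delta> j * ?e i)
        - (\<Sum>r = 1..i. (of_nat j - of_nat i + 2 * of_nat r) * (\<delta> (i - r) * ?e (j + r) + \<delta> (j + r) * ?e (i - r)))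
        - c * (\<delta> i * ?e j + \<delta> j * ?e i))) (at (y_map l k x k))"
    unfolding val by (intro DERIV_cmult DERIV_diff DERIV_sum dEE)
  then have "partial_deriv k (gamma_inv_y l k i j) (y_map l k x) =
      ?s i * ?s j * ((of_nat i - c) * (\<delta> i * ?e j + \<delta> j * ?e i)
        - (\<Sum>r = 1..i. (of_nat j - of_nat i + 2 * of_nat r) * (\<delta> (i - r) * ?e (j + r) + \<delta> (j + r) * ?e (i - r))))"
    unfolding partial_deriv_def by (intro DERIV_imp_deriv) (simp add: algebra_simps)
  also have "(\<Sum>r = 1..i. (of_nat j - of_nat i + 2 * of_nat r) * (\<delta> (i - r) * ?e (j + r) + \<delta> (j + r) * ?e (i - r)))
     = - (saito_core l k x i j / ?s k)"
  proof -
    \<comment> \<open>The factor \<open>E\<^sub>k\<close> sits at \<open>r = i - k\<close> in the first case and at \<open>r = k - j\<close> in the second.\<close>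
    consider "k < i" | "j < k" | "i \<le> k" "k \<le> j" by linarith
    then show ?thesis
    proof cases
      case 1
      have "(\<Sum>r = 1..i. (of_nat j - of_nat i + 2 * of_nat r) * (\<delta> (i - r) * ?e (j + r) + \<delta> (j + r) * ?e (i - r)))
        = (\<Sum>r = 1..i. if r = i - k then (of_nat j + of_nat i - 2 * of_nat k) * ?e (i + j - k) / ?s k else 0)"
        using 1 ij by (intro sum.cong refl) (auto simp: \<delta>_def of_nat_diff algebra_simps add_divide_distrib diff_divide_distrib)
      also have "\<dots> = (of_nat j + of_nat i - 2 * of_nat k) * ?e (i + j - k) / ?s k"
        using 1 k by (simp add: Suc_le_eq)
      finally show ?thesis
        using 1 ij by (simp add: saito_core_def coeff_slope_poly of_nat_diff algebra_simps add_divide_distrib diff_divide_distrib)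
    next
      case 2
      have "(\<Sum>r = 1..i. (of_nat j - of_nat i + 2 * of_nat r) * (\<delta> (i - r) * ?e (j + r) + \<delta> (j + r) * ?e (i - r)))
        = (\<Sum>r = 1..i. if r = k - j then (2 * of_nat k - of_nat i - of_nat j) * ?e (i + j - k) / ?s k else 0)"
        using 2 ij by (intro sum.cong refl) (auto simp: \<delta>_def of_nat_diff algebra_simps add_divide_distrib diff_divide_distrib)
      also have "\<dots> = (if k \<le> i + j then (2 * of_nat k - of_nat i - of_nat j) * ?e (i + j - k) / ?s k else 0)"
        using 2 by auto
      finally show ?thesis
        using 2 ij by (simp add: saito_core_def coeff_slope_poly of_nat_diff algebra_simps add_divide_distrib diff_divide_distrib)
    next
      case 3
      then have "(\<Sum>r = 1..i. (of_nat j - of_nat i + 2 * of_nat r) * (\<delta> (i - r) * ?e (j + r) + \<delta> (j + r) * ?e (i - r))) = 0"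
        by (intro sum.neutral) (auto simp: \<delta>_def)
      with 3 show ?thesis
        by (simp add: saito_core_def)
    qed
  qed
  also have "(of_nat i - c) * (\<delta> i * ?e j + \<delta> j * ?e i) = 0"
  proof (cases "i = k \<or> j = k")
    case True
    have "c = of_nat i"
    proof -
      have "d_coeff l k i * d_coeff l k j / d_coeff l k k = d_coeff l i j"
        using True d_coeff_self_nonzero[OF k] by (auto simp: d_coeff_commute)
      then show ?thesis
        using ij by (simp add: c_def d_coeff_eq[OF i j] min_def)
    qed
    then show ?thesis by simp
  qed (simp add: \<delta>_def)
  finally show ?thesis
    by simp
qed

lemma gamma_inv_y_commute:
  assumes k: "k \<in> {1..l}" and i: "i \<in> {1..l}" and j: "j \<in> {1..l}"
  shows "gamma_inv_y l k i j = gamma_inv_y l k j i"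
  unfolding gamma_inv_y_def gamma_inv_y_map[OF k i j] gamma_inv_y_map[OF k j i] cofactor_gram_def
  by (simp only: ac_simps)

lemma saito_contravariant_entry:
  assumes "k \<in> {1..l}" "i \<in> {1..l+1}" "j \<in> {1..l+1}"
  shows "saito_contravariant l k \<kappa> p $$ (i - 1, j - 1) = \<kappa> * partial_deriv k (gamma_inv_y l k i j) p"
  using assms by (auto simp: saito_contravariant_def lie_deriv_e_field)

lemma saito_contravariant_core:
  assumes k: "k \<in> {1..l}" and i: "i \<in> {1..l}" and j: "j \<in> {1..l}"
  shows "saito_contravariant l k \<kappa> (y_map l k x) $$ (i - 1, j - 1)
     = \<kappa> * (y_scale l k i x * y_scale l k j x / y_scale l k k x * saito_core l k x i j)"
proof -
  have "saito_contravariant l k \<kappa> (y_map l k x) $$ (i - 1, j - 1)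
      = \<kappa> * partial_deriv k (gamma_inv_y l k i j) (y_map l k x)"
    using i j by (intro saito_contravariant_entry[OF k]) auto
  also have "partial_deriv k (gamma_inv_y l k i j) (y_map l k x)
      = y_scale l k i x * y_scale l k j x / y_scale l k k x * saito_core l k x i j"
  proof (cases "i \<le> j")
    case True
    then show ?thesis using gamma_inv_y_deriv[OF k i j] by blast
  next
    case False
    then have "partial_deriv k (gamma_inv_y l k j i) (y_map l k x)
        = y_scale l k j x * y_scale l k i x / y_scale l k k x * saito_core l k x j i"
      using gamma_inv_y_deriv[OF k j i] by simp
    moreover have "saito_core l k x j i = saito_core l k x i j"
      by (simp add: saito_core_def add.commute)
    ultimately show ?thesis
      using gamma_inv_y_commute[OF k i j] by (simp add: mult.commute)
  qed
  finally show ?thesis .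
qed

lemma saito_contravariant_top:
  assumes k: "k \<in> {1..l}" and i: "i \<in> {1..l}"
  shows "saito_contravariant l k \<kappa> (y_map l k x) $$ (i - 1, l) = (if i = k then - \<kappa> else 0)"
    and "saito_contravariant l k \<kappa> (y_map l k x) $$ (l, i - 1) = (if i = k then - \<kappa> else 0)"
    and "saito_contravariant l k \<kappa> (y_map l k x) $$ (l, l) = 0"
proof -
  have inv: "y_map l k (inv_into (coord_space (l + 1)) (y_map l k) ((y_map l k x)(k := t))) = (y_map l k x)(k := t)" for t
    using y_map_in_coord_space[of l k x] k by (intro y_map_inv) (auto simp: coord_space_def)
  have d: "deriv (\<lambda>t. - (d_coeff l k i * (if i = k then t else y_map l k x i) / d_coeff l k k)) (y_map l k x k) = (if i = k then - 1 else 0)"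
    using d_coeff_self_nonzero[OF k]
    by (intro DERIV_imp_deriv) (auto intro!: derivative_eq_intros)
  have "gamma_inv_y l k i (l + 1) ((y_map l k x)(k := t)) = - (d_coeff l k i * (if i = k then t else y_map l k x i) / d_coeff l k k)"
    "gamma_inv_y l k (l + 1) i ((y_map l k x)(k := t)) = - (d_coeff l k i * (if i = k then t else y_map l k x i) / d_coeff l k k)"
    "gamma_inv_y l k (l + 1) (l + 1) ((y_map l k x)(k := t)) = - (1 / d_coeff l k k)" for t
    unfolding gamma_inv_y_def gamma_inv_y_map_top[OF k i] inv by (simp_all only: fun_upd_apply)
  then have "partial_deriv k (gamma_inv_y l k i (l + 1)) (y_map l k x) = (if i = k then - 1 else 0)"
    "partial_deriv k (gamma_inv_y l k (l + 1) i) (y_map l k x) = (if i = k then - 1 else 0)"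
    and "partial_deriv k (gamma_inv_y l k (l + 1) (l + 1)) (y_map l k x) = 0"
    unfolding partial_deriv_def by (simp_all only: d deriv_const)
  then show "saito_contravariant l k \<kappa> (y_map l k x) $$ (i - 1, l) = (if i = k then - \<kappa> else 0)"
    "saito_contravariant l k \<kappa> (y_map l k x) $$ (l, i - 1) = (if i = k then - \<kappa> else 0)"
    "saito_contravariant l k \<kappa> (y_map l k x) $$ (l, l) = 0"
    using saito_contravariant_entry[OF k, of i "l + 1" \<kappa>] saito_contravariant_entry[OF k, of "l + 1" i \<kappa>]
      saito_contravariant_entry[OF k, of "l + 1" "l + 1" \<kappa>] i by simp_all
qed

section \<open>The covariant metric as a residue pairing\<close>

text \<open>
  A tangent vector with components \<open>u\<^sub>i\<close> in the coordinates \<open>y\<close>, encoded as a variation of the orbit polynomial. The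
  weights \<open>d\<^sub>i\<close> are piecewise linear in \<open>i\<close> with a break at \<open>k\<close>; the correction by
  \<open>(i - k) u\<^sub>l\<^sub>+\<^sub>1 E\<^sub>i\<close> beyond \<open>k\<close> removes the break, so that motion along \<open>x\<^sub>l\<^sub>+\<^sub>1\<close> becomes a
  rescaling of the variable (see \<open>tangent_poly_dy_apply\<close>). The top coefficient is the same correction for the
  constant coefficient \<open>E\<^sub>l\<^sub>+\<^sub>1 = 1\<close>.
\<close>

definition tangent_poly :: "nat \<Rightarrow> nat \<Rightarrow> (nat \<Rightarrow> complex) \<Rightarrow> (nat \<Rightarrow> complex) \<Rightarrow> complex poly" where
  "tangent_poly l k x u = (\<Sum>i = 1..l+1. monom (if i \<le> k then u i / y_scale l k i x
     else if i \<le> l then u i / y_scale l k i x + (of_nat i - of_nat k) * u (l + 1) * coeff (orbit_poly l x) i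
     else (of_nat i - of_nat k) * u (l + 1)) i)"

lemma coeff_tangent_poly:
  "coeff (tangent_poly l k x u) i = (if 1 \<le> i \<and> i \<le> l + 1 then (if i \<le> k then u i / y_scale l k i x
     else if i \<le> l then u i / y_scale l k i x + (of_nat i - of_nat k) * u (l + 1) * coeff (orbit_poly l x) i
     else (of_nat i - of_nat k) * u (l + 1)) else 0)"
  unfolding tangent_poly_def by (simp add: coeff_sum del: sum.cl_ivl_Suc)

lemma degree_tangent_poly: "degree (tangent_poly l k x u) \<le> l + 1"
  by (rule degree_le) (simp add: coeff_tangent_poly)

lemma degree_slope_poly:
  assumes "k \<in> {1..l}"
  shows "degree (slope_poly l k x) = l + 1"
proof (rule antisym)
  show "degree (slope_poly l k x) \<le> l + 1"
    by (rule degree_le) (simp add: coeff_slope_poly coeff_eq_0 degree_orbit_poly)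
  have "(of_nat (l + 1) :: complex) \<noteq> of_nat k"
    using assms by (simp only: of_nat_eq_iff) simp
  then show "l + 1 \<le> degree (slope_poly l k x)"
    by (intro le_degree) (simp only: coeff_slope_poly coeff_orbit_poly_top, simp)
qed

text \<open>
  The covector that the contravariant Saito metric sends to \<open>u\<close>.
\<close>

definition dual_vector :: "nat \<Rightarrow> nat \<Rightarrow> complex \<Rightarrow> (nat \<Rightarrow> complex) \<Rightarrow> (nat \<Rightarrow> complex) \<Rightarrow> nat \<Rightarrow> complex" where
  "dual_vector l k \<kappa> x u j =
    (if j = k then - u (l + 1) / \<kappa>
     else if j = l + 1 then - (y_scale l k k x / \<kappa>) * coeff (tangent_poly l k x u) k
     else y_scale l k k x / \<kappa> / y_scale l k j x * dual_coeff (slope_poly l k x) k (tangent_poly l k x u) (u (l + 1)) j)"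

context
  fixes l k :: nat and \<kappa> :: complex and x :: "nat \<Rightarrow> complex"
  assumes k: "k \<in> {1..l}" and \<kappa>: "\<kappa> \<noteq> 0"
begin

lemma slope_poly_facts:
  "degree (slope_poly l k x) = l + 1" "1 \<le> k" "k < l + 1" "coeff (slope_poly l k x) 0 \<noteq> 0"
  "coeff (slope_poly l k x) k = 0"
  using k degree_slope_poly[OF k] by (auto simp: coeff_slope_poly coeff_orbit_poly_0)

lemma tangent_poly_facts:
  "degree (tangent_poly l k x u) \<le> l + 1" "coeff (tangent_poly l k x u) 0 = 0"
  "coeff (tangent_poly l k x u) (l + 1) = u (l + 1) * coeff (slope_poly l k x) (l + 1)"
proof -
  show "coeff (tangent_poly l k x u) (l + 1) = u (l + 1) * coeff (slope_poly l k x) (l + 1)"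
    unfolding coeff_tangent_poly coeff_slope_poly coeff_orbit_poly_top using k by simp
qed (simp_all only: degree_tangent_poly, simp add: coeff_tangent_poly)

lemma sum_split_at_k: "(\<Sum>j = 1..l+1. f j) = (\<Sum>j\<in>{1..<k}. f j) + f k + (\<Sum>j\<in>{k<..<l+1}. f j) + (f (l + 1) :: complex)"
proof -
  have "{1..l+1} = insert (l + 1) (insert k ({1..<k} \<union> {k<..<l+1}))"
    using k by auto
  moreover have "(\<Sum>j\<in>insert (l + 1) (insert k ({1..<k} \<union> {k<..<l+1})). f j)
      = f (l + 1) + (f k + ((\<Sum>j\<in>{1..<k}. f j) + (\<Sum>j\<in>{k<..<l+1}. f j)))"
    using k by (subst sum.insert, simp, simp, subst sum.insert, simp, simp, subst sum.union_disjoint) auto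
  ultimately show ?thesis by simp
qed

lemma saito_contravariant_dual_vector:
  assumes i: "i \<in> {1..l+1}"
  shows "(\<Sum>j = 1..l+1. saito_contravariant l k \<kappa> (y_map l k x) $$ (i - 1, j - 1) * dual_vector l k \<kappa> x u j) = u i"
proof -
  let ?M = "saito_contravariant l k \<kappa> (y_map l k x)"
  let ?X = "dual_vector l k \<kappa> x u" and ?N = "tangent_poly l k x u" and ?T = "slope_poly l k x"
  let ?c = "dual_coeff ?T k ?N (u (l + 1))"
  let ?s = "\<lambda>i. y_scale l k i x"
  show ?thesis
  proof (cases "i = l + 1")
    case True
    have "?M $$ (i - 1, j - 1) * ?X j = 0" if "j \<in> {1..l+1} - {k}" for j
    proof (cases "j = l + 1")
      case False
      then show ?thesis
        using that saito_contravariant_top(2)[OF k, of j \<kappa> x] True by auto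
    qed (use True saito_contravariant_top(3)[OF k k, of \<kappa> x] in auto)
    then have "(\<Sum>j = 1..l+1. ?M $$ (i - 1, j - 1) * ?X j) = (\<Sum>j\<in>{k}. ?M $$ (i - 1, j - 1) * ?X j)"
      using k by (intro sum.mono_neutral_right) auto
    also have "\<dots> = u i"
      using True saito_contravariant_top(2)[OF k k, of \<kappa> x] \<kappa> by (simp add: dual_vector_def)
    finally show ?thesis .
  next
    case False
    then have i': "i \<in> {1..l}" using i by auto
    have top: "?M $$ (i - 1, (l + 1) - 1) * ?X (l + 1) = (if i = k then ?s k * coeff ?N k else 0)"
      using saito_contravariant_top(1)[OF k i', of \<kappa> x] k \<kappa> by (simp add: dual_vector_def)
    have core: "?M $$ (i - 1, j - 1) * ?X j = ?s i * (saito_core l k x i j * ?c j)"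
      if "j \<in> {1..l}" "j \<noteq> k" for j
      using saito_contravariant_core[OF k i' that(1), of \<kappa> x] that \<kappa> by (simp add: dual_vector_def)
    have corek: "?M $$ (i - 1, k - 1) * ?X k = 0"
      using saito_contravariant_core[OF k i' k, of \<kappa> x] by (simp add: saito_core_def)
    have split: "(\<Sum>j = 1..l+1. ?M $$ (i - 1, j - 1) * ?X j)
      = ?s i * (\<Sum>j\<in>{1..<k}. saito_core l k x i j * ?c j) + ?s i * (\<Sum>j\<in>{k<..<l+1}. saito_core l k x i j * ?c j)
         + (if i = k then ?s k * coeff ?N k else 0)"
    proof -
      have "(\<Sum>j\<in>{1..<k}. ?M $$ (i - 1, j - 1) * ?X j) = (\<Sum>j\<in>{1..<k}. ?s i * (saito_core l k x i j * ?c j))"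
        using k by (intro sum.cong refl core) auto
      moreover have "(\<Sum>j\<in>{k<..<l+1}. ?M $$ (i - 1, j - 1) * ?X j) = (\<Sum>j\<in>{k<..<l+1}. ?s i * (saito_core l k x i j * ?c j))"
        by (intro sum.cong refl core) auto
      ultimately show ?thesis
        unfolding sum_split_at_k corek top sum_distrib_left by (simp only: add_0_right)
    qed
    consider "i < k" | "i = k" | "k < i" by linarith
    then show ?thesis
    proof cases
      case 1
      have "(\<Sum>j\<in>{1..<k}. saito_core l k x i j * ?c j)
        = (\<Sum>j\<in>{1..<k}. (if k \<le> i + j then coeff ?T (i + j - k) else 0) * ?c j)"
        using 1 by (intro sum.cong) (auto simp: saito_core_def)
      also have "\<dots> = coeff ?N i"
        by (rule dual_coeff_low[OF slope_poly_facts tangent_poly_facts tangent_poly_facts]) (use 1 i in auto)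
      finally have low: "(\<Sum>j\<in>{1..<k}. saito_core l k x i j * ?c j) = coeff ?N i" .
      have high: "(\<Sum>j\<in>{k<..<l+1}. saito_core l k x i j * ?c j) = 0"
        using 1 by (intro sum.neutral) (auto simp: saito_core_def)
      show ?thesis
        unfolding split low high using 1 i' by (simp add: coeff_tangent_poly)
    next
      case 2
      have "(\<Sum>j\<in>{1..<k}. saito_core l k x i j * ?c j) = 0" "(\<Sum>j\<in>{k<..<l+1}. saito_core l k x i j * ?c j) = 0"
        using 2 by (auto intro!: sum.neutral simp: saito_core_def)
      then show ?thesis
        unfolding split using 2 i' by (simp add: coeff_tangent_poly)
    next
      case 3
      have "(\<Sum>j\<in>{k<..<l+1}. saito_core l k x i j * ?c j)
        = - (\<Sum>j\<in>{k<..<l+1}. coeff ?T (i + j - k) * ?c j)"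
        using 3 unfolding sum_negf[symmetric] by (intro sum.cong) (auto simp: saito_core_def)
      also have "(\<Sum>j\<in>{k<..<l+1}. coeff ?T (i + j - k) * ?c j) = - (coeff ?N i - u (l + 1) * coeff ?T i)"
        by (rule dual_coeff_high[OF slope_poly_facts tangent_poly_facts tangent_poly_facts]) (use 3 i' in auto)
      finally have 1: "(\<Sum>j\<in>{k<..<l+1}. saito_core l k x i j * ?c j) = coeff ?N i - u (l + 1) * coeff ?T i"
        by simp
      have 2: "(\<Sum>j\<in>{1..<k}. saito_core l k x i j * ?c j) = 0"
        using 3 by (intro sum.neutral) (auto simp: saito_core_def)
      show ?thesis
        unfolding split 1 2 using 3 i' by (simp add: coeff_tangent_poly coeff_slope_poly)
    qed
  qed
qed

lemma dual_vector_pairing: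
  "(\<Sum>j = 1..l+1. dual_vector l k \<kappa> x u j * v j)
    = y_scale l k k x / \<kappa> * residue_0_inf (slope_poly l k x) k (tangent_poly l k x u * tangent_poly l k x v)"
proof -
  let ?X = "dual_vector l k \<kappa> x u" and ?N = "tangent_poly l k x" and ?T = "slope_poly l k x"
  let ?c = "dual_coeff ?T k (?N u) (u (l + 1))"
  let ?s = "\<lambda>i. y_scale l k i x"
  have low: "?X j * v j = ?s k / \<kappa> * (?c j * coeff (?N v) j)" if "j \<in> {1..<k}" for j
    using that k by (simp add: dual_vector_def coeff_tangent_poly)
  have high: "?X j * v j = ?s k / \<kappa> * (?c j * (coeff (?N v) j - v (l + 1) * coeff ?T j))" if "j \<in> {k<..<l+1}" for j
    using that k by (simp add: dual_vector_def coeff_tangent_poly coeff_slope_poly)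
  have mid: "?X k * v k = - (?s k / \<kappa> * (u (l + 1) * coeff (?N v) k))"
    using k by (simp add: dual_vector_def coeff_tangent_poly)
  have top: "?X (l + 1) * v (l + 1) = - (?s k / \<kappa> * (v (l + 1) * coeff (?N u) k))"
    using k by (simp add: dual_vector_def)
  have "(\<Sum>j = 1..l+1. ?X j * v j) = ?s k / \<kappa> * (\<Sum>j\<in>{1..<k}. ?c j * coeff (?N v) j)
      + - (?s k / \<kappa> * (u (l + 1) * coeff (?N v) k))
      + ?s k / \<kappa> * (\<Sum>j\<in>{k<..<l+1}. ?c j * (coeff (?N v) j - v (l + 1) * coeff ?T j))
      + - (?s k / \<kappa> * (v (l + 1) * coeff (?N u) k))"
    unfolding sum_split_at_k mid top sum_distrib_left
    by (intro arg_cong2[of _ _ _ _ "(+)"] refl sum.cong low high)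
  also have "\<dots> = ?s k / \<kappa> * ((\<Sum>j\<in>{1..<k}. ?c j * coeff (?N v) j)
      + (\<Sum>j\<in>{k<..<l+1}. ?c j * (coeff (?N v) j - v (l + 1) * coeff ?T j))
      - u (l + 1) * coeff (?N v) k - v (l + 1) * coeff (?N u) k)"
    by (simp only: ring_distribs) simp
  also have "(\<Sum>j\<in>{1..<k}. ?c j * coeff (?N v) j)
      + (\<Sum>j\<in>{k<..<l+1}. ?c j * (coeff (?N v) j - v (l + 1) * coeff ?T j))
      - u (l + 1) * coeff (?N v) k - v (l + 1) * coeff (?N u) k = residue_0_inf ?T k (?N u * ?N v)"
    by (rule dual_coeff_pairing[OF slope_poly_facts tangent_poly_facts tangent_poly_facts])
  finally show ?thesis .
qed

text \<open>
  The covectors dual to the unit vectors form a right inverse of the contravariant matrix, so the covariant matrix exists and sends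
  \<open>v\<close> to its dual vector.
\<close>

lemma saito_covariant_pairing:
  "(\<Sum>i = 1..l+1. \<Sum>j = 1..l+1. saito_covariant l k \<kappa> (y_map l k x) $$ (i - 1, j - 1) * u i * v j)
    = y_scale l k k x / \<kappa> * residue_0_inf (slope_poly l k x) k (tangent_poly l k x v * tangent_poly l k x u)"
proof -
  let ?n = "l + 1"
  let ?M = "saito_contravariant l k \<kappa> (y_map l k x)"
  define C where "C = saito_covariant l k \<kappa> (y_map l k x)"
  have M: "?M \<in> carrier_mat ?n ?n"
    by (simp add: saito_contravariant_def)
  have shift: "(\<Sum>j = 0..<?n. f (j + 1)) = (\<Sum>j = 1..?n. f j)" for f :: "nat \<Rightarrow> complex"
    using sum.atLeast1_atMost_eq[of f ?n] by (simp add: lessThan_atLeast0 del: sum.cl_ivl_Suc sum.op_ivl_Suc)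
  have MX: "?M *\<^sub>v Matrix.vec ?n (\<lambda>j. dual_vector l k \<kappa> x w (j + 1)) = Matrix.vec ?n (\<lambda>i. w (i + 1))" for w
  proof (rule eq_vecI)
    fix i assume "i < dim_vec (Matrix.vec ?n (\<lambda>i. w (i + 1)))"
    then have i: "i < ?n" by simp
    have "Matrix.vec_index (?M *\<^sub>v Matrix.vec ?n (\<lambda>j. dual_vector l k \<kappa> x w (j + 1))) i
       = (\<Sum>j = 0..<?n. ?M $$ ((i + 1) - 1, (j + 1) - 1) * dual_vector l k \<kappa> x w (j + 1))"
      using i M by (auto simp: scalar_prod_def intro!: sum.cong)
    also have "\<dots> = w (i + 1)"
      unfolding shift[of "\<lambda>j. ?M $$ ((i + 1) - 1, j - 1) * dual_vector l k \<kappa> x w j"]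
      by (rule saito_contravariant_dual_vector) (use i in auto)
    finally show "Matrix.vec_index (?M *\<^sub>v Matrix.vec ?n (\<lambda>j. dual_vector l k \<kappa> x w (j + 1))) i = Matrix.vec_index (Matrix.vec ?n (\<lambda>i. w (i + 1))) i"
      using i by simp
  qed (use M in auto)
  define B where "B = Matrix.mat ?n ?n (\<lambda>(i, j). dual_vector l k \<kappa> x (\<lambda>m. if m = j + 1 then 1 else 0) (i + 1))"
  have B: "B \<in> carrier_mat ?n ?n" by (simp add: B_def)
  have MB: "?M * B = 1\<^sub>m ?n"
  proof (rule mat_col_eqI)
    fix j assume "j < dim_col (1\<^sub>m ?n :: complex mat)"
    then have j: "j < ?n" by simp
    have "col (?M * B) j = ?M *\<^sub>v col B j"
      using j M B by (intro col_mult2) auto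
    also have "col B j = Matrix.vec ?n (\<lambda>i. dual_vector l k \<kappa> x (\<lambda>m. if m = j + 1 then 1 else 0) (i + 1))"
      using j by (auto simp: B_def)
    also have "?M *\<^sub>v \<dots> = col (1\<^sub>m ?n) j"
      unfolding MX using j by (intro eq_vecI) auto
    finally show "col (?M * B) j = col (1\<^sub>m ?n) j" .
  qed (use M B in auto)
  have "C = B"
    unfolding C_def saito_covariant_def by (rule inverse_matrix_eq[OF M B MB])
  have BM: "B * ?M = 1\<^sub>m ?n"
    by (rule mat_mult_left_right_inverse[OF M B MB])
  have CX: "C *\<^sub>v Matrix.vec ?n (\<lambda>i. v (i + 1)) = Matrix.vec ?n (\<lambda>j. dual_vector l k \<kappa> x v (j + 1))"
  proof -
    let ?X = "Matrix.vec ?n (\<lambda>j. dual_vector l k \<kappa> x v (j + 1))"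
    have "C *\<^sub>v Matrix.vec ?n (\<lambda>i. v (i + 1)) = B *\<^sub>v (?M *\<^sub>v ?X)"
      unfolding MX \<open>C = B\<close> ..
    also have "\<dots> = (B * ?M) *\<^sub>v ?X"
      by (rule assoc_mult_mat_vec[symmetric]) (use M B in auto)
    also have "\<dots> = ?X"
      unfolding BM by (rule one_mult_mat_vec) auto
    finally show ?thesis .
  qed
  have row: "(\<Sum>j = 1..?n. C $$ (i - 1, j - 1) * v j) = dual_vector l k \<kappa> x v i" if i: "i \<in> {1..?n}" for i
  proof -
    have "Matrix.vec_index (C *\<^sub>v Matrix.vec ?n (\<lambda>i. v (i + 1))) (i - 1) = (\<Sum>j = 0..<?n. C $$ (i - 1, (j + 1) - 1) * v (j + 1))"
      using i B unfolding \<open>C = B\<close> by (auto simp: scalar_prod_def intro!: sum.cong)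
    also have "\<dots> = (\<Sum>j = 1..?n. C $$ (i - 1, j - 1) * v j)"
      by (rule shift)
    finally show ?thesis
      unfolding CX using i by auto
  qed
  have "(\<Sum>i = 1..?n. \<Sum>j = 1..?n. C $$ (i - 1, j - 1) * u i * v j) = (\<Sum>i = 1..?n. dual_vector l k \<kappa> x v i * u i)"
  proof (rule sum.cong[OF refl])
    fix i assume i: "i \<in> {1..?n}"
    show "(\<Sum>j = 1..?n. C $$ (i - 1, j - 1) * u i * v j) = dual_vector l k \<kappa> x v i * u i"
      unfolding row[OF i, symmetric] sum_distrib_right by (intro sum.cong refl) (simp only: ac_simps)
  qed
  then show ?thesis
    unfolding dual_vector_pairing C_def .
qed

end

text \<open>
  The logarithm of \<open>a\<^sub>p\<close> at the point \<open>u\<close>; it is linear, so it is also the logarithmic derivative of \<open>a\<^sub>p\<close> along the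
  vector \<open>u\<close>.
\<close>

definition log_deriv :: "nat \<Rightarrow> (nat \<Rightarrow> complex) \<Rightarrow> nat \<Rightarrow> complex" where
  "log_deriv l u p = x_tilde l u (p - 1) - x_tilde l u p"

lemma sum_log_deriv: "(\<Sum>p = 1..l+1. log_deriv l u p) = 0"
  unfolding log_deriv_def sum_telescope_1 by simp

lemma sum_by_parts:
  fixes c w :: "nat \<Rightarrow> complex"
  shows "(\<Sum>m = 1..l. (c m - c (m + 1)) * w m) = - (\<Sum>p = 1..l. c p * (w (p - 1) - w p)) + c 1 * w 0 - c (l + 1) * w l"
  by (induction l) (auto simp: algebra_simps)

lemma dy_apply_eq:
  assumes i: "i \<in> {1..l}"
  shows "dy_apply l k x u i = y_scale l k i x *
    (- (\<Sum>p = 1..l+1. log_deriv l u p * cofactor_coeff l x p i) + d_coeff l k i * u (l + 1) * coeff (orbit_poly l x) i)"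
proof -
  let ?c = "\<lambda>p. cofactor_coeff l x p i"
  have "(\<Sum>m = 1..l. partial_deriv m (\<lambda>z. y_map l k z i) x * u m)
      = (\<Sum>m = 1..l. y_scale l k i x * ((?c m - ?c (m + 1)) * x_tilde l u m))"
    using i by (intro sum.cong) (auto simp: partial_deriv_y_map x_tilde_eq)
  also have "\<dots> = y_scale l k i x * (- (\<Sum>p = 1..l. ?c p * log_deriv l u p) - ?c (l + 1) * x_tilde l u l)"
    unfolding sum_distrib_left[symmetric] sum_by_parts[of ?c "x_tilde l u" l] log_deriv_def by simp
  also have "- (\<Sum>p = 1..l. ?c p * log_deriv l u p) - ?c (l + 1) * x_tilde l u l
      = - (\<Sum>p = 1..l+1. log_deriv l u p * ?c p)"
    by (simp add: log_deriv_def mult.commute)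
  finally show ?thesis
    using partial_deriv_y_map_top[OF i, of k x] y_map_eq[OF i, of k x]
    by (simp add: dy_apply_def algebra_simps)
qed

lemma dy_apply_top: "dy_apply l k x u (l + 1) = u (l + 1)"
proof -
  have "dy_apply l k x u (l + 1) = (\<Sum>m = 1..l+1. if m = l + 1 then u m else 0)"
    unfolding dy_apply_def partial_deriv_y_map_coord by (intro sum.cong) auto
  then show ?thesis by simp
qed

text \<open>
  For vectors that come from \<open>x\<close>-space, the polynomial is the variation of the orbit polynomial caused by the logarithmic
  derivatives of the \<open>a\<^sub>p\<close>, plus \<open>(1 - k/(l + 1)) u\<^sub>l\<^sub>+\<^sub>1\<close> times \<open>x E'(x)\<close>.
\<close>

lemma tangent_poly_dy_apply:
  assumes k: "k \<in> {1..l}"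
  shows "tangent_poly l k x (dy_apply l k x u)
    = (\<Sum>p = 1..l+1. Polynomial.smult (log_deriv l u p * a_fun l x p) (lin_cofactor l (a_fun l x) p))
      + Polynomial.smult ((of_nat (l + 1) - of_nat k) / of_nat (l + 1) * u (l + 1)) (pCons 0 (pderiv (orbit_poly l x)))"
    (is "_ = ?R")
proof (rule poly_eqI)
  fix i
  let ?E = "coeff (orbit_poly l x)" and ?\<beta> = "(of_nat (l + 1) - of_nat k) / of_nat (l + 1) :: complex"
  define S where "S = (\<Sum>p = 1..l+1. log_deriv l u p * cofactor_coeff l x p i)"
  have "(\<Sum>p = 1..l+1. log_deriv l u p * a_fun l x p * coeff (lin_cofactor l (a_fun l x) p) i)
      = (\<Sum>p = 1..l+1. log_deriv l u p * ?E i - log_deriv l u p * cofactor_coeff l x p i)"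
    by (intro sum.cong refl)
      (simp add: cofactor_coeff_def coeff_cofactor_step[of _ l] orbit_poly_def algebra_simps)
  also have "\<dots> = - S"
    unfolding sum_subtractf sum_distrib_right[symmetric] sum_log_deriv S_def by simp
  finally have R: "coeff ?R i = - S + ?\<beta> * u (l + 1) * (of_nat i * ?E i)"
    by (cases i) (simp_all add: coeff_sum coeff_pderiv del: sum.cl_ivl_Suc of_nat_add of_nat_Suc)
  have dy: "dy_apply l k x u i = y_scale l k i x * (- S + d_coeff l k i * u (l + 1) * ?E i)" if "i \<in> {1..l}"
    unfolding dy_apply_eq[OF that] S_def ..
  have n0: "(of_nat (l + 1) :: complex) \<noteq> 0"
    by (simp del: of_nat_add of_nat_Suc)
  consider "i = 0" | "i \<in> {1..k}" | "i \<in> {k<..l}" | "i = l + 1" | "i > l + 1"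
    using k by fastforce
  then show "coeff (tangent_poly l k x (dy_apply l k x u)) i = coeff ?R i"
  proof cases
    case 1
    then have "S = 0" by (simp add: S_def cofactor_coeff_def)
    then show ?thesis unfolding R using 1 by (simp add: coeff_tangent_poly)
  next
    case 2
    then have i: "i \<in> {1..l}" using k by auto
    have "d_coeff l k i = ?\<beta> * of_nat i"
      using 2 n0 by (simp add: d_coeff_eq[OF k i] min_def field_simps del: of_nat_add of_nat_Suc)
    then show ?thesis
      unfolding R using 2 i by (simp add: coeff_tangent_poly dy[OF i] del: of_nat_add of_nat_Suc sum.cl_ivl_Suc)
  next
    case 3
    then have i: "i \<in> {1..l}" by auto
    \<comment> \<open>Beyond \<open>k\<close> the weight \<open>d\<^sub>i\<close> falls short of its linear continuation by \<open>i - k\<close>.\<close>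
    have "d_coeff l k i + (of_nat i - of_nat k) = ?\<beta> * of_nat i"
      using 3 n0 by (simp add: d_coeff_eq[OF k i] min_def field_simps del: of_nat_add of_nat_Suc)
    moreover have "coeff (tangent_poly l k x (dy_apply l k x u)) i
        = - S + (d_coeff l k i + (of_nat i - of_nat k)) * u (l + 1) * ?E i"
      using 3 by (simp add: coeff_tangent_poly dy[OF i] dy_apply_top[simplified] distrib_right)
    ultimately show ?thesis
      unfolding R by (simp only: mult.assoc mult.commute mult.left_commute)
  next
    case 4
    have "S = 0"
    proof -
      have "S = (\<Sum>p = 1..l+1. log_deriv l u p)"
        unfolding S_def
      proof (rule sum.cong[OF refl])
        fix p assume p: "p \<in> {1..l+1}"
        show "log_deriv l u p * cofactor_coeff l x p i = log_deriv l u p"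
          using lead_coeff_lin_cofactor[OF p, of "a_fun l x"] 4 by (simp add: cofactor_coeff_def)
      qed
      then show ?thesis by (simp only: sum_log_deriv)
    qed
    then show ?thesis
      unfolding R unfolding 4 coeff_orbit_poly_top using k n0
      by (simp add: coeff_tangent_poly dy_apply_top[simplified] field_simps del: of_nat_add of_nat_Suc)
  next
    case 5
    have "S = 0"
      unfolding S_def
    proof (intro sum.neutral ballI)
      fix p assume p: "p \<in> {1..l+1}"
      have "degree (pCons 0 (lin_cofactor l (a_fun l x) p)) < i"
        using degree_lin_cofactor[OF p, of "a_fun l x"] degree_pCons_le[of 0 "lin_cofactor l (a_fun l x) p"] 5 by simp
      then show "log_deriv l u p * cofactor_coeff l x p i = 0"
        by (simp add: cofactor_coeff_def coeff_eq_0)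
    qed
    then show ?thesis
      unfolding R using 5 by (simp add: coeff_tangent_poly coeff_eq_0 degree_orbit_poly)
  qed
qed

section \<open>Linear coordinates on a stratum\<close>

definition block_rep :: "(nat \<Rightarrow> nat set) \<Rightarrow> nat \<Rightarrow> nat" where
  "block_rep B b = (SOME p. p \<in> B b)"

definition block_of :: "nat \<Rightarrow> (nat \<Rightarrow> nat set) \<Rightarrow> nat \<Rightarrow> nat" where
  "block_of d B p = (THE b. b \<in> {1..d+1} \<and> p \<in> B b)"

text \<open>
  The logarithm of \<open>\<xi>\<^sub>b\<close> shifted by a multiple of \<open>x\<^sub>l\<^sub>+\<^sub>1\<close>. The logarithms alone satisfy a linear relation; with the
  shift the \<open>d + 1\<close> values are independent coordinates on the stratum, and they are the coefficients in
  \<open>reduced_tangent_poly\<close>.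
\<close>

definition stratum_coord :: "nat \<Rightarrow> nat \<Rightarrow> (nat \<Rightarrow> nat set) \<Rightarrow> (nat \<Rightarrow> complex) \<Rightarrow> nat \<Rightarrow> complex" where
  "stratum_coord l k B u b = log_deriv l u (block_rep B b) + of_nat k / of_nat (l + 1) * u (l + 1)"

text \<open>
  The coordinate \<open>x\<^sub>l\<^sub>+\<^sub>1\<close> in terms of the coordinates of the stratum: weighting them with the block sizes makes the
  logarithms cancel and leaves \<open>k x\<^sub>l\<^sub>+\<^sub>1\<close>.
\<close>

definition stratum_top :: "nat \<Rightarrow> nat \<Rightarrow> (nat \<Rightarrow> nat set) \<Rightarrow> (nat \<Rightarrow> complex) \<Rightarrow> complex" where
  "stratum_top k d B \<phi> = (\<Sum>b = 1..d+1. of_nat (card (B b)) * \<phi> b) / of_nat k"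

definition stratum_point :: "nat \<Rightarrow> nat \<Rightarrow> nat \<Rightarrow> (nat \<Rightarrow> nat set) \<Rightarrow> (nat \<Rightarrow> complex) \<Rightarrow> nat \<Rightarrow> complex" where
  "stratum_point l k d B \<phi> i =
    (if i \<in> {1..l} then - (\<Sum>p = 1..i. \<phi> (block_of d B p) - of_nat k / of_nat (l + 1) * stratum_top k d B \<phi>)
     else if i = l + 1 then stratum_top k d B \<phi> else 0)"

lemma x_tilde_linear:
  "x_tilde l (\<lambda>i. \<Sum>r\<in>S. t r * f r i) j = (\<Sum>r\<in>S. t r * x_tilde l (f r) j)"
proof (cases "j \<in> {1..l}")
  case True
  then show ?thesis by (simp only: x_tilde_eq)
next
  case False
  then show ?thesis by (simp only: x_tilde_def if_False mult_zero_right sum.neutral_const)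
qed

lemma pCons_0_sum: "pCons 0 (\<Sum>i\<in>S. f i) = (\<Sum>i\<in>S. pCons 0 (f i :: complex poly))"
proof (induction S rule: infinite_finite_induct)
  case (insert x F)
  have "pCons 0 (f x + sum f F) = pCons 0 (f x) + pCons 0 (sum f F)"
    by simp
  then show ?case
    using insert by (simp del: add_pCons)
qed auto

lemma smult_sum_right: "Polynomial.smult c (\<Sum>i\<in>S. f i) = (\<Sum>i\<in>S. Polynomial.smult c (f i :: complex poly))"
  by (induction S rule: infinite_finite_induct) (auto simp: smult_add_right)

lemma stratum_coord_linear:
  "stratum_coord l k B (\<lambda>i. \<Sum>r\<in>S. t r * f r i) b = (\<Sum>r\<in>S. t r * stratum_coord l k B (f r) b)"
  by (simp add: stratum_coord_def log_deriv_def x_tilde_linear sum_subtractf[symmetric] sum.distrib[symmetric]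
      sum_distrib_left algebra_simps del: of_nat_add of_nat_Suc)

lemma a_fun_eq_exp: "a_fun l x p = exp (log_deriv l x p)"
  by (simp add: a_fun_def log_deriv_def)

context
  fixes l d :: nat and B :: "nat \<Rightarrow> nat set"
  assumes part: "is_block_partition l d B"
begin

lemma block_subset: "b \<in> {1..d+1} \<Longrightarrow> B b \<subseteq> {1..l+1}"
  using part unfolding is_block_partition_def by blast

lemma finite_block: "b \<in> {1..d+1} \<Longrightarrow> finite (B b)"
  using block_subset finite_subset by blast

lemma block_rep_in: "b \<in> {1..d+1} \<Longrightarrow> block_rep B b \<in> B b"
  using part unfolding is_block_partition_def block_rep_def by (simp add: some_in_eq)

lemma block_rep_range: "b \<in> {1..d+1} \<Longrightarrow> block_rep B b \<in> {1..l+1}"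
  using block_rep_in block_subset by blast

lemma card_block_pos: "b \<in> {1..d+1} \<Longrightarrow> card (B b) \<ge> 1"
  using block_rep_in finite_block by (metis One_nat_def Suc_leI card_gt_0_iff empty_iff)

lemma block_of_eq:
  assumes "b \<in> {1..d+1}" "p \<in> B b"
  shows "block_of d B p = b"
  unfolding block_of_def
proof (rule the_equality)
  show "b \<in> {1..d+1} \<and> p \<in> B b" using assms by blast
  fix c assume "c \<in> {1..d+1} \<and> p \<in> B c"
  then show "c = b"
    using part assms unfolding is_block_partition_def disjoint_family_on_def by blast
qed

lemma block_of_in:
  assumes "p \<in> {1..l+1}"
  shows "block_of d B p \<in> {1..d+1}" "p \<in> B (block_of d B p)"
proof -
  obtain b where "b \<in> {1..d+1}" "p \<in> B b"
    using part assms unfolding is_block_partition_def by blast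
  then show "block_of d B p \<in> {1..d+1}" "p \<in> B (block_of d B p)"
    using block_of_eq by auto
qed

lemma sum_blocks: "(\<Sum>p = 1..l+1. g p) = (\<Sum>b = 1..d+1. \<Sum>p\<in>B b. g p)" for g :: "nat \<Rightarrow> 'a::comm_monoid_add"
proof -
  have "(\<Sum>p\<in>(\<Union>b \<in> {1..d+1}. B b). g p) = (\<Sum>b = 1..d+1. \<Sum>p\<in>B b. g p)"
    using part finite_block unfolding is_block_partition_def disjoint_family_on_def
    by (intro sum.UNION_disjoint) auto
  then show ?thesis
    using part unfolding is_block_partition_def by simp
qed

lemma prod_blocks:
  fixes g :: "nat \<Rightarrow> 'a::comm_monoid_mult"
  assumes "\<And>b p. b \<in> {1..d+1} \<Longrightarrow> p \<in> B b \<Longrightarrow> g p = f b"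
  shows "(\<Prod>p = 1..l+1. g p) = (\<Prod>b = 1..d+1. f b ^ card (B b))"
proof -
  have "(\<Prod>p\<in>(\<Union>b \<in> {1..d+1}. B b). g p) = (\<Prod>b = 1..d+1. \<Prod>p\<in>B b. g p)"
    using part finite_block unfolding is_block_partition_def disjoint_family_on_def
    by (intro prod.UNION_disjoint) auto
  also have "\<dots> = (\<Prod>b = 1..d+1. f b ^ card (B b))"
    by (intro prod.cong refl) (simp add: assms)
  finally show ?thesis
    using part unfolding is_block_partition_def by simp
qed

lemma sum_blocks_const:
  fixes g :: "nat \<Rightarrow> complex"
  assumes "\<And>b p. b \<in> {1..d+1} \<Longrightarrow> p \<in> B b \<Longrightarrow> g p = f b"
  shows "(\<Sum>p = 1..l+1. g p) = (\<Sum>b = 1..d+1. of_nat (card (B b)) * f b)"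
  unfolding sum_blocks by (intro sum.cong refl) (simp add: assms)

lemma sum_card_blocks: "(\<Sum>b = 1..d+1. card (B b)) = l + 1"
  using sum_blocks[of "\<lambda>_. 1 :: nat"] by simp

lemma log_deriv_block:
  assumes "x \<in> stratum l d B" "b \<in> {1..d+1}" "p \<in> B b"
  shows "log_deriv l x p = log_deriv l x (block_rep B b)"
  using assms block_rep_in[OF assms(2)] unfolding stratum_def log_deriv_def by blast

lemma xi_eq:
  assumes "x \<in> stratum l d B" "b \<in> {1..d+1}"
  shows "xi l B x b = exp (log_deriv l x (block_rep B b))"
  unfolding xi_def
proof (rule the_equality)
  show "\<forall>i\<in>B b. a_fun l x i = exp (log_deriv l x (block_rep B b))"
    using log_deriv_block[OF assms] by (simp add: a_fun_eq_exp)
  fix c assume "\<forall>i\<in>B b. a_fun l x i = c"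
  then show "c = exp (log_deriv l x (block_rep B b))"
    using block_rep_in[OF assms(2)] by (auto simp: a_fun_eq_exp)
qed

lemma a_fun_block:
  "x \<in> stratum l d B \<Longrightarrow> b \<in> {1..d+1} \<Longrightarrow> p \<in> B b \<Longrightarrow> a_fun l x p = xi l B x b"
  by (simp add: a_fun_eq_exp xi_eq log_deriv_block del: atLeastAtMost_iff)

lemma xi_nonzero: "x \<in> stratum l d B \<Longrightarrow> b \<in> {1..d+1} \<Longrightarrow> xi l B x b \<noteq> 0"
  by (simp add: xi_eq del: atLeastAtMost_iff)

lemma prod_xi:
  assumes "x \<in> stratum l d B"
  shows "(\<Prod>b = 1..d+1. xi l B x b ^ card (B b)) = 1"
  using prod_blocks[of "a_fun l x" "xi l B x"] a_fun_block[OF assms] prod_a_fun[of l x] by simp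

context
  fixes k :: nat
  assumes k: "k \<ge> 1"
begin

lemma stratum_point_top: "stratum_point l k d B \<phi> (l + 1) = stratum_top k d B \<phi>"
  by (simp add: stratum_point_def)

lemma x_tilde_stratum_point:
  assumes "i \<le> l + 1"
  shows "x_tilde l (stratum_point l k d B \<phi>) i
    = - (\<Sum>p = 1..i. \<phi> (block_of d B p) - of_nat k / of_nat (l + 1) * stratum_top k d B \<phi>)"
proof -
  consider "i = 0" | "i \<in> {1..l}" | "i = l + 1" using assms by fastforce
  then show ?thesis
  proof cases
    case 2
    then show ?thesis
      unfolding x_tilde_eq[OF 2] by (simp only: stratum_point_def if_True)
  next
    case 3
    have "(\<Sum>p = 1..l+1. \<phi> (block_of d B p) - of_nat k / of_nat (l + 1) * stratum_top k d B \<phi>)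
      = (\<Sum>b = 1..d+1. of_nat (card (B b)) * \<phi> b) - of_nat (l + 1) * (of_nat k / of_nat (l + 1) * stratum_top k d B \<phi>)"
      unfolding sum_subtractf sum_constant
      by (subst sum_blocks_const[of "\<lambda>p. \<phi> (block_of d B p)" \<phi>]) (auto simp: block_of_eq simp del: sum.cl_ivl_Suc atLeastAtMost_iff)
    also have "\<dots> = 0"
      using k by (simp add: stratum_top_def del: of_nat_add of_nat_Suc sum.cl_ivl_Suc)
    finally show ?thesis
      using 3 by simp
  qed simp
qed

lemma log_deriv_stratum_point:
  assumes "p \<in> {1..l+1}"
  shows "log_deriv l (stratum_point l k d B \<phi>) p = \<phi> (block_of d B p) - of_nat k / of_nat (l + 1) * stratum_top k d B \<phi>"
proof -
  obtain i where p: "p = Suc i" using assms by (cases p) auto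
  then have "i \<le> l + 1" "Suc i \<le> l + 1" using assms by auto
  then show ?thesis
    unfolding log_deriv_def p diff_Suc_1 x_tilde_stratum_point[OF \<open>i \<le> l + 1\<close>] x_tilde_stratum_point[OF \<open>Suc i \<le> l + 1\<close>]
    by (simp del: of_nat_add of_nat_Suc)
qed

lemma stratum_point_in: "stratum_point l k d B \<phi> \<in> stratum l d B"
proof -
  have "log_deriv l (stratum_point l k d B \<phi>) p = log_deriv l (stratum_point l k d B \<phi>) q"
    if "b \<in> {1..d+1}" "p \<in> B b" "q \<in> B b" for b p q
    using that block_subset[OF that(1)]
    by (subst (1 2) log_deriv_stratum_point) (auto simp: block_of_eq simp del: atLeastAtMost_iff)
  moreover have "stratum_point l k d B \<phi> \<in> coord_space (l + 1)"
    by (auto simp: coord_space_def stratum_point_def)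
  ultimately show ?thesis
    unfolding stratum_def log_deriv_def by blast
qed

lemma stratum_coord_point:
  assumes "b \<in> {1..d+1}"
  shows "stratum_coord l k B (stratum_point l k d B \<phi>) b = \<phi> b"
  unfolding stratum_coord_def stratum_point_top log_deriv_stratum_point[OF block_rep_range[OF assms]]
    block_of_eq[OF assms block_rep_in[OF assms]] by simp

lemma stratum_top_cong: "(\<And>b. b \<in> {1..d+1} \<Longrightarrow> \<phi> b = \<psi> b) \<Longrightarrow> stratum_top k d B \<phi> = stratum_top k d B \<psi>"
  unfolding stratum_top_def by (intro arg_cong2[of _ _ _ _ "(/)"] sum.cong refl) auto

lemma stratum_point_cong:
  assumes "\<And>b. b \<in> {1..d+1} \<Longrightarrow> \<phi> b = \<psi> b"
  shows "stratum_point l k d B \<phi> = stratum_point l k d B \<psi>"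
proof
  fix i
  have "\<phi> (block_of d B p) = \<psi> (block_of d B p)" if "p \<in> {1..l+1}" for p
    using assms block_of_in(1)[OF that] by blast
  then show "stratum_point l k d B \<phi> i = stratum_point l k d B \<psi> i"
    using stratum_top_cong[of \<phi> \<psi>] assms by (auto simp: stratum_point_def intro!: sum.cong)
qed

lemma stratum_point_coord:
  assumes x: "x \<in> stratum l d B"
  shows "stratum_point l k d B (stratum_coord l k B x) = x"
proof
  let ?\<phi> = "stratum_coord l k B x"
  have coord: "?\<phi> (block_of d B p) = log_deriv l x p + of_nat k / of_nat (l + 1) * x (l + 1)"
    if "p \<in> {1..l+1}" for p
    unfolding stratum_coord_def log_deriv_block[OF x block_of_in[OF that]] ..
  have "(\<Sum>b = 1..d+1. of_nat (card (B b)) * ?\<phi> b) = (\<Sum>p = 1..l+1. ?\<phi> (block_of d B p))"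
    by (rule sum_blocks_const[symmetric]) (simp only: block_of_eq)
  also have "\<dots> = (\<Sum>p = 1..l+1. log_deriv l x p + of_nat k / of_nat (l + 1) * x (l + 1))"
    by (intro sum.cong refl coord)
  also have "\<dots> = of_nat (l + 1) * (of_nat k / of_nat (l + 1) * x (l + 1))"
    unfolding sum.distrib sum_log_deriv sum_constant by simp
  also have "\<dots> = of_nat k * x (l + 1)"
    by (simp del: of_nat_add of_nat_Suc)
  finally have top: "stratum_top k d B ?\<phi> = x (l + 1)"
    using k by (simp add: stratum_top_def)
  fix i
  consider "i \<in> {1..l}" | "i = l + 1" | "i \<notin> {1..l+1}" by fastforce
  then show "stratum_point l k d B ?\<phi> i = x i"
  proof cases
    case 1
    have "(\<Sum>p = 1..i. ?\<phi> (block_of d B p) - of_nat k / of_nat (l + 1) * stratum_top k d B ?\<phi>) = (\<Sum>p = 1..i. log_deriv l x p)"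
      using 1 by (intro sum.cong refl) (simp add: coord top)
    also have "\<dots> = - x i"
      unfolding log_deriv_def sum_telescope_1 x_tilde_eq[OF 1] by simp
    finally have "(\<Sum>p = 1..i. ?\<phi> (block_of d B p) - of_nat k / of_nat (l + 1) * stratum_top k d B ?\<phi>) = - x i" .
    then show ?thesis
      unfolding stratum_point_def using 1 by (simp only: if_True minus_minus)
  next
    case 2
    then show ?thesis using top stratum_point_top by simp
  next
    case 3
    then show ?thesis using x by (auto simp: stratum_point_def stratum_def coord_space_def)
  qed
qed

lemma stratum_coord_inj:
  assumes "x \<in> stratum l d B" "y \<in> stratum l d B"
    and "\<And>b. b \<in> {1..d+1} \<Longrightarrow> stratum_coord l k B x b = stratum_coord l k B y b"
  shows "x = y"
  using stratum_point_coord[OF assms(1)] stratum_point_coord[OF assms(2)]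
    stratum_point_cong[of "stratum_coord l k B x" "stratum_coord l k B y"] assms(3) by metis

lemma stratum_closed_sum:
  assumes "\<And>r. r \<in> S \<Longrightarrow> f r \<in> stratum l d B"
  shows "(\<lambda>i. \<Sum>r\<in>S. t r * f r i) \<in> stratum l d B"
proof -
  have "(\<lambda>i. \<Sum>r\<in>S. t r * f r i) \<in> coord_space (l + 1)"
    using assms by (auto simp: coord_space_def stratum_def intro!: sum.neutral)
  moreover have "log_deriv l (\<lambda>i. \<Sum>r\<in>S. t r * f r i) p = log_deriv l (\<lambda>i. \<Sum>r\<in>S. t r * f r i) q"
    if "b \<in> {1..d+1}" "p \<in> B b" "q \<in> B b" for b p q
  proof -
    have *: "log_deriv l (\<lambda>i. \<Sum>r\<in>S. t r * f r i) p = (\<Sum>r\<in>S. t r * log_deriv l (f r) p)" for p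
      by (simp add: log_deriv_def x_tilde_linear sum_subtractf[symmetric] algebra_simps)
    show ?thesis
      unfolding * using log_deriv_block[OF assms that(1,2)] log_deriv_block[OF assms that(1,3)]
      by (intro sum.cong refl) simp
  qed
  ultimately show ?thesis
    unfolding stratum_def log_deriv_def by blast
qed

lemma linear_frame_exists: "\<exists>f. linear_frame (stratum l d B) (d + 1) f"
proof -
  define f where "f r = stratum_point l k d B (\<lambda>b. if b = r then 1 else 0)" for r
  let ?h = "\<lambda>t. (\<lambda>i. \<Sum>r = 1..d+1. t r * f r i)"
  have in_stratum: "?h t \<in> stratum l d B" for t
    by (rule stratum_closed_sum) (simp add: f_def stratum_point_in)
  have coord: "stratum_coord l k B (?h t) b = t b" if b: "b \<in> {1..d+1}" for t b
  proof -
    have "stratum_coord l k B (?h t) b = (\<Sum>r = 1..d+1. if b = r then t r else 0)"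
      unfolding stratum_coord_linear f_def stratum_coord_point[OF b] by (intro sum.cong refl) simp
    then show ?thesis using b by simp
  qed
  have "bij_betw ?h (coord_space (d + 1)) (stratum l d B)"
  proof (rule bij_betw_byWitness[where f' = "\<lambda>x b. if b \<in> {1..d+1} then stratum_coord l k B x b else 0"])
    show "\<forall>t\<in>coord_space (d + 1). (\<lambda>b. if b \<in> {1..d+1} then stratum_coord l k B (?h t) b else 0) = t"
    proof (intro ballI ext)
      fix t b assume t: "t \<in> coord_space (d + 1)"
      show "(if b \<in> {1..d+1} then stratum_coord l k B (?h t) b else 0) = t b"
      proof (cases "b \<in> {1..d+1}")
        case True
        then show ?thesis by (simp only: coord if_True)
      next
        case False
        then have "t b = 0" using t unfolding coord_space_def by blast
        with False show ?thesis by (simp only: if_False)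
      qed
    qed
    show "\<forall>x\<in>stratum l d B. ?h (\<lambda>b. if b \<in> {1..d+1} then stratum_coord l k B x b else 0) = x"
    proof
      fix x assume x: "x \<in> stratum l d B"
      show "?h (\<lambda>b. if b \<in> {1..d+1} then stratum_coord l k B x b else 0) = x"
        by (rule stratum_coord_inj[OF in_stratum x]) (simp only: coord if_True)
    qed
    show "?h ` coord_space (d + 1) \<subseteq> stratum l d B"
      using in_stratum by blast
    show "(\<lambda>x b. if b \<in> {1..d+1} then stratum_coord l k B x b else 0) ` stratum l d B \<subseteq> coord_space (d + 1)"
      by (auto simp: coord_space_def)
  qed
  then show ?thesis
    unfolding linear_frame_def by blast
qed

lemma linear_frame_in_stratum:
  assumes f: "linear_frame (stratum l d B) (d + 1) f" and r: "r \<in> {1..d+1}"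
  shows "f r \<in> stratum l d B"
proof -
  let ?t = "\<lambda>s. if s = r then 1 else 0 :: complex"
  have "?t \<in> coord_space (d + 1)"
    using r by (auto simp: coord_space_def)
  then have "(\<lambda>i. \<Sum>s = 1..d+1. ?t s * f s i) \<in> stratum l d B"
    using f unfolding linear_frame_def by (auto dest: bij_betwE simp del: sum.cl_ivl_Suc)
  moreover have "(\<lambda>i. \<Sum>s = 1..d+1. ?t s * f s i) = f r"
  proof
    fix i
    have "(\<Sum>s = 1..d+1. ?t s * f s i) = (\<Sum>s = 1..d+1. if s = r then f s i else 0)"
      by (intro sum.cong refl) simp
    then show "(\<Sum>s = 1..d+1. ?t s * f s i) = f r i"
      using r by simp
  qed
  ultimately show ?thesis by simp
qed

text \<open>
  A kernel vector would be a combination of the frame all of whose coordinates vanish.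
\<close>

lemma det_frame_coord_nonzero:
  assumes f: "linear_frame (stratum l d B) (d + 1) f"
  shows "Determinant.det (Matrix.mat (d + 1) (d + 1) (\<lambda>(b, r). stratum_coord l k B (f (r + 1)) (b + 1))) \<noteq> 0"
    (is "Determinant.det ?F \<noteq> 0")
proof
  let ?n = "d + 1"
  assume "Determinant.det ?F = 0"
  then obtain v where v: "v \<in> carrier_vec ?n" "v \<noteq> 0\<^sub>v ?n" "?F *\<^sub>v v = 0\<^sub>v ?n"
    using det_0_iff_vec_prod_zero_field[of ?F ?n] by auto
  define t where "t r = (if r \<in> {1..?n} then vec_index v (r - 1) else 0)" for r
  have t: "t \<in> coord_space ?n"
    by (auto simp: coord_space_def t_def)
  let ?h = "\<lambda>t. (\<lambda>i. \<Sum>r = 1..?n. t r * f r i)"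
  have shift: "(\<Sum>j = 0..<?n. g (j + 1)) = (\<Sum>j = 1..?n. g j)" for g :: "nat \<Rightarrow> complex"
    using sum.atLeast1_atMost_eq[of g ?n] by (simp add: lessThan_atLeast0 del: sum.cl_ivl_Suc sum.op_ivl_Suc)
  have coord: "stratum_coord l k B (?h t) b = 0" if b: "b \<in> {1..?n}" for b
  proof -
    have "stratum_coord l k B (?h t) b = (\<Sum>r = 0..<?n. t (r + 1) * stratum_coord l k B (f (r + 1)) b)"
      unfolding stratum_coord_linear by (rule shift[symmetric])
    also have "\<dots> = vec_index (?F *\<^sub>v v) (b - 1)"
      using b v(1) by (auto simp: scalar_prod_def t_def intro!: sum.cong)
    also have "\<dots> = 0"
      unfolding v(3) using b by auto
    finally show ?thesis .
  qed
  have h0: "?h (\<lambda>_. 0) \<in> stratum l d B" "?h t \<in> stratum l d B"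
    using linear_frame_in_stratum[OF f] by (intro stratum_closed_sum, blast)+
  have "?h t = ?h (\<lambda>_. 0)"
  proof (rule stratum_coord_inj[OF h0(2) h0(1)])
    fix b assume b: "b \<in> {1..d+1}"
    show "stratum_coord l k B (?h t) b = stratum_coord l k B (?h (\<lambda>_. 0)) b"
    proof -
      have "stratum_coord l k B (?h (\<lambda>_. 0)) b = 0"
        unfolding stratum_coord_linear by (simp only: mult_zero_left sum.neutral_const)
      then show ?thesis by (simp only: coord[OF b])
    qed
  qed
  then have "t = (\<lambda>_. 0)"
    using f t unfolding linear_frame_def bij_betw_def
    by (elim conjE inj_onD) (auto simp: coord_space_def)
  then have "vec_index v i = 0" if "i < ?n" for i
  proof -
    have "t (i + 1) = 0" using \<open>t = (\<lambda>_. 0)\<close> by (rule fun_cong)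
    then show ?thesis using that by (simp add: t_def)
  qed
  then have "v = 0\<^sub>v ?n"
    using v(1) by (intro eq_vecI) auto
  with v(2) show False by blast
qed

end

section \<open>The Gram determinant on a stratum\<close>

text \<open>
  The common factor of the orbit polynomial, its cofactors and its slope polynomial on the stratum.
\<close>

definition excess_poly :: "(nat \<Rightarrow> complex) \<Rightarrow> complex poly" where
  "excess_poly x = (\<Prod>b = 1..d+1. [:xi l B x b, 1:] ^ (card (B b) - 1))"

text \<open>
  The multiple of the critical polynomial is kept for \<open>tangent_poly_stratum\<close> to be an exact factorisation; it drops out modulo
  the critical polynomial.
\<close>

definition reduced_tangent_poly :: "nat \<Rightarrow> (nat \<Rightarrow> complex) \<Rightarrow> (nat \<Rightarrow> complex) \<Rightarrow> complex poly" where
  "reduced_tangent_poly k x u = Polynomial.smult (u (l + 1)) (crit_poly d (xi l B x) (\<lambda>b. card (B b)) k)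
    + (\<Sum>b = 1..d+1. Polynomial.smult (of_nat (card (B b)) * xi l B x b * stratum_coord l k B u b) (lin_cofactor d (xi l B x) b))"

context
  fixes x :: "nat \<Rightarrow> complex" and k :: nat
  assumes x: "x \<in> stratum l d B" and k: "k \<in> {1..l}"
begin

lemma orbit_poly_stratum: "orbit_poly l x = excess_poly x * lin_prod d (xi l B x)"
proof -
  have "orbit_poly l x = (\<Prod>b = 1..d+1. [:xi l B x b, 1:] ^ card (B b))"
    unfolding orbit_poly_def lin_prod_def by (rule prod_blocks) (simp only: a_fun_block[OF x])
  also have "\<dots> = (\<Prod>b = 1..d+1. [:xi l B x b, 1:] ^ (card (B b) - 1) * [:xi l B x b, 1:])"
  proof (rule prod.cong[OF refl])
    fix b assume "b \<in> {1..d+1}"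
    then have "card (B b) = Suc (card (B b) - 1)"
      using card_block_pos by fastforce
    then show "[:xi l B x b, 1:] ^ card (B b) = [:xi l B x b, 1:] ^ (card (B b) - 1) * [:xi l B x b, 1:]"
      by (metis power_Suc2)
  qed
  finally show ?thesis
    unfolding excess_poly_def lin_prod_def prod.distrib .
qed

lemma lin_cofactor_stratum:
  assumes b: "b \<in> {1..d+1}" and p: "p \<in> B b"
  shows "lin_cofactor l (a_fun l x) p = excess_poly x * lin_cofactor d (xi l B x) b"
proof -
  have "p \<in> {1..l+1}" using block_subset[OF b] p by blast
  then have "[:xi l B x b, 1:] * lin_cofactor l (a_fun l x) p = orbit_poly l x"
    unfolding a_fun_block[OF x b p, symmetric] orbit_poly_def by (rule lin_prod_eq_cofactor[symmetric])
  also have "\<dots> = [:xi l B x b, 1:] * (excess_poly x * lin_cofactor d (xi l B x) b)"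
    unfolding orbit_poly_stratum lin_prod_eq_cofactor[OF b] by (simp only: ac_simps)
  finally show ?thesis
    by (metis mult_cancel_left pCons_eq_0_iff one_neq_zero)
qed

text \<open>
  Uses \<open>x R\<^sub>b = R - \<xi>\<^sub>b R\<^sub>b\<close> for \<open>R\<close> the product of the linear factors and \<open>R\<^sub>b\<close> its cofactors.
\<close>

lemma pderiv_orbit_poly_stratum:
  "pCons 0 (pderiv (orbit_poly l x)) = excess_poly x * (Polynomial.smult (of_nat (l + 1)) (lin_prod d (xi l B x))
     - (\<Sum>b = 1..d+1. Polynomial.smult (of_nat (card (B b)) * xi l B x b) (lin_cofactor d (xi l B x) b)))"
proof -
  let ?\<xi> = "xi l B x" and ?m = "\<lambda>b. of_nat (card (B b)) :: complex"
  have "pCons 0 (pderiv (orbit_poly l x)) = (\<Sum>p = 1..l+1. pCons 0 (lin_cofactor l (a_fun l x) p))"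
    unfolding orbit_poly_def pderiv_lin_prod by (rule pCons_0_sum)
  also have "\<dots> = (\<Sum>b = 1..d+1. \<Sum>p\<in>B b. pCons 0 (excess_poly x * lin_cofactor d ?\<xi> b))"
    unfolding sum_blocks by (intro sum.cong refl) (simp only: lin_cofactor_stratum)
  also have "\<dots> = (\<Sum>b = 1..d+1. excess_poly x * (Polynomial.smult (?m b) (lin_prod d ?\<xi>) - Polynomial.smult (?m b * ?\<xi> b) (lin_cofactor d ?\<xi> b)))"
  proof (rule sum.cong[OF refl])
    fix b assume b: "b \<in> {1..d+1}"
    have "pCons 0 (lin_cofactor d ?\<xi> b) = lin_prod d ?\<xi> - Polynomial.smult (?\<xi> b) (lin_cofactor d ?\<xi> b)"
      unfolding lin_prod_eq_cofactor[OF b] by simp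
    then have "pCons 0 (excess_poly x * lin_cofactor d ?\<xi> b) = excess_poly x * (lin_prod d ?\<xi> - Polynomial.smult (?\<xi> b) (lin_cofactor d ?\<xi> b))"
      by (metis mult_pCons_right smult_0_left add_0_left)
    then show "(\<Sum>p\<in>B b. pCons 0 (excess_poly x * lin_cofactor d ?\<xi> b))
        = excess_poly x * (Polynomial.smult (?m b) (lin_prod d ?\<xi>) - Polynomial.smult (?m b * ?\<xi> b) (lin_cofactor d ?\<xi> b))"
      by (simp add: of_nat_poly smult_diff_right right_diff_distrib mult.commute)
  qed
  also have "\<dots> = excess_poly x * (Polynomial.smult (\<Sum>b = 1..d+1. ?m b) (lin_prod d ?\<xi>)
     - (\<Sum>b = 1..d+1. Polynomial.smult (?m b * ?\<xi> b) (lin_cofactor d ?\<xi> b)))"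
    unfolding sum_distrib_left[symmetric] sum_subtractf smult_sum ..
  also have "(\<Sum>b = 1..d+1. ?m b) = of_nat (l + 1)"
    unfolding of_nat_sum[symmetric] sum_card_blocks ..
  finally show ?thesis .
qed

lemma slope_poly_stratum: "slope_poly l k x = excess_poly x * crit_poly d (xi l B x) (\<lambda>b. card (B b)) k"
  unfolding slope_poly_def pderiv_orbit_poly_stratum
  unfolding orbit_poly_stratum crit_poly_def sum_card_blocks
  by (simp add: right_diff_distrib smult_diff_left del: of_nat_add of_nat_Suc sum.cl_ivl_Suc)

lemma tangent_poly_stratum:
  assumes u: "u \<in> stratum l d B"
  shows "tangent_poly l k x (dy_apply l k x u) = excess_poly x * reduced_tangent_poly k x u"
proof -
  let ?\<xi> = "xi l B x" and ?m = "\<lambda>b. of_nat (card (B b)) :: complex"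
  let ?R = "lin_prod d ?\<xi>" and ?C = "lin_cofactor d ?\<xi>" and ?n = "of_nat (l + 1) :: complex"
  let ?W = "\<Sum>b = 1..d+1. Polynomial.smult (?m b * ?\<xi> b) (?C b)"
  let ?\<theta> = "\<lambda>b. log_deriv l u (block_rep B b)" and ?\<tau> = "u (l + 1)"
  define V where "V = (\<Sum>b = 1..d+1. Polynomial.smult (?m b * ?\<xi> b * ?\<theta> b) (?C b))"
  have n0: "?n \<noteq> 0" by (simp del: of_nat_add of_nat_Suc)
  have "(\<Sum>p = 1..l+1. Polynomial.smult (log_deriv l u p * a_fun l x p) (lin_cofactor l (a_fun l x) p))
     = (\<Sum>b = 1..d+1. \<Sum>p\<in>B b. Polynomial.smult (?\<theta> b * ?\<xi> b) (excess_poly x * ?C b))"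
    unfolding sum_blocks by (intro sum.cong refl) (simp only: lin_cofactor_stratum log_deriv_block[OF u] a_fun_block[OF x])
  also have "\<dots> = (\<Sum>b = 1..d+1. excess_poly x * Polynomial.smult (?m b * ?\<xi> b * ?\<theta> b) (?C b))"
    by (intro sum.cong refl) (simp add: of_nat_poly ac_simps)
  also have "\<dots> = excess_poly x * V"
    unfolding V_def sum_distrib_left ..
  finally have 1: "(\<Sum>p = 1..l+1. Polynomial.smult (log_deriv l u p * a_fun l x p) (lin_cofactor l (a_fun l x) p)) = excess_poly x * V" .
  have "reduced_tangent_poly k x u = Polynomial.smult ?\<tau> (Polynomial.smult (?n - of_nat k) ?R - ?W) + (V + Polynomial.smult (of_nat k / ?n * ?\<tau>) ?W)"
  proof -
    have "(\<Sum>b = 1..d+1. Polynomial.smult (?m b * ?\<xi> b * stratum_coord l k B u b) (?C b)) = V + Polynomial.smult (of_nat k / ?n * ?\<tau>) ?W"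
      unfolding V_def smult_sum_right sum.distrib[symmetric] stratum_coord_def
      by (intro sum.cong refl) (simp add: smult_add_left[symmetric] ring_distribs ac_simps del: of_nat_add of_nat_Suc)
    then show ?thesis
      unfolding reduced_tangent_poly_def crit_poly_def sum_card_blocks by (simp only:)
  qed
  also have "\<dots> = V + Polynomial.smult ((?n - of_nat k) / ?n * ?\<tau>) (Polynomial.smult ?n ?R - ?W)"
  proof (rule poly_eqI)
    fix i
    have "t * ((n - c) * r - w) + (v + c / n * t * w) = v + (n - c) / n * t * (n * r - w)"
      if "n \<noteq> 0" for t n c r w v :: complex
      using that by (simp add: field_simps)
    then show "coeff (Polynomial.smult ?\<tau> (Polynomial.smult (?n - of_nat k) ?R - ?W) + (V + Polynomial.smult (of_nat k / ?n * ?\<tau>) ?W)) i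
       = coeff (V + Polynomial.smult ((?n - of_nat k) / ?n * ?\<tau>) (Polynomial.smult ?n ?R - ?W)) i"
      unfolding coeff_add coeff_diff coeff_smult using n0 by blast
  qed
  finally have 2: "reduced_tangent_poly k x u = V + Polynomial.smult ((?n - of_nat k) / ?n * ?\<tau>) (Polynomial.smult ?n ?R - ?W)" .
  show ?thesis
    unfolding tangent_poly_dy_apply[OF k] 1 2 pderiv_orbit_poly_stratum distrib_left mult_smult_right ..
qed

lemma crit_poly_stratum_facts:
  "degree (crit_poly d (xi l B x) (\<lambda>b. card (B b)) k) = Suc d"
  "coeff (crit_poly d (xi l B x) (\<lambda>b. card (B b)) k) (Suc d) = of_nat (l + 1) - of_nat k"
  "coeff (crit_poly d (xi l B x) (\<lambda>b. card (B b)) k) 0 \<noteq> 0"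
proof -
  show "degree (crit_poly d (xi l B x) (\<lambda>b. card (B b)) k) = Suc d"
    by (rule degree_crit_poly) (unfold sum_card_blocks, use k in auto)
  show "coeff (crit_poly d (xi l B x) (\<lambda>b. card (B b)) k) (Suc d) = of_nat (l + 1) - of_nat k"
    unfolding coeff_crit_poly_top sum_card_blocks ..
  show "coeff (crit_poly d (xi l B x) (\<lambda>b. card (B b)) k) 0 \<noteq> 0"
    unfolding poly_0_coeff_0[symmetric] poly_crit_poly_0 using k xi_nonzero[OF x] by auto
qed

lemma saito_pullback_stratum:
  assumes \<kappa>: "\<kappa> \<noteq> 0" and u: "u \<in> stratum l d B" and v: "v \<in> stratum l d B"
    and w: "excess_poly x = crit_poly d (xi l B x) (\<lambda>b. card (B b)) k * s + monom 1 (Suc k) * w"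
  shows "saito_pullback l k \<kappa> x u v = - (y_scale l k k x / (\<kappa> * (of_nat (l + 1) - of_nat k)))
     * coeff ((w * reduced_tangent_poly k x u * reduced_tangent_poly k x v) mod crit_poly d (xi l B x) (\<lambda>b. card (B b)) k) d"
proof -
  let ?Q = "crit_poly d (xi l B x) (\<lambda>b. card (B b)) k"
  have t0: "coeff (excess_poly x * ?Q) 0 \<noteq> 0"
    unfolding slope_poly_stratum[symmetric] using slope_poly_facts(4)[OF k \<kappa>] .
  have "saito_pullback l k \<kappa> x u v
     = y_scale l k k x / \<kappa> * residue_0_inf (excess_poly x * ?Q) k
         ((excess_poly x * reduced_tangent_poly k x v) * (excess_poly x * reduced_tangent_poly k x u))"
    unfolding saito_pullback_def saito_covariant_pairing[OF k \<kappa>] tangent_poly_stratum[OF u] tangent_poly_stratum[OF v]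
      slope_poly_stratum ..
  also have "residue_0_inf (excess_poly x * ?Q) k
         ((excess_poly x * reduced_tangent_poly k x v) * (excess_poly x * reduced_tangent_poly k x u))
     = - coeff ((w * reduced_tangent_poly k x v * reduced_tangent_poly k x u) mod ?Q) (degree ?Q - 1) / lead_coeff ?Q"
    by (rule residue_0_inf_factor[OF t0 _ w]) (simp add: crit_poly_stratum_facts)
  also have "w * reduced_tangent_poly k x v * reduced_tangent_poly k x u = w * reduced_tangent_poly k x u * reduced_tangent_poly k x v"
    by (simp only: ac_simps)
  finally show ?thesis
    unfolding crit_poly_stratum_facts diff_Suc_1 by simp
qed

text \<open>
  The residue pairing factors through the critical polynomial, so \<open>det_stratum_form\<close> applies. The scale of \<open>y\<^sub>k\<close> is a
  constant times \<open>a\<^sub>0\<close> and enters once per dimension.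
\<close>

lemma det_saito_gram:
  assumes \<kappa>: "\<kappa> \<noteq> 0" and f: "linear_frame (stratum l d B) (d + 1) f"
  shows "Determinant.det (saito_gram l k \<kappa> (d + 1) f x) =
    (- (of_nat (orbit_mult l k) / (\<kappa> * (of_nat (l + 1) - of_nat k)))) ^ (d + 1)
      * stratum_const d (\<lambda>b. card (B b)) k
      * Determinant.det (Matrix.mat (d + 1) (d + 1) (\<lambda>(b, r). stratum_coord l k B (f (r + 1)) (b + 1))) ^ 2
      * (\<Prod>b = 1..d+1. \<Prod>a\<in>{1..<b}. (- 1) ^ card (B a))
      * a0 l k x ^ (d + 1) * (\<Prod>b = 1..d+1. xi l B x b powi (- int k))
      * (\<Prod>b = 1..d+1. \<Prod>a\<in>{1..<b}. (xi l B x a - xi l B x b) ^ (card (B a) + card (B b)))"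
proof -
  let ?\<xi> = "xi l B x" and ?m = "\<lambda>b. card (B b)" and ?n = "d + 1"
  let ?Q = "crit_poly d ?\<xi> ?m k"
  let ?\<nu> = "\<lambda>r. reduced_tangent_poly k x (f (r + 1))"
  define c where "c = - (of_nat (orbit_mult l k) / (\<kappa> * (of_nat (l + 1) - of_nat k)))"
  obtain s w where w: "excess_poly x = ?Q * s + monom 1 (Suc k) * w"
    using expansion_at_0_exists[OF crit_poly_stratum_facts(3), of "excess_poly x" "Suc k"] by blast
  let ?G = "Matrix.mat ?n ?n (\<lambda>(r, s). coeff ((w * ?\<nu> r * ?\<nu> s) mod ?Q) d)"
  have in_stratum: "f (r + 1) \<in> stratum l d B" if "r < ?n" for r
    using linear_frame_in_stratum[OF _ f, of 1 "r + 1"] that by auto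
  have scale: "- (y_scale l k k x / (\<kappa> * (of_nat (l + 1) - of_nat k))) = c * a0 l k x"
    by (simp add: c_def y_scale_def a0_def)
  have "saito_gram l k \<kappa> ?n f x = (c * a0 l k x) \<cdot>\<^sub>m ?G"
    unfolding saito_gram_def
    by (rule eq_matI) (simp_all add: saito_pullback_stratum[OF \<kappa> in_stratum in_stratum w, unfolded scale, simplified])
  then have "Determinant.det (saito_gram l k \<kappa> ?n f x) = (c * a0 l k x) ^ ?n * Determinant.det ?G"
    by simp
  also have "Determinant.det ?G = stratum_const d ?m k
      * Determinant.det (Matrix.mat ?n ?n (\<lambda>(b, r). stratum_coord l k B (f (r + 1)) (b + 1))) ^ 2
      * (\<Prod>b = 1..d+1. ?\<xi> b ^ ?m b) * (\<Prod>b = 1..d+1. ?\<xi> b powi (- int k))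
      * (\<Prod>b = 1..d+1. poly (lin_cofactor d ?\<xi> b) (- ?\<xi> b) ^ ?m b)"
  proof (rule det_stratum_form[where \<phi> = "\<lambda>r. stratum_coord l k B (f (r + 1))"])
    show "?\<xi> b \<noteq> 0" if "b \<in> {1..d+1}" for b using xi_nonzero[OF x that] .
    show "?m b \<ge> 1" if "b \<in> {1..d+1}" for b using card_block_pos[OF that] .
    show "1 \<le> k" "k < (\<Sum>b = 1..d+1. ?m b)" unfolding sum_card_blocks using k by auto
    show "(\<Prod>b = 1..d+1. [:?\<xi> b, 1:] ^ (?m b - 1)) = ?Q * s + monom 1 (Suc k) * w"
      using w unfolding excess_poly_def .
    show "?\<nu> r mod ?Q = (\<Sum>b = 1..d+1. Polynomial.smult (of_nat (?m b) * ?\<xi> b * stratum_coord l k B (f (r + 1)) b) (lin_cofactor d ?\<xi> b)) mod ?Q" for r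
      unfolding reduced_tangent_poly_def by (simp only: mod_smult_left poly_mod_add_left mod_self smult_0_right add_0_left)
  qed
  finally show ?thesis
    unfolding prod_xi[OF x] prod_cofactor_values c_def[symmetric] power_mult_distrib by (simp only: ac_simps mult_1_right mult_1_left)
qed

end

end

lemma stratum_const_nonzero:
  assumes "\<And>b. b \<in> {1..d+1} \<Longrightarrow> m b \<ge> 1" "1 \<le> k" "k < (\<Sum>b = 1..d+1. m b)"
  shows "stratum_const d m k \<noteq> 0"
proof -
  have "(of_nat (\<Sum>b = 1..d+1. m b) :: complex) \<noteq> of_nat k"
    using assms(3) by (simp only: of_nat_eq_iff)
  moreover have "m b \<noteq> 0" if "b \<in> {1..d+1}" for b
    using assms(1)[OF that] by simp
  ultimately show ?thesis
    using assms(2) unfolding stratum_const_def by (simp add: prod_zero_iff del: sum.cl_ivl_Suc prod.cl_ivl_Suc)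
qed

theorem theorem2p4:
  fixes l k d :: nat and B :: "nat \<Rightarrow> nat set" and \<kappa> :: complex
  assumes "1 \<le> k" and "k \<le> l"
    and "is_block_partition l d B"
    and "\<kappa> \<noteq> 0"
  shows "(\<exists>f. linear_frame (stratum l d B) (d + 1) f) \<and>
    (\<forall>f. linear_frame (stratum l d B) (d + 1) f \<longrightarrow>
      (\<exists>c. c \<noteq> 0 \<and> (\<forall>x \<in> stratum l d B.
         Determinant.det (saito_gram l k \<kappa> (d + 1) f x) =
           c * a0 l k x ^ (d + 1)
             * (\<Prod>a = 1..d+1. xi l B x a powi (- int k))
             * (\<Prod>b = 1..d+1. \<Prod>a \<in> {1..<b}.
                  (xi l B x a - xi l B x b) ^ (card (B a) + card (B b))))))"
proof (intro conjI allI impI)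
  show "\<exists>f. linear_frame (stratum l d B) (d + 1) f"
    using assms by (intro linear_frame_exists)
  fix f assume f: "linear_frame (stratum l d B) (d + 1) f"
  have k: "k \<in> {1..l}" using assms by simp
  let ?m = "\<lambda>b. card (B b)"
  let ?\<Phi> = "Determinant.det (Matrix.mat (d + 1) (d + 1) (\<lambda>(b, r). stratum_coord l k B (f (r + 1)) (b + 1)))"
  define c where "c = (- (of_nat (orbit_mult l k) / (\<kappa> * (of_nat (l + 1) - of_nat k)))) ^ (d + 1)
      * stratum_const d ?m k * ?\<Phi> ^ 2 * (\<Prod>b = 1..d+1. \<Prod>a\<in>{1..<b}. (- 1) ^ ?m a)"
  have "(of_nat (l + 1) :: complex) \<noteq> of_nat k"
    using assms by (simp only: of_nat_eq_iff)
  then have "(- (of_nat (orbit_mult l k) / (\<kappa> * (of_nat (l + 1) - of_nat k)))) ^ (d + 1) \<noteq> (0 :: complex)"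
    using assms(4) orbit_mult_pos[of l k] by (simp del: of_nat_add of_nat_Suc power_Suc)
  moreover have "stratum_const d ?m k \<noteq> 0"
    using card_block_pos[OF assms(3)] sum_card_blocks[OF assms(3)] assms(1,2)
    by (intro stratum_const_nonzero) auto
  moreover have "?\<Phi> \<noteq> 0"
    by (rule det_frame_coord_nonzero[OF assms(3,1) f])
  moreover have "(\<Prod>b = 1..d+1. \<Prod>a\<in>{1..<b}. (- 1) ^ ?m a) \<noteq> (0 :: complex)"
    by (simp add: prod_zero_iff del: prod.cl_ivl_Suc)
  ultimately have "c \<noteq> 0"
    unfolding c_def by (simp only: mult_eq_0_iff power_eq_0_iff simp_thms)
  then show "\<exists>c. c \<noteq> 0 \<and> (\<forall>x \<in> stratum l d B.
         Determinant.det (saito_gram l k \<kappa> (d + 1) f x) =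
           c * a0 l k x ^ (d + 1)
             * (\<Prod>a = 1..d+1. xi l B x a powi (- int k))
             * (\<Prod>b = 1..d+1. \<Prod>a \<in> {1..<b}.
                  (xi l B x a - xi l B x b) ^ (card (B a) + card (B b))))"
    using det_saito_gram[OF assms(3) _ k assms(4) f] unfolding c_def by blast
qed

end
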